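(* (1) Given any primely generated conical refinement monoid $M$, there is a poset $I$ and an $I$-system $\mathcal J$ such that $M\cong M(\mathcal J)$. (2) For any poset $I$ and any $I$-system $\mathcal J$, the monoid $M(\mathcal J)$ is a primely generated conical refinement monoid. Moreover, $M(\mathcal J)$ is a tame monoid.
   Context: All monoids and semigroups are commutative, written additively; $\mathbb N=\{1,2,\dots\}$. For a monoid $M$, $x\le y$ means $y=x+z$ for some $z\in M$. $M$ is conical if $x+y=0$ implies $x=y=0$. $M$ is a refinement monoid if whenever $a+b=c+d$ there are $w,x,y,z\in M$ with $a=w+x$, $b=y+z$, $c=w+y$, $d=x+z$. An element $p$ is prime if it is not invertible and $p\le a+b$ implies $p\le a$ or $p\le b$. $M$ is primely generated if every non-invertible element is a sum of primes. A refinement monoid is tame if it is a direct limit of finitely generated refinement monoids. $I$-systems. Let $(I,\le)$ be a poset. An $I$-system $\mathcal J=(I,\le,(G_i)_{i\in I},\varphi_{ji}\,(i<j))$ consists of: (a) a partition $I=I_{\rm free}\sqcup I_{\rm reg}$ (one part may be empty); (b) abelian groups $G_i$, $i\in I$; put $M_i=\widehat G_i=G_i$ if $i\in I_{\rm reg}$, and $M_i=\mathbb N\times G_i$, $\widehat G_i=\mathbb Z\times G_i$ if $i\in I_{\rm free}$ (so $\widehat G_i$ is the Grothendieck group of $M_i$); $G_i$ is viewed as the subgroup $\{0\}\times G_i$ of $\widehat G_i$ when $i$ is free; (c) semigroup homomorphisms $\varphi_{ji}\colon M_i\to G_j$ for $i<j$, with unique extensions to group homomorphisms $\widehat\varphi_{ji}\colon\widehat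 G_i\to G_j\subseteq\widehat G_j$, such that: (c1) $i\mapsto\widehat G_i$, $(i<j)\mapsto\widehat\varphi_{ji}$, with $\widehat\varphi_{ii}=\mathrm{id}$, is a functor from $I$ to abelian groups; (c2) for each $i\in I_{\rm free}$ the map $\bigoplus_{k<i}\varphi_{ik}\colon\bigoplus_{k<i}M_k\to G_i$ (coproduct of commutative semigroups) is surjective, i.e. every element of $G_i$ is a finite sum of elements $\varphi_{ik}(x)$ with $k<i$, $x\in M_k$ (for $i$ minimal in $I$ this means that $G_i$ is trivial). The monoid $M(\mathcal J)$. Let $A(I)$ be the set of lower subsets $a$ of $I$ such that the set $\mathrm{Max}(a)$ of maximal elements of $a$ is finite and every element of $a$ lies below some element of $\mathrm{Max}(a)$ (including $a=\emptyset$). For $a\in A(I)$ let $\widehat H_a=\bigoplus_{i\in a}\widehat G_i$; for $i\in a$, $u\in\widehat G_i$ let $\chi(a,i,u)\in\widehat H_a$ have $i$-th component $u$ and all other components $0$; let $U_a$ be the subgroup of $\widehat H_a$ generated by all $\chi(a,i,u)-\chi(a,j,\widehat\varphi_{ji}(u))$ with $i<j$, $j\in\mathrm{Max}(a)$, $u\in\widehat G_i$. Let $H_a$ be the subsemigroup of all $(z_i)_{i\in a}\in\widehat H_a$ with $z_i\in\mathbb N\times G_i$ for each free $i\in\mathrm{Max}(a)$ and $z_i\in\{(0,0_i)\}\cup(\mathbb N\times G_i)$ for each free $i\in a\setminus\mathrm{Max}(a)$ (no condition for regular $i$). Put $M_a=H_a/{\sim}$, where $x\sim y$ iff $x-y\in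 U_a$. For $a\subseteq b$ let $f_a^b\colon\widehat H_a\to\widehat H_b$ be the canonical embedding. Then $M(\mathcal J)=\bigsqcup_{a\in A(I)}M_a$ with addition $[x]+[y]=[f_a^{a\cup b}(x)+f_b^{a\cup b}(y)]\in M_{a\cup b}$ for $x\in H_a$, $y\in H_b$. *)

theory Defs
  imports "HOL-Algebra.Divisibility" "HOL-Algebra.Product_Groups"
begin

text \<open>
  Commutative monoids are HOL-Algebra structures, written multiplicatively: the algebraic order
  \<open>x \<le> y\<close> is \<open>x divides y\<close>, and prime elements (not invertible, \<open>p \<le> a + b\<close> implies
  \<open>p \<le> a\<close> or \<open>p \<le> b\<close>) are those satisfying \<open>Divisibility.prime\<close>.
\<close>

section \<open>Classes of commutative monoids\<close>

definition finite_sums :: "('a, 'b) monoid_scheme \<Rightarrow> 'a set \<Rightarrow> 'a set" where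
  "finite_sums M S = {foldr (\<otimes>\<^bsub>M\<^esub>) xs \<one>\<^bsub>M\<^esub> | xs. set xs \<subseteq> S}"

definition conical :: "('a, 'b) monoid_scheme \<Rightarrow> bool" where
  "conical M \<longleftrightarrow>
     (\<forall>x\<in>carrier M. \<forall>y\<in>carrier M. x \<otimes>\<^bsub>M\<^esub> y = \<one>\<^bsub>M\<^esub> \<longrightarrow> x = \<one>\<^bsub>M\<^esub> \<and> y = \<one>\<^bsub>M\<^esub>)"

definition refinement_monoid :: "('a, 'b) monoid_scheme \<Rightarrow> bool" where
  "refinement_monoid M \<longleftrightarrow> comm_monoid M \<and>
     (\<forall>a\<in>carrier M. \<forall>b\<in>carrier M. \<forall>c\<in>carrier M. \<forall>d\<in>carrier M.
        a \<otimes>\<^bsub>M\<^esub> b = c \<otimes>\<^bsub>M\<^esub> d \<longrightarrow>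
        (\<exists>w\<in>carrier M. \<exists>x\<in>carrier M. \<exists>y\<in>carrier M. \<exists>z\<in>carrier M.
           a = w \<otimes>\<^bsub>M\<^esub> x \<and> b = y \<otimes>\<^bsub>M\<^esub> z \<and> c = w \<otimes>\<^bsub>M\<^esub> y \<and> d = x \<otimes>\<^bsub>M\<^esub> z))"

definition primely_generated :: "('a, 'b) monoid_scheme \<Rightarrow> bool" where
  "primely_generated M \<longleftrightarrow>
     carrier M - Units M \<subseteq> finite_sums M {p \<in> carrier M. Divisibility.prime M p}"

definition finitely_generated_monoid :: "('a, 'b) monoid_scheme \<Rightarrow> bool" where
  "finitely_generated_monoid M \<longleftrightarrow>
     (\<exists>S. finite S \<and> S \<subseteq> carrier M \<and> carrier M = finite_sums M S)"

section \<open>Direct limits and tame monoids\<close>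

definition direct_system ::
  "'l set \<Rightarrow> ('l \<times> 'l) set \<Rightarrow> ('l \<Rightarrow> 'm monoid) \<Rightarrow> ('l \<Rightarrow> 'l \<Rightarrow> 'm \<Rightarrow> 'm) \<Rightarrow> bool" where
  "direct_system L r N f \<longleftrightarrow>
     L \<noteq> {} \<and> partial_order_on L r \<and>
     (\<forall>i\<in>L. \<forall>j\<in>L. \<exists>k\<in>L. (i, k) \<in> r \<and> (j, k) \<in> r) \<and>
     (\<forall>i\<in>L. comm_monoid (N i)) \<and>
     (\<forall>(i, j)\<in>r. f i j \<in> hom (N i) (N j) \<and> f i j \<one>\<^bsub>N i\<^esub> = \<one>\<^bsub>N j\<^esub>) \<and>
     (\<forall>i\<in>L. \<forall>x\<in>carrier (N i). f i i x = x) \<and>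
     (\<forall>i j k. (i, j) \<in> r \<longrightarrow> (j, k) \<in> r \<longrightarrow>
        (\<forall>x\<in>carrier (N i). f i k x = f j k (f i j x)))"

definition direct_limit_rel ::
  "'l set \<Rightarrow> ('l \<times> 'l) set \<Rightarrow> ('l \<Rightarrow> 'm monoid) \<Rightarrow> ('l \<Rightarrow> 'l \<Rightarrow> 'm \<Rightarrow> 'm) \<Rightarrow>
     (('l \<times> 'm) \<times> ('l \<times> 'm)) set" where
  "direct_limit_rel L r N f =
     {((i, x), (j, y)) | i x j y. i \<in> L \<and> j \<in> L \<and> x \<in> carrier (N i) \<and> y \<in> carrier (N j) \<and>
        (\<exists>k\<in>L. (i, k) \<in> r \<and> (j, k) \<in> r \<and> f i k x = f j k y)}"

definition direct_limit ::
  "'l set \<Rightarrow> ('l \<times> 'l) set \<Rightarrow> ('l \<Rightarrow> 'm monoid) \<Rightarrow> ('l \<Rightarrow> 'l \<Rightarrow> 'm \<Rightarrow> 'm) \<Rightarrow>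
     ('l \<times> 'm) set monoid" where
  "direct_limit L r N f =
     \<lparr>carrier = (SIGMA i:L. carrier (N i)) // direct_limit_rel L r N f,
      monoid.mult = (\<lambda>A B. \<Union>{direct_limit_rel L r N f `` {(k, f i k x \<otimes>\<^bsub>N k\<^esub> f j k y)} | i x j y k.
        (i, x) \<in> A \<and> (j, y) \<in> B \<and> (i, k) \<in> r \<and> (j, k) \<in> r}),
      one = (\<Union>i\<in>L. direct_limit_rel L r N f `` {(i, \<one>\<^bsub>N i\<^esub>)})\<rparr>"

text \<open>
  The types of the direct system are no restriction. A finitely generated commutative monoid is
  countable, hence isomorphic to one with carrier in \<^typ>\<open>nat\<close>. The index set of a direct system of
  countable monoids with limit \<open>M\<close> has a directed subset of cardinality at most
  \<open>max |M| \<aleph>\<^sub>0\<close> with the same limit (choose a representative of each element of \<open>M\<close>, then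
  close countably often under upper bounds and under witnesses of identifications), and this
  subset embeds into \<^typ>\<open>'a list set\<close>.
\<close>

definition tame :: "('a, 'b) monoid_scheme \<Rightarrow> bool" where
  "tame M \<longleftrightarrow> refinement_monoid M \<and>
     (\<exists>(L :: 'a list set set) r (N :: 'a list set \<Rightarrow> nat monoid) f.
        direct_system L r N f \<and>
        (\<forall>i\<in>L. finitely_generated_monoid (N i) \<and> refinement_monoid (N i)) \<and>
        M \<cong> direct_limit L r N f)"

section \<open>I-systems\<close>

text \<open>
  Both kinds of components are represented in \<^typ>\<open>int \<times> 'g\<close>. For regular \<open>i\<close> the first coordinate
  is always \<open>0\<close>, so that \<open>G\<^sub>i\<close> is replaced by its copy \<open>{0} \<times> G\<^sub>i\<close>; the identification of
  \<open>G\<^sub>i\<close> with a subgroup of \<open>grothendieck J i\<close> is then \<open>g \<mapsto> (0, g)\<close> in both cases.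
  The map \<open>\<phi>\<^sub>j\<^sub>i : M\<^sub>i \<rightarrow> G\<^sub>j\<close> is \<open>phi J j i\<close>. The regular indices are \<open>index J - free J\<close>.
\<close>

text \<open>
  Every primely generated conical refinement monoid on a type \<^typ>\<open>'a\<close> leaves room for its I-system in
  \<^typ>\<open>'a\<close>: the indices can be taken to be representatives \<open>p\<close> of the primes modulo
  \<open>p \<le> q \<le> p\<close>, and \<open>G\<^sub>p\<close> to be the set \<open>{x. p \<le> x \<le> p}\<close> with a suitable operation.
\<close>

record ('i, 'g) i_system =
  index :: "'i set"
  order_rel :: "('i \<times> 'i) set"
  free :: "'i set"
  grp :: "'i \<Rightarrow> 'g monoid"
  phi :: "'i \<Rightarrow> 'i \<Rightarrow> int \<times> 'g \<Rightarrow> 'g"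

definition below :: "('i, 'g) i_system \<Rightarrow> 'i \<Rightarrow> 'i \<Rightarrow> bool" where
  "below J i j \<longleftrightarrow> (i, j) \<in> order_rel J \<and> i \<noteq> j"

definition grothendieck :: "('i, 'g) i_system \<Rightarrow> 'i \<Rightarrow> (int \<times> 'g) monoid" where
  "grothendieck J i =
     (integer_group \<times>\<times> grp J i)
       \<lparr>carrier := (if i \<in> free J then UNIV else {0}) \<times> carrier (grp J i)\<rparr>"

text \<open>The semigroup \<open>M\<^sub>i\<close>; for free \<open>i\<close> the field \<^const>\<open>one\<close> is not in the carrier and is junk.\<close>

definition component :: "('i, 'g) i_system \<Rightarrow> 'i \<Rightarrow> (int \<times> 'g) monoid" where
  "component J i =
     (grothendieck J i)
       \<lparr>carrier := (if i \<in> free J then {1..} else {0}) \<times> carrier (grp J i)\<rparr>"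

text \<open>
  The unique extension of \<open>phi J j i\<close> to the Grothendieck group; it exists whenever
  \<open>phi J j i\<close> is a semigroup homomorphism into the group \<open>G\<^sub>j\<close>.
\<close>

definition phi_ext :: "('i, 'g) i_system \<Rightarrow> 'i \<Rightarrow> 'i \<Rightarrow> int \<times> 'g \<Rightarrow> 'g" where
  "phi_ext J j i =
     (THE h. h \<in> hom (grothendieck J i) (grp J j) \<and>
             h \<in> extensional (carrier (grothendieck J i)) \<and>
             (\<forall>u\<in>carrier (component J i). h u = phi J j i u))"

definition phi_hat :: "('i, 'g) i_system \<Rightarrow> 'i \<Rightarrow> 'i \<Rightarrow> int \<times> 'g \<Rightarrow> int \<times> 'g" where
  "phi_hat J j i u = (if i = j then u else (0, phi_ext J j i u))"

definition is_i_system :: "('i, 'g) i_system \<Rightarrow> bool" where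
  "is_i_system J \<longleftrightarrow>
     partial_order_on (index J) (order_rel J) \<and>
     free J \<subseteq> index J \<and>
     (\<forall>i\<in>index J. comm_group (grp J i)) \<and>
     (\<forall>i j. below J i j \<longrightarrow> phi J j i \<in> hom (component J i) (grp J j)) \<and>
     (\<forall>i j k. (i, j) \<in> order_rel J \<longrightarrow> (j, k) \<in> order_rel J \<longrightarrow>
        (\<forall>u\<in>carrier (grothendieck J i). phi_hat J k i u = phi_hat J k j (phi_hat J j i u))) \<and>
     (\<forall>i\<in>free J. carrier (grp J i) =
        finite_sums (grp J i) {phi J i k x | k x. below J k i \<and> x \<in> carrier (component J k)})"

section \<open>The monoid of an I-system\<close>

definition max_elems :: "('i, 'g) i_system \<Rightarrow> 'i set \<Rightarrow> 'i set" where
  "max_elems J a = {m \<in> a. \<not> (\<exists>i\<in>a. below J m i)}"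

definition lower_sets :: "('i, 'g) i_system \<Rightarrow> 'i set set" where
  "lower_sets J =
     {a. a \<subseteq> index J \<and> (\<forall>i j. j \<in> a \<longrightarrow> (i, j) \<in> order_rel J \<longrightarrow> i \<in> a) \<and>
         finite (max_elems J a) \<and>
         (\<forall>i\<in>a. \<exists>m\<in>max_elems J a. (i, m) \<in> order_rel J)}"

definition H_hat :: "('i, 'g) i_system \<Rightarrow> 'i set \<Rightarrow> ('i \<Rightarrow> int \<times> 'g) monoid" where
  "H_hat J a = sum_group a (grothendieck J)"

definition chi :: "('i, 'g) i_system \<Rightarrow> 'i set \<Rightarrow> 'i \<Rightarrow> int \<times> 'g \<Rightarrow> 'i \<Rightarrow> int \<times> 'g" where
  "chi J a i u = (\<lambda>k\<in>a. if k = i then u else \<one>\<^bsub>grothendieck J k\<^esub>)"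

definition U_rel :: "('i, 'g) i_system \<Rightarrow> 'i set \<Rightarrow> ('i \<Rightarrow> int \<times> 'g) set" where
  "U_rel J a = generate (H_hat J a)
     {chi J a i u \<otimes>\<^bsub>H_hat J a\<^esub> inv\<^bsub>H_hat J a\<^esub> chi J a j (phi_hat J j i u) | i j u.
        below J i j \<and> j \<in> max_elems J a \<and> u \<in> carrier (grothendieck J i)}"

definition H_pos :: "('i, 'g) i_system \<Rightarrow> 'i set \<Rightarrow> ('i \<Rightarrow> int \<times> 'g) set" where
  "H_pos J a =
     {z \<in> carrier (H_hat J a). \<forall>i\<in>a. i \<in> free J \<longrightarrow>
        z i \<in> carrier (component J i) \<or> i \<notin> max_elems J a \<and> z i = \<one>\<^bsub>grothendieck J i\<^esub>}"

definition H_equiv ::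
  "('i, 'g) i_system \<Rightarrow> 'i set \<Rightarrow> (('i \<Rightarrow> int \<times> 'g) \<times> ('i \<Rightarrow> int \<times> 'g)) set" where
  "H_equiv J a =
     {(x, y). x \<in> H_pos J a \<and> y \<in> H_pos J a \<and>
        x \<otimes>\<^bsub>H_hat J a\<^esub> inv\<^bsub>H_hat J a\<^esub> y \<in> U_rel J a}"

definition embed ::
  "('i, 'g) i_system \<Rightarrow> 'i set \<Rightarrow> 'i set \<Rightarrow> ('i \<Rightarrow> int \<times> 'g) \<Rightarrow> 'i \<Rightarrow> int \<times> 'g" where
  "embed J a b z = (\<lambda>i\<in>b. if i \<in> a then z i else \<one>\<^bsub>grothendieck J i\<^esub>)"

text \<open>
  An element \<open>[x] \<in> M\<^sub>a\<close> is the pair of \<open>a\<close> and the class of \<open>x\<close>. The union in the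
  multiplication runs over all representatives, whose sums lie in a single class.
\<close>

definition monoid_of :: "('i, 'g) i_system \<Rightarrow> ('i set \<times> ('i \<Rightarrow> int \<times> 'g) set) monoid" where
  "monoid_of J =
     \<lparr>carrier = (SIGMA a:lower_sets J. H_pos J a // H_equiv J a),
      monoid.mult = (\<lambda>(a, A) (b, B). (a \<union> b, \<Union>x\<in>A. \<Union>y\<in>B. H_equiv J (a \<union> b) ``
        {embed J a (a \<union> b) x \<otimes>\<^bsub>H_hat J (a \<union> b)\<^esub> embed J b (a \<union> b) y})),
      one = ({}, H_equiv J {} `` {\<one>\<^bsub>H_hat J {}\<^esub>})\<rparr>"

end

theory Submission
  imports Defs "HOL-Library.Multiset_Order" "HOL-Library.Confluence"
begin

text \<open>
  Everything rests on presentations of commutative monoids by rewriting finite multisets of tokens,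
  each rule replacing a single token by a multiset. If any two rules for the same token can be
  joined in one step, rewriting is confluent; since a rewrite of a sum takes place in one of the
  summands, refinement is inherited from the free commutative monoid.

  \<open>M(J)\<close> is presented by the tokens \<open>(i, x)\<close> with \<open>x \<in> G\<^sub>i\<close>, standing for \<open>x\<close> itself when \<open>i\<close> is
  regular and for \<open>(1, x)\<close> when \<open>i\<close> is free, and the rules \<open>(i, x) \<rightarrow> (i, y) + \<Gamma>\<close>, where \<open>\<Gamma>\<close>
  consists of tokens absorbed by \<open>i\<close> and \<open>x = y + \<phi>(\<Gamma>)\<close>. Such rules commute because \<open>G\<^sub>i\<close> is a
  group. Conversely, if a prime \<open>p\<close> of a primely generated conical refinement monoid is a sum of
  primes, then it is associated to one of them, so that the relation is an instance of such a rule,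
  and refinement reduces every relation between sums of primes to relations of this kind. Hence the
  monoid has the presentation of \<open>M(J)\<close>, where \<open>J\<close> is formed by its classes of associated primes.

  For tameness, take a finite set \<open>T\<close> of primes and the rules \<open>t \<rightarrow> t + \<Gamma>\<close> for all \<open>\<Gamma>\<close> over \<open>T\<close> with
  \<open>t + \<Gamma> = t\<close> in \<open>M\<close>. They commute trivially and so present a finitely generated refinement monoid
  over \<open>M\<close>. By Redei's theorem the relations of a finitely generated submonoid of \<open>M\<close> follow from
  finitely many, which hold in this monoid when \<open>T\<close> is large. So the inclusion of the submonoid
  factors through it, and these monoids, connected through the submonoids of \<open>M\<close>, form a direct
  system with limit \<open>M\<close>.
\<close>

section \<open>Context-free rewriting of multisets\<close>

text \<open>The relations of \<open>M(J)\<close> are not of the shape that rules allow. At a free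
  index (1, x) + (1, y) equals (1, x + y) + (1, 0), yet a rule consumes a single token. Condition
  (c2) helps: every element of \<open>G\<^sub>i\<close> is the value of a word from below
  \<open>i\<close>, so group parts can be moved into absorbed tokens and back. At a regular index
  the neutral token is invisible in \<open>H_hat\<close>, but every token at or above that index
  absorbs it. Finally \<open>U_rel\<close> permits subtraction while words only add, so its elements
  are written as differences of vectors that can be added to words. Each rule keeps a token at the
  rewritten index. Hence no nonempty word can vanish, which gives conicality, and no index that
  occurs can disappear, which makes tokens prime. The expansion rules used for tameness never
  exchange one prime for another; relations between associated primes are recovered because the
  elements associated to \<open>j\<close> form a group, whose inverses supply a common expansion of
  both sides. Tameness is proved for every primely generated conical refinement monoid and then
  applied to \<open>M(J)\<close>.\<close>

inductive rewrite :: "('t \<Rightarrow> 't multiset \<Rightarrow> bool) \<Rightarrow> 't multiset \<Rightarrow> 't multiset \<Rightarrow> bool"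
  for R where
  rewriteI: "R t A \<Longrightarrow> rewrite R (add_mset t \<Gamma>) (A + \<Gamma>)"

abbreviation conv :: "('t \<Rightarrow> 't multiset \<Rightarrow> bool) \<Rightarrow> 't multiset \<Rightarrow> 't multiset \<Rightarrow> bool" where
  "conv R \<equiv> equivclp (rewrite R)"

lemma rewrite_single: "R t A \<Longrightarrow> rewrite R {#t#} A"
  using rewriteI[of R t A "{#}"] by simp

lemma rewrite_add: "rewrite R \<alpha> \<beta> \<Longrightarrow> rewrite R (\<alpha> + \<gamma>) (\<beta> + \<gamma>)"
  by (auto elim!: rewrite.cases simp: add.assoc intro: rewriteI)

lemma conv_add_right: "conv R \<alpha> \<beta> \<Longrightarrow> conv R (\<alpha> + \<gamma>) (\<beta> + \<gamma>)"
proof (induction rule: equivclp_induct)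
  case (step \<beta> \<delta>)
  then have "conv R (\<beta> + \<gamma>) (\<delta> + \<gamma>)"
    using rewrite_add by (metis r_into_equivclp converse_r_into_equivclp)
  with step show ?case by (meson transpD transp_equivclp)
qed simp

lemma conv_trans [trans]: "conv R \<alpha> \<beta> \<Longrightarrow> conv R \<beta> \<gamma> \<Longrightarrow> conv R \<alpha> \<gamma>"
  by (meson transpD transp_equivclp)

lemma conv_add: "conv R \<alpha> \<beta> \<Longrightarrow> conv R \<gamma> \<delta> \<Longrightarrow> conv R (\<alpha> + \<gamma>) (\<beta> + \<delta>)"
  by (metis add.commute conv_add_right conv_trans)

lemma conv_mono:
  assumes "conv R \<alpha> \<beta>" and "\<And>t A. R t A \<Longrightarrow> R' t A"
  shows "conv R' \<alpha> \<beta>"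
  using assms(1)
proof (induction rule: equivclp_induct)
  case (step \<beta> \<gamma>)
  have "rewrite R x y \<Longrightarrow> rewrite R' x y" for x y
    using assms(2) by (auto elim!: rewrite.cases intro: rewriteI)
  with step have "conv R' \<beta> \<gamma>" by blast
  with step show ?case by (blast intro: conv_trans)
qed simp

text \<open>The consumed token belongs to one of the summands, so only that summand changes. A rule
  with two tokens on its left could straddle the sum.\<close>

lemma rewrite_split:
  assumes "rewrite R (\<alpha> + \<beta>) \<gamma>"
  obtains (left) \<alpha>' where "rewrite R \<alpha> \<alpha>'" "\<gamma> = \<alpha>' + \<beta>"
    | (right) \<beta>' where "rewrite R \<beta> \<beta>'" "\<gamma> = \<alpha> + \<beta>'"
proof -
  from assms obtain t A \<Gamma> where R: "R t A" and eq: "\<alpha> + \<beta> = add_mset t \<Gamma>" and \<gamma>: "\<gamma> = A + \<Gamma>"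
    by (auto elim: rewrite.cases)
  from eq have "t \<in># \<alpha> + \<beta>" by simp
  then consider "t \<in># \<alpha>" | "t \<in># \<beta>" by auto
  then show thesis
  proof cases
    case 1
    then obtain \<alpha>' where "\<alpha> = add_mset t \<alpha>'" by (metis multi_member_split)
    with R eq \<gamma> show thesis by (intro left[of "A + \<alpha>'"]) (auto intro: rewriteI)
  next
    case 2
    then obtain \<beta>' where "\<beta> = add_mset t \<beta>'" by (metis multi_member_split)
    with R eq \<gamma> show thesis by (intro right[of "A + \<beta>'"]) (auto intro: rewriteI)
  qed
qed

lemma rewrites_split:
  assumes "(rewrite R)\<^sup>*\<^sup>* (\<alpha> + \<beta>) \<gamma>"
  shows "\<exists>\<alpha>' \<beta>'. \<gamma> = \<alpha>' + \<beta>' \<and> (rewrite R)\<^sup>*\<^sup>* \<alpha> \<alpha>' \<and> (rewrite R)\<^sup>*\<^sup>* \<beta> \<beta>'"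
  using assms
proof (induction rule: rtranclp_induct)
  case (step \<gamma> \<delta>)
  then obtain \<alpha>' \<beta>' where "\<gamma> = \<alpha>' + \<beta>'" and *: "(rewrite R)\<^sup>*\<^sup>* \<alpha> \<alpha>'" "(rewrite R)\<^sup>*\<^sup>* \<beta> \<beta>'"
    by blast
  with step have "rewrite R (\<alpha>' + \<beta>') \<delta>" by simp
  then show ?case
  proof (cases rule: rewrite_split)
    case (left \<alpha>'')
    show ?thesis by (intro exI[of _ "\<alpha>''"] exI[of _ "\<beta>'"]) (use left * in \<open>auto intro: rtranclp.rtrancl_into_rtrancl\<close>)
  next
    case (right \<beta>'')
    show ?thesis by (intro exI[of _ "\<alpha>'"] exI[of _ "\<beta>''"]) (use right * in \<open>auto intro: rtranclp.rtrancl_into_rtrancl\<close>)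
  qed
qed blast

text \<open>Rewritings at different tokens commute, so only two rules for the same token have to be
  joined. At most one step on each side gives strong confluence, which does not ask for termination;
  rules such as t -> t + \<Gamma> can be applied forever.\<close>

lemma confluent_rewrite:
  assumes diamond: "\<And>t A B. R t A \<Longrightarrow> R t B \<Longrightarrow> \<exists>D. (rewrite R)\<^sup>=\<^sup>= A D \<and> (rewrite R)\<^sup>=\<^sup>= B D"
  shows "confluentp (rewrite R)"
proof (rule strong_confluentp_imp_confluentp, rule strong_confluentpI)
  fix \<alpha> \<beta> \<gamma> assume "rewrite R \<alpha> \<beta>" "rewrite R \<alpha> \<gamma>"
  then obtain t A \<Gamma> where R: "R t A" and \<alpha>: "\<alpha> = {#t#} + \<Gamma>" and \<beta>: "\<beta> = A + \<Gamma>"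
    by (auto elim: rewrite.cases)
  from \<open>rewrite R \<alpha> \<gamma>\<close> have "rewrite R ({#t#} + \<Gamma>) \<gamma>" by (simp add: \<alpha>)
  \<comment> \<open>Splitting off the occurrence of \<open>t\<close> decides whether the second step
    rewrites this very token or a token of \<Gamma>.\<close>
  then have "\<exists>\<delta>. (rewrite R)\<^sup>=\<^sup>= \<beta> \<delta> \<and> (rewrite R)\<^sup>=\<^sup>= \<gamma> \<delta>"
  proof (cases rule: rewrite_split)
    case (left B)
    then have "R t B" by (auto elim!: rewrite.cases)
    from diamond[OF R this] obtain D where "(rewrite R)\<^sup>=\<^sup>= A D" "(rewrite R)\<^sup>=\<^sup>= B D" by blast
    then show ?thesis
      by (intro exI[of _ "D + \<Gamma>"]) (auto simp: \<beta> left intro: rewrite_add)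
  next
    case (right \<Gamma>')
    have "rewrite R ({#t#} + \<Gamma>') (A + \<Gamma>')" using R by (auto intro: rewriteI)
    moreover have "rewrite R (A + \<Gamma>) (A + \<Gamma>')"
      using rewrite_add[OF right(1), of A] by (simp add: add.commute)
    ultimately show ?thesis using right by (auto simp: \<beta>)
  qed
  then show "\<exists>\<delta>. (rewrite R)\<^sup>*\<^sup>* \<beta> \<delta> \<and> (rewrite R)\<^sup>=\<^sup>= \<gamma> \<delta>" by auto
qed

lemma conv_joinable:
  assumes "confluentp (rewrite R)" and "conv R \<alpha> \<beta>"
  obtains \<gamma> where "(rewrite R)\<^sup>*\<^sup>* \<alpha> \<gamma>" "(rewrite R)\<^sup>*\<^sup>* \<beta> \<gamma>"
  using assms semiconfluentp_equivclp[OF confluentp_imp_semiconfluentp[OF assms(1)]]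
  by (auto simp: rtranclp_conversep)

text \<open>With \<open>w\<close> the common part of \<alpha> and \<gamma>, the other three parts
  are forced; the subtraction in \<open>z\<close> is exact because the surplus of \<gamma> over
  \<alpha> is contained in \<beta>.\<close>

lemma multiset_refinement:
  fixes \<alpha> \<beta> \<gamma> \<delta> :: "'t multiset"
  assumes "\<alpha> + \<beta> = \<gamma> + \<delta>"
  shows "\<exists>w x y z. \<alpha> = w + x \<and> \<beta> = y + z \<and> \<gamma> = w + y \<and> \<delta> = x + z"
proof (intro exI conjI)
  have eq: "count \<alpha> t + count \<beta> t = count \<gamma> t + count \<delta> t" for t
    using arg_cong[OF assms, of "\<lambda>\<mu>. count \<mu> t"] by simp
  show "\<alpha> = (\<alpha> \<inter># \<gamma>) + (\<alpha> - \<gamma>)" "\<gamma> = (\<alpha> \<inter># \<gamma>) + (\<gamma> - \<alpha>)"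
    by (auto simp: multiset_eq_iff)
  have "count \<beta> t = (count \<gamma> t - count \<alpha> t) + (count \<beta> t - (count \<gamma> t - count \<alpha> t))"
    and "count \<delta> t = (count \<alpha> t - count \<gamma> t) + (count \<beta> t - (count \<gamma> t - count \<alpha> t))" for t
    using eq[of t] by linarith+
  then show "\<beta> = (\<gamma> - \<alpha>) + (\<beta> - (\<gamma> - \<alpha>))" "\<delta> = (\<alpha> - \<gamma>) + (\<beta> - (\<gamma> - \<alpha>))"
    by (simp_all add: multiset_eq_iff)
qed

text \<open>\<open>X\<close> is known only through the map \<open>q\<close> from words, so that a
  given monoid and \<open>M(J)\<close> can be instances of one and the same presentation.
  \<open>R_closed\<close> keeps rewriting inside the words over \<open>T\<close>, where alone
  \<open>q\<close> is controlled.\<close>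

locale presented_monoid = comm_monoid X
  for X :: "('x, 'b) monoid_scheme" (structure) +
  fixes T :: "'t set" and R :: "'t \<Rightarrow> 't multiset \<Rightarrow> bool" and q :: "'t multiset \<Rightarrow> 'x"
  assumes R_closed: "R t A \<Longrightarrow> t \<in> T \<and> set_mset A \<subseteq> T"
    and R_confluent: "confluentp (rewrite R)"
    and q_carrier: "q ` {\<alpha>. set_mset \<alpha> \<subseteq> T} = carrier X"
    and q_empty: "q {#} = \<one>"
    and q_add: "set_mset \<alpha> \<subseteq> T \<Longrightarrow> set_mset \<beta> \<subseteq> T \<Longrightarrow> q (\<alpha> + \<beta>) = q \<alpha> \<otimes> q \<beta>"
    and q_eq_iff: "set_mset \<alpha> \<subseteq> T \<Longrightarrow> set_mset \<beta> \<subseteq> T \<Longrightarrow> q \<alpha> = q \<beta> \<longleftrightarrow> conv R \<alpha> \<beta>"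
begin

lemma q_closed: "set_mset \<alpha> \<subseteq> T \<Longrightarrow> q \<alpha> \<in> carrier X"
  using q_carrier by blast

lemma q_surj:
  assumes "x \<in> carrier X" obtains \<alpha> where "set_mset \<alpha> \<subseteq> T" "x = q \<alpha>"
  using assms q_carrier by blast

lemma rewrite_closed: "rewrite R \<alpha> \<beta> \<Longrightarrow> set_mset \<alpha> \<subseteq> T \<Longrightarrow> set_mset \<beta> \<subseteq> T"
  using R_closed by (fastforce elim!: rewrite.cases)

lemma rewrites_closed: "(rewrite R)\<^sup>*\<^sup>* \<alpha> \<beta> \<Longrightarrow> set_mset \<alpha> \<subseteq> T \<Longrightarrow> set_mset \<beta> \<subseteq> T"
  by (induction rule: rtranclp_induct) (auto dest: rewrite_closed)

lemma q_rewrites: "(rewrite R)\<^sup>*\<^sup>* \<alpha> \<beta> \<Longrightarrow> set_mset \<alpha> \<subseteq> T \<Longrightarrow> q \<beta> = q \<alpha>"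
  by (metis equivclp_sym q_eq_iff rewrites_closed rtranclp_into_equivclp)

lemma q_eqE:
  assumes "q \<alpha> = q \<beta>" "set_mset \<alpha> \<subseteq> T" "set_mset \<beta> \<subseteq> T"
  obtains \<gamma> where "(rewrite R)\<^sup>*\<^sup>* \<alpha> \<gamma>" "(rewrite R)\<^sup>*\<^sup>* \<beta> \<gamma>"
  using assms conv_joinable[OF R_confluent] q_eq_iff by metis

theorem refinement: "refinement_monoid X"
  unfolding refinement_monoid_def
proof (intro conjI ballI impI)
  show "comm_monoid X" by (rule comm_monoid_axioms)
  fix a b c d assume "a \<in> carrier X" "b \<in> carrier X" "c \<in> carrier X" "d \<in> carrier X"
    and eq: "a \<otimes> b = c \<otimes> d"
  then obtain \<alpha> \<beta> \<gamma> \<delta> where T: "set_mset \<alpha> \<subseteq> T" "set_mset \<beta> \<subseteq> T" "set_mset \<gamma> \<subseteq> T" "set_mset \<delta> \<subseteq> T"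
    and q: "a = q \<alpha>" "b = q \<beta>" "c = q \<gamma>" "d = q \<delta>"
    by (metis q_surj)
  from eq have "q (\<alpha> + \<beta>) = q (\<gamma> + \<delta>)" by (simp add: q T q_add)
  then obtain \<epsilon> where "(rewrite R)\<^sup>*\<^sup>* (\<alpha> + \<beta>) \<epsilon>" "(rewrite R)\<^sup>*\<^sup>* (\<gamma> + \<delta>) \<epsilon>"
    by (rule q_eqE) (use T in auto)
  then obtain \<alpha>' \<beta>' \<gamma>' \<delta>' where \<epsilon>: "\<epsilon> = \<alpha>' + \<beta>'" "\<epsilon> = \<gamma>' + \<delta>'"
    and *: "(rewrite R)\<^sup>*\<^sup>* \<alpha> \<alpha>'" "(rewrite R)\<^sup>*\<^sup>* \<beta> \<beta>'" "(rewrite R)\<^sup>*\<^sup>* \<gamma> \<gamma>'" "(rewrite R)\<^sup>*\<^sup>* \<delta> \<delta>'"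
    using rewrites_split by metis
  \<comment> \<open>The common reduct \<epsilon> is a sum in two ways, and refinement of multisets
    applies to it. Values do not change along rewriting, so the result transfers to a, b, c,
    d.\<close>
  from \<epsilon> obtain w x y z where 1: "\<alpha>' = w + x" "\<beta>' = y + z" "\<gamma>' = w + y" "\<delta>' = x + z"
    by (metis multiset_refinement)
  have T': "set_mset w \<subseteq> T" "set_mset x \<subseteq> T" "set_mset y \<subseteq> T" "set_mset z \<subseteq> T"
    using *(1,2)[THEN rewrites_closed] T 1 by auto
  have "a = q w \<otimes> q x" "b = q y \<otimes> q z" "c = q w \<otimes> q y" "d = q x \<otimes> q z"
    using *[THEN q_rewrites] T by (simp_all add: q 1 q_add T')
  with T' show "\<exists>w\<in>carrier X. \<exists>x\<in>carrier X. \<exists>y\<in>carrier X. \<exists>z\<in>carrier X.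
      a = w \<otimes> x \<and> b = y \<otimes> z \<and> c = w \<otimes> y \<and> d = x \<otimes> z"
    using q_closed by blast
qed

lemma q_mset: "set ts \<subseteq> T \<Longrightarrow> q (mset ts) = foldr (\<otimes>) (map (\<lambda>t. q {#t#}) ts) \<one>"
proof (induction ts)
  case (Cons t ts)
  then show ?case using q_add[of "{#t#}" "mset ts"] by simp
qed (simp add: q_empty)

lemma carrier_eq_finite_sums: "carrier X = finite_sums X ((\<lambda>t. q {#t#}) ` T)"
proof
  show "carrier X \<subseteq> finite_sums X ((\<lambda>t. q {#t#}) ` T)"
  proof
    fix x assume "x \<in> carrier X"
    then obtain ts where "set ts \<subseteq> T" "x = q (mset ts)" by (metis q_surj ex_mset set_mset_mset)
    then have "x = foldr (\<otimes>) (map (\<lambda>t. q {#t#}) ts) \<one>" "set (map (\<lambda>t. q {#t#}) ts) \<subseteq> (\<lambda>t. q {#t#}) ` T"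
      by (auto simp: q_mset)
    then show "x \<in> finite_sums X ((\<lambda>t. q {#t#}) ` T)" unfolding finite_sums_def by blast
  qed
  show "finite_sums X ((\<lambda>t. q {#t#}) ` T) \<subseteq> carrier X"
  proof
    fix x assume "x \<in> finite_sums X ((\<lambda>t. q {#t#}) ` T)"
    then obtain xs where x: "x = foldr (\<otimes>) xs \<one>" and xs: "set xs \<subseteq> (\<lambda>t. q {#t#}) ` T"
      by (auto simp: finite_sums_def)
    from xs have "set xs \<subseteq> carrier X" using q_closed by (auto dest!: subsetD)
    then show "x \<in> carrier X" unfolding x by (induction xs) auto
  qed
qed

lemma finitely_generated: "finite T \<Longrightarrow> finitely_generated_monoid X"
  unfolding finitely_generated_monoid_def
  by (rule exI[of _ "(\<lambda>t. q {#t#}) ` T"]) (auto simp: carrier_eq_finite_sums[symmetric] q_closed)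

lemma rewrites_empty: "(rewrite R)\<^sup>*\<^sup>* {#} \<beta> \<Longrightarrow> \<beta> = {#}"
  by (erule converse_rtranclpE) (auto elim: rewrite.cases)

text \<open>The empty word admits no step, so a word of value one must reduce to it; the last step
  of such a reduction, if there is one, would have an empty right side.\<close>

lemma q_eq_one:
  assumes ne: "\<And>t A. R t A \<Longrightarrow> A \<noteq> {#}" and "set_mset \<alpha> \<subseteq> T" "q \<alpha> = \<one>"
  shows "\<alpha> = {#}"
proof -
  from assms have "q \<alpha> = q {#}" by (simp add: q_empty)
  then obtain \<gamma> where *: "(rewrite R)\<^sup>*\<^sup>* \<alpha> \<gamma>" "(rewrite R)\<^sup>*\<^sup>* {#} \<gamma>"
    by (rule q_eqE) (use assms in auto)
  from *(2) have "\<gamma> = {#}" by (rule rewrites_empty)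
  with *(1) show ?thesis
    by (cases rule: rtranclp.cases) (auto elim!: rewrite.cases dest!: ne)
qed

lemma conical:
  assumes ne: "\<And>t A. R t A \<Longrightarrow> A \<noteq> {#}"
  shows "conical X"
  unfolding conical_def
proof (intro ballI impI)
  fix x y assume "x \<in> carrier X" "y \<in> carrier X" and eq: "x \<otimes> y = \<one>"
  then obtain \<alpha> \<beta> where *: "set_mset \<alpha> \<subseteq> T" "set_mset \<beta> \<subseteq> T" "x = q \<alpha>" "y = q \<beta>"
    by (metis q_surj)
  with eq have "q (\<alpha> + \<beta>) = \<one>" by (simp add: q_add)
  then have "\<alpha> + \<beta> = {#}" by (intro q_eq_one) (use * ne in auto)
  with * show "x = \<one> \<and> y = \<one>" by (simp add: q_empty)
qed

text \<open>The label \<kappa> becomes the index of a token (\<open>fst\<close> for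
  \<open>M(J)\<close>): a step may change a token but keeps its class present.\<close>

lemma rewrites_class:
  assumes cls: "\<And>t A. R t A \<Longrightarrow> \<exists>t'\<in>#A. \<kappa> t' = \<kappa> t"
    and "(rewrite R)\<^sup>*\<^sup>* \<alpha> \<beta>" "t \<in># \<alpha>"
  shows "\<exists>t'\<in>#\<beta>. \<kappa> t' = \<kappa> t"
  using assms(2,3)
proof (induction rule: rtranclp_induct)
  case (step \<beta> \<gamma>)
  then obtain t' where "t' \<in># \<beta>" "\<kappa> t' = \<kappa> t" by blast
  with \<open>rewrite R \<beta> \<gamma>\<close> show ?case using cls by (fastforce elim!: rewrite.cases)
qed blast

text \<open>Join \<alpha> + \<beta> with t + \<gamma>. The class of \<open>t\<close> survives in the
  common reduct, hence in the part that comes from \<alpha> or in the part that comes from \<beta>,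
  and \<open>exchange\<close> turns a token of that class into \<open>t\<close> plus a
  remainder.\<close>

lemma prime_token:
  assumes cls: "\<And>t A. R t A \<Longrightarrow> \<exists>t'\<in>#A. \<kappa> t' = \<kappa> t"
    and exchange: "\<And>t'. t' \<in> T \<Longrightarrow> \<kappa> t' = \<kappa> t \<Longrightarrow>
      \<exists>\<Gamma>. set_mset \<Gamma> \<subseteq> T \<and> conv R {#t'#} (add_mset t \<Gamma>)"
    and t: "t \<in> T"
  shows "Divisibility.prime X (q {#t#})"
  unfolding Divisibility.prime_def
proof (intro conjI ballI impI)
  have ne: "A \<noteq> {#}" if "R t A" for t A using cls[OF that] by auto
  show "q {#t#} \<notin> Units X"
  proof
    assume "q {#t#} \<in> Units X"
    moreover have "conical X" by (rule conical) (rule ne)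
    ultimately have "q {#t#} = \<one>" unfolding conical_def Units_def by blast
    then have "{#t#} = {#}" by (intro q_eq_one) (use t ne in auto)
    then show False by simp
  qed
  fix a b assume ab: "a \<in> carrier X" "b \<in> carrier X" and "q {#t#} divides a \<otimes> b"
  then obtain c where c: "c \<in> carrier X" "a \<otimes> b = q {#t#} \<otimes> c" by (auto simp: factor_def)
  with ab obtain \<alpha> \<beta> \<gamma> where T: "set_mset \<alpha> \<subseteq> T" "set_mset \<beta> \<subseteq> T" "set_mset \<gamma> \<subseteq> T"
    and q: "a = q \<alpha>" "b = q \<beta>" "c = q \<gamma>"
    by (metis q_surj)
  with c t have "q (\<alpha> + \<beta>) = q ({#t#} + \<gamma>)" by (subst (1 2) q_add) auto
  then obtain \<delta> where *: "(rewrite R)\<^sup>*\<^sup>* (\<alpha> + \<beta>) \<delta>" "(rewrite R)\<^sup>*\<^sup>* ({#t#} + \<gamma>) \<delta>"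
    by (rule q_eqE) (use T t in auto)
  then obtain \<alpha>' \<beta>' where \<delta>: "\<delta> = \<alpha>' + \<beta>'" and **: "(rewrite R)\<^sup>*\<^sup>* \<alpha> \<alpha>'" "(rewrite R)\<^sup>*\<^sup>* \<beta> \<beta>'"
    using rewrites_split by metis
  have T': "set_mset \<alpha>' \<subseteq> T" "set_mset \<beta>' \<subseteq> T" using ** T by (simp_all add: rewrites_closed)
  have dvd: "q {#t#} divides q \<epsilon>" if \<epsilon>: "set_mset \<epsilon> \<subseteq> T" and t': "t' \<in># \<epsilon>" "\<kappa> t' = \<kappa> t" for \<epsilon> t'
  proof -
    from t' obtain \<zeta> where \<zeta>: "\<epsilon> = {#t'#} + \<zeta>" by (metis add_mset_add_single add.commute multi_member_split)
    from exchange[of t'] t' \<epsilon> obtain \<Gamma> where \<Gamma>: "set_mset \<Gamma> \<subseteq> T" "conv R {#t'#} (add_mset t \<Gamma>)" by blast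
    have "conv R \<epsilon> ({#t#} + (\<Gamma> + \<zeta>))" using conv_add_right[OF \<Gamma>(2), of \<zeta>] by (simp add: \<zeta>)
    then have "q \<epsilon> = q ({#t#} + (\<Gamma> + \<zeta>))" using \<epsilon> \<Gamma> t \<zeta> by (subst q_eq_iff) auto
    also have "\<dots> = q {#t#} \<otimes> q (\<Gamma> + \<zeta>)" using \<epsilon> \<Gamma> t \<zeta> by (subst q_add) auto
    finally show ?thesis using \<epsilon> \<Gamma> \<zeta> by (auto simp: factor_def intro!: bexI[of _ "q (\<Gamma> + \<zeta>)"] q_closed)
  qed
  from rewrites_class[OF cls *(2), of t] obtain t' where "t' \<in># \<alpha>' + \<beta>'" "\<kappa> t' = \<kappa> t"
    by (auto simp: \<delta>)
  then have "q {#t#} divides q \<alpha>' \<or> q {#t#} divides q \<beta>'" using dvd T' by auto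
  then show "q {#t#} divides a \<or> q {#t#} divides b"
    using **[THEN q_rewrites] T by (simp add: q)
qed

lemma primely_generated:
  assumes "\<And>t. t \<in> T \<Longrightarrow> Divisibility.prime X (q {#t#})"
  shows "primely_generated X"
proof -
  have "finite_sums X ((\<lambda>t. q {#t#}) ` T) \<subseteq> finite_sums X {p \<in> carrier X. Divisibility.prime X p}"
    using assms q_closed unfolding finite_sums_def by (intro Collect_mono ex_mono conj_mono imp_refl) auto
  then show ?thesis by (auto simp: primely_generated_def carrier_eq_finite_sums[symmetric])
qed

end

text \<open>Both are the quotient of the words over \<open>T\<close> by \<open>conv R\<close>. This
  is how a given monoid is recognized as some \<open>M(J)\<close>.\<close>

lemma presented_monoid_iso:
  assumes "presented_monoid X T R q" "presented_monoid Y T R q'"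
  shows "X \<cong> Y"
proof -
  interpret X: presented_monoid X T R q by fact
  interpret Y: presented_monoid Y T R q' by fact
  define W where "W = {\<alpha>. set_mset \<alpha> \<subseteq> T}"
  define h where "h x = q' (SOME \<alpha>. \<alpha> \<in> W \<and> q \<alpha> = x)" for x
  have h: "h (q \<alpha>) = q' \<alpha>" if "\<alpha> \<in> W" for \<alpha>
  proof -
    have "(SOME \<beta>. \<beta> \<in> W \<and> q \<beta> = q \<alpha>) \<in> W \<and> q (SOME \<beta>. \<beta> \<in> W \<and> q \<beta> = q \<alpha>) = q \<alpha>"
      by (rule someI) (use that in simp)
    with that show ?thesis unfolding h_def
      using X.q_eq_iff Y.q_eq_iff by (auto simp: W_def)
  qed
  have X: "carrier X = q ` W" and Y: "carrier Y = q' ` W"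
    using X.q_carrier Y.q_carrier by (simp_all add: W_def)
  have "h \<in> iso X Y"
    unfolding iso_iff
  proof (intro conjI)
    show "h \<in> hom X Y"
    proof (rule homI)
      fix x assume "x \<in> carrier X" then show "h x \<in> carrier Y" by (auto simp: X Y h)
    next
      fix x y assume "x \<in> carrier X" "y \<in> carrier X"
      then obtain \<alpha> \<beta> where *: "\<alpha> \<in> W" "\<beta> \<in> W" "x = q \<alpha>" "y = q \<beta>" by (auto simp: X)
      then have "x \<otimes>\<^bsub>X\<^esub> y = q (\<alpha> + \<beta>)" "\<alpha> + \<beta> \<in> W" using X.q_add by (auto simp: W_def)
      with * show "h (x \<otimes>\<^bsub>X\<^esub> y) = h x \<otimes>\<^bsub>Y\<^esub> h y" using Y.q_add by (simp add: h W_def)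
    qed
    show "h ` carrier X = carrier Y" by (auto simp: X Y h image_iff)
    show "inj_on h (carrier X)"
      by (auto simp: X h inj_on_def W_def X.q_eq_iff Y.q_eq_iff)
  qed
  then show ?thesis by (rule is_isoI)
qed

text \<open>The stages of a direct system in \<open>tame\<close> have carriers in
  \<open>nat\<close>. Words over a finite \<open>T\<close> are countable, so a class can be
  represented by the number of a chosen word in it.\<close>

lemma ex_presented_monoid_nat:
  assumes T: "finite T" and closed: "\<And>t A. R t A \<Longrightarrow> t \<in> T \<and> set_mset A \<subseteq> T"
    and confl: "confluentp (rewrite R)"
  shows "\<exists>(X :: nat monoid) q. presented_monoid X T R q"
proof -
  define W where "W = {\<alpha>. set_mset \<alpha> \<subseteq> T}"
  have "W = mset ` lists T"
    by (auto simp: W_def image_iff lists_eq_set) (metis ex_mset set_mset_mset)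
  with T have "countable W" by (simp add: countable_finite countable_lists)
  define c where "c \<alpha> = (SOME \<beta>. \<beta> \<in> W \<and> conv R \<alpha> \<beta>)" for \<alpha>
  have c: "c \<alpha> \<in> W \<and> conv R \<alpha> (c \<alpha>)" if "\<alpha> \<in> W" for \<alpha>
    unfolding c_def by (rule someI) (use that in auto)
  have c_eq: "c \<alpha> = c \<beta> \<longleftrightarrow> conv R \<alpha> \<beta>" if "\<alpha> \<in> W" "\<beta> \<in> W" for \<alpha> \<beta>
  proof
    assume "c \<alpha> = c \<beta>" then show "conv R \<alpha> \<beta>" using c that by (metis conv_trans equivclp_sym)
  next
    assume "conv R \<alpha> \<beta>"
    then have "conv R \<alpha> \<gamma> \<longleftrightarrow> conv R \<beta> \<gamma>" for \<gamma> by (meson conv_trans equivclp_sym)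
    then show "c \<alpha> = c \<beta>" by (simp add: c_def)
  qed
  define q where "q \<alpha> = to_nat_on W (c \<alpha>)" for \<alpha>
  have q_eq: "q \<alpha> = q \<beta> \<longleftrightarrow> conv R \<alpha> \<beta>" if "\<alpha> \<in> W" "\<beta> \<in> W" for \<alpha> \<beta>
    using that c \<open>countable W\<close> by (simp add: q_def c_eq)
  define r where "r n = (SOME \<alpha>. \<alpha> \<in> W \<and> q \<alpha> = n)" for n
  have r: "r (q \<alpha>) \<in> W \<and> conv R (r (q \<alpha>)) \<alpha>" if "\<alpha> \<in> W" for \<alpha>
  proof -
    have "r (q \<alpha>) \<in> W \<and> q (r (q \<alpha>)) = q \<alpha>" unfolding r_def by (rule someI) (use that in simp)
    with q_eq that show ?thesis by blast
  qed
  define X where "X = \<lparr>carrier = q ` W, monoid.mult = (\<lambda>m n. q (r m + r n)), one = q {#}\<rparr>"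
  have W_add: "\<alpha> + \<beta> \<in> W" if "\<alpha> \<in> W" "\<beta> \<in> W" for \<alpha> \<beta> using that by (simp add: W_def)
  have q_add: "q \<alpha> \<otimes>\<^bsub>X\<^esub> q \<beta> = q (\<alpha> + \<beta>)" if "\<alpha> \<in> W" "\<beta> \<in> W" for \<alpha> \<beta>
    using that r by (simp add: X_def q_eq W_add conv_add)
  have carr: "carrier X = q ` W" and one: "\<one>\<^bsub>X\<^esub> = q {#}" and W0: "{#} \<in> W" by (simp_all add: X_def W_def)
  have "comm_monoid X"
    by (rule comm_monoidI) (auto simp: carr one q_add W_add W0 add_ac)
  then interpret comm_monoid X .
  have "presented_monoid X T R q"
    by unfold_locales (use closed confl q_add q_eq in \<open>auto simp: carr one W_def\<close>)
  then show ?thesis by blast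
qed

text \<open>Values outside the carrier are skipped: \<open>fold_mset\<close> needs step functions
  that commute on the whole type.\<close>

definition mprod :: "('x, 'b) monoid_scheme \<Rightarrow> ('t \<Rightarrow> 'x) \<Rightarrow> 't multiset \<Rightarrow> 'x" where
  "mprod X v = fold_mset (\<lambda>t x. if v t \<in> carrier X \<and> x \<in> carrier X then v t \<otimes>\<^bsub>X\<^esub> x else x) \<one>\<^bsub>X\<^esub>"

lemma refinement_monoidE:
  assumes "refinement_monoid X" "a \<otimes>\<^bsub>X\<^esub> b = c \<otimes>\<^bsub>X\<^esub> d"
    and "a \<in> carrier X" "b \<in> carrier X" "c \<in> carrier X" "d \<in> carrier X"
  obtains w x y z where "w \<in> carrier X" "x \<in> carrier X" "y \<in> carrier X" "z \<in> carrier X"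
    "a = w \<otimes>\<^bsub>X\<^esub> x" "b = y \<otimes>\<^bsub>X\<^esub> z" "c = w \<otimes>\<^bsub>X\<^esub> y" "d = x \<otimes>\<^bsub>X\<^esub> z"
  using assms unfolding refinement_monoid_def by blast

context comm_monoid
begin

lemma mprod_comp_fun_commute:
  "comp_fun_commute (\<lambda>t x. if v t \<in> carrier G \<and> x \<in> carrier G then v t \<otimes> x else x)"
  by standard (auto simp: fun_eq_iff m_lcomm)

lemma mprod_empty [simp]: "mprod G v {#} = \<one>"
  by (simp add: mprod_def)

lemma mprod_closed [simp, intro]: "mprod G v \<alpha> \<in> carrier G"
  unfolding mprod_def
  by (induction \<alpha>) (auto simp: comp_fun_commute.fold_mset_add_mset[OF mprod_comp_fun_commute])

lemma mprod_add_mset [simp]: "v t \<in> carrier G \<Longrightarrow> mprod G v (add_mset t \<alpha>) = v t \<otimes> mprod G v \<alpha>"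
  using mprod_closed[of v \<alpha>]
  by (simp add: mprod_def comp_fun_commute.fold_mset_add_mset[OF mprod_comp_fun_commute])

lemma mprod_add:
  "v ` set_mset \<alpha> \<subseteq> carrier G \<Longrightarrow> v ` set_mset \<beta> \<subseteq> carrier G \<Longrightarrow>
   mprod G v (\<alpha> + \<beta>) = mprod G v \<alpha> \<otimes> mprod G v \<beta>"
  by (induction \<alpha>) (auto simp: m_assoc)

lemma mprod_cong: "(\<And>t. t \<in># \<alpha> \<Longrightarrow> v t = w t) \<Longrightarrow> w ` set_mset \<alpha> \<subseteq> carrier G \<Longrightarrow> mprod G v \<alpha> = mprod G w \<alpha>"
  by (induction \<alpha>) auto

text \<open>
  Refinement splits a relation between sums into relations \<open>v t = \<dots>\<close> for single tokens, so a
  congruence containing these contains all relations.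
\<close>

lemma refinement_mprod:
  assumes ref: "refinement_monoid G" and con: "conical G" and v: "v \<in> T \<rightarrow> carrier G"
    and surj: "\<And>x. x \<in> carrier G \<Longrightarrow> \<exists>\<alpha>. set_mset \<alpha> \<subseteq> T \<and> x = mprod G v \<alpha>"
    and E: "equivp E" "\<And>\<alpha> \<beta> \<gamma>. E \<alpha> \<beta> \<Longrightarrow> E (\<alpha> + \<gamma>) (\<beta> + \<gamma>)"
    and token: "\<And>t \<zeta>. t \<in> T \<Longrightarrow> set_mset \<zeta> \<subseteq> T \<Longrightarrow> v t = mprod G v \<zeta> \<Longrightarrow> E {#t#} \<zeta>"
    and "set_mset \<alpha> \<subseteq> T" "set_mset \<beta> \<subseteq> T" "mprod G v \<alpha> = mprod G v \<beta>"
  shows "E \<alpha> \<beta>"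
proof -
  have refl: "E \<alpha> \<alpha>" and sym: "E \<alpha> \<beta> \<Longrightarrow> E \<beta> \<alpha>" and trans: "E \<alpha> \<beta> \<Longrightarrow> E \<beta> \<gamma> \<Longrightarrow> E \<alpha> \<gamma>" for \<alpha> \<beta> \<gamma>
    using E(1) by (metis equivp_def)+
  have E_add: "E (\<alpha> + \<gamma>) (\<beta> + \<delta>)" if "E \<alpha> \<beta>" "E \<gamma> \<delta>" for \<alpha> \<beta> \<gamma> \<delta>
    using that E(2) trans by (metis add.commute)
  have mprod_add': "mprod G v (\<alpha> + \<beta>) = mprod G v \<alpha> \<otimes> mprod G v \<beta>"
    if "set_mset \<alpha> \<subseteq> T" "set_mset \<beta> \<subseteq> T" for \<alpha> \<beta>
    using that v by (intro mprod_add) auto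
  \<comment> \<open>A splitting of the value lifts to \<beta> modulo \<open>E\<close>: refine the
    value of one token and the rest against c and d, realize the two parts of the token's value by
    words, and replace the token by them using \<open>token\<close>.\<close>
  have split: "\<exists>\<beta>\<^sub>1 \<beta>\<^sub>2. set_mset \<beta>\<^sub>1 \<subseteq> T \<and> set_mset \<beta>\<^sub>2 \<subseteq> T \<and> E \<beta> (\<beta>\<^sub>1 + \<beta>\<^sub>2) \<and>
      mprod G v \<beta>\<^sub>1 = c \<and> mprod G v \<beta>\<^sub>2 = d"
    if "set_mset \<beta> \<subseteq> T" "c \<in> carrier G" "d \<in> carrier G" "mprod G v \<beta> = c \<otimes> d" for \<beta> c d
    using that
  proof (induction \<beta> arbitrary: c d)
    case empty
    then have "c \<otimes> d = \<one>" by simp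
    with con empty have "c = \<one>" "d = \<one>" unfolding conical_def by blast+
    with refl show ?case by (intro exI[of _ "{#}"]) simp
  next
    case (add t \<beta>)
    have vt: "v t \<in> carrier G" using add v by auto
    with add have "v t \<otimes> mprod G v \<beta> = c \<otimes> d" by simp
    then obtain w x y z where wxyz: "w \<in> carrier G" "x \<in> carrier G" "y \<in> carrier G" "z \<in> carrier G"
      "v t = w \<otimes> x" "mprod G v \<beta> = y \<otimes> z" "c = w \<otimes> y" "d = x \<otimes> z"
      by (rule refinement_monoidE[OF ref]) (use vt add.prems in auto)
    obtain \<beta>\<^sub>1 \<beta>\<^sub>2 where \<beta>: "set_mset \<beta>\<^sub>1 \<subseteq> T" "set_mset \<beta>\<^sub>2 \<subseteq> T" "E \<beta> (\<beta>\<^sub>1 + \<beta>\<^sub>2)"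
      "mprod G v \<beta>\<^sub>1 = y" "mprod G v \<beta>\<^sub>2 = z"
      using add.IH[OF _ wxyz(3,4,6)] add.prems(1) by auto
    obtain \<omega>\<^sub>1 \<omega>\<^sub>2 where \<omega>: "set_mset \<omega>\<^sub>1 \<subseteq> T" "set_mset \<omega>\<^sub>2 \<subseteq> T" "w = mprod G v \<omega>\<^sub>1" "x = mprod G v \<omega>\<^sub>2"
      using surj wxyz by metis
    have "v t = mprod G v (\<omega>\<^sub>1 + \<omega>\<^sub>2)" using \<omega> wxyz by (simp add: mprod_add')
    with add.prems(1) \<omega> have "E {#t#} (\<omega>\<^sub>1 + \<omega>\<^sub>2)" by (intro token) auto
    from E_add[OF this \<beta>(3)] have "E (add_mset t \<beta>) ((\<omega>\<^sub>1 + \<beta>\<^sub>1) + (\<omega>\<^sub>2 + \<beta>\<^sub>2))"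
      by (simp add: ac_simps)
    with \<omega> \<beta> wxyz show ?case
      by (intro exI[of _ "\<omega>\<^sub>1 + \<beta>\<^sub>1"] exI[of _ "\<omega>\<^sub>2 + \<beta>\<^sub>2"]) (auto simp: mprod_add')
  qed
  \<comment> \<open>Conicality forces value one on each token of \<beta>, so \<open>token\<close>
    applies with the empty word.\<close>
  have E_empty: "E {#} \<beta>" if "set_mset \<beta> \<subseteq> T" "mprod G v \<beta> = \<one>" for \<beta>
    using that
  proof (induction \<beta>)
    case (add t \<beta>)
    then have "v t \<in> carrier G" using v by auto
    with add.prems have "v t \<in> carrier G" "v t \<otimes> mprod G v \<beta> = \<one>" by simp_all
    with con have *: "v t = \<one>" "mprod G v \<beta> = \<one>" unfolding conical_def by (meson mprod_closed)+
    with token[of t "{#}"] add.prems have "E {#} {#t#}" by (auto intro: sym)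
    from \<open>E {#} {#t#}\<close> add.IH * add.prems have "E ({#} + {#}) ({#t#} + \<beta>)" by (intro E_add) auto
    then show ?case by simp
  qed (rule refl)
  show ?thesis using assms(7-)
  proof (induction \<alpha> arbitrary: \<beta>)
    case empty
    then show ?case using E_empty by simp
  next
    case (add t \<alpha>)
    then have "v t \<in> carrier G" using v by auto
    with add.prems have "mprod G v \<beta> = v t \<otimes> mprod G v \<alpha>" "v t \<in> carrier G" by simp_all
    with split[of \<beta> "v t" "mprod G v \<alpha>"] add.prems obtain \<beta>\<^sub>1 \<beta>\<^sub>2 where
      \<beta>: "set_mset \<beta>\<^sub>1 \<subseteq> T" "set_mset \<beta>\<^sub>2 \<subseteq> T" "E \<beta> (\<beta>\<^sub>1 + \<beta>\<^sub>2)" "mprod G v \<beta>\<^sub>1 = v t" "mprod G v \<beta>\<^sub>2 = mprod G v \<alpha>"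
      by auto
    have "E ({#t#} + \<alpha>) (\<beta>\<^sub>1 + \<beta>\<^sub>2)"
      using token[of t \<beta>\<^sub>1] add.IH[of \<beta>\<^sub>2] \<beta> add.prems by (intro E_add) auto
    from trans[OF this sym[OF \<beta>(3)]] show ?case by simp
  qed
qed

end

section \<open>The monoid of an I-system\<close>

lemma carrier_grothendieck:
  "carrier (grothendieck J i) = (if i \<in> free J then UNIV else {0}) \<times> carrier (grp J i)"
  by (simp add: grothendieck_def)

lemma mult_grothendieck [simp]:
  "u \<otimes>\<^bsub>grothendieck J i\<^esub> v = (fst u + fst v, snd u \<otimes>\<^bsub>grp J i\<^esub> snd v)"
  by (simp add: grothendieck_def mult_DirProd')

lemma one_grothendieck [simp]: "\<one>\<^bsub>grothendieck J i\<^esub> = (0, \<one>\<^bsub>grp J i\<^esub>)"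
  by (simp add: grothendieck_def)

lemma carrier_component:
  "carrier (component J i) = (if i \<in> free J then {1..} else {0}) \<times> carrier (grp J i)"
  by (simp add: component_def)

lemma mult_component [simp]:
  "u \<otimes>\<^bsub>component J i\<^esub> v = (fst u + fst v, snd u \<otimes>\<^bsub>grp J i\<^esub> snd v)"
  by (simp add: component_def)

lemma component_subset: "carrier (component J i) \<subseteq> carrier (grothendieck J i)"
  by (auto simp: carrier_component carrier_grothendieck)

lemma comm_group_grothendieck:
  assumes "comm_group (grp J i)" shows "comm_group (grothendieck J i)"
proof -
  interpret G: comm_group "grp J i" by fact
  show ?thesis
  proof (rule comm_groupI)
    fix u assume "u \<in> carrier (grothendieck J i)"
    then show "\<exists>v\<in>carrier (grothendieck J i). v \<otimes>\<^bsub>grothendieck J i\<^esub> u = \<one>\<^bsub>grothendieck J i\<^esub>"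
      by (intro bexI[of _ "(- fst u, inv\<^bsub>grp J i\<^esub> snd u)"]) (auto simp: carrier_grothendieck split: if_splits)
  qed (auto simp: carrier_grothendieck G.m_ac split: if_splits)
qed

lemma grothendieck_fraction:
  assumes "comm_group (grp J i)" and u: "u \<in> carrier (grothendieck J i)"
  obtains x y where "x \<in> carrier (component J i)" "y \<in> carrier (component J i)"
    "u \<otimes>\<^bsub>grothendieck J i\<^esub> y = x"
proof (rule that)
  interpret G: comm_group "grp J i" by fact
  \<comment> \<open>The first coordinate |fst u| + 1 puts both \<open>?y\<close> and the sum into
    \<open>M\<^sub>i\<close>, which starts at 1 for free \<open>i\<close>; for regular
    \<open>i\<close> it has to stay 0.\<close>
  let ?y = "(if i \<in> free J then \<bar>fst u\<bar> + 1 else 0, \<one>\<^bsub>grp J i\<^esub>)"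
  show "u \<otimes>\<^bsub>grothendieck J i\<^esub> ?y \<in> carrier (component J i)" "?y \<in> carrier (component J i)"
    using u by (auto simp: carrier_component carrier_grothendieck)
qed simp

lemma hom_grothendieck_unique:
  assumes Gi: "comm_group (grp J i)" and H: "group H"
    and h: "h \<in> hom (grothendieck J i) H" "h' \<in> hom (grothendieck J i) H"
    and eq: "\<And>x. x \<in> carrier (component J i) \<Longrightarrow> h x = h' x"
    and u: "u \<in> carrier (grothendieck J i)"
  shows "h u = h' u"
proof -
  obtain x y where xy: "x \<in> carrier (component J i)" "y \<in> carrier (component J i)"
    "u \<otimes>\<^bsub>grothendieck J i\<^esub> y = x" by (rule grothendieck_fraction[OF Gi u])
  then have y: "y \<in> carrier (grothendieck J i)" using component_subset[of J i] by (rule_tac subsetD)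
  interpret H: group H by fact
  have "h u \<otimes>\<^bsub>H\<^esub> h y = h x" "h' u \<otimes>\<^bsub>H\<^esub> h' y = h' x"
    using h[THEN hom_mult, OF u y] xy(3) by auto
  moreover have "h u \<in> carrier H" "h' u \<in> carrier H" "h y \<in> carrier H"
    using h u y by (auto simp: hom_in_carrier)
  ultimately show ?thesis using eq[OF xy(1)] eq[OF xy(2)] by (metis H.r_cancel)
qed

text \<open>This justifies the definite description \<open>phi_ext\<close>. Uniqueness holds because
  the Grothendieck group consists of differences from \<open>M\<^sub>i\<close>; existence is clear
  for regular \<open>i\<close>, where the two carriers agree, and comes from an explicit formula for
  free \<open>i\<close>.\<close>

lemma phi_ext:
  assumes Gi: "comm_group (grp J i)" and Gj: "comm_group (grp J j)"
    and phi: "phi J j i \<in> hom (component J i) (grp J j)"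
  shows phi_ext_hom: "phi_ext J j i \<in> hom (grothendieck J i) (grp J j)"
    and phi_ext_component: "u \<in> carrier (component J i) \<Longrightarrow> phi_ext J j i u = phi J j i u"
proof -
  interpret Gi: comm_group "grp J i" by fact
  interpret Gj: comm_group "grp J j" by fact
  let ?P = "\<lambda>h. h \<in> hom (grothendieck J i) (grp J j) \<and> h \<in> extensional (carrier (grothendieck J i)) \<and>
    (\<forall>u\<in>carrier (component J i). h u = phi J j i u)"
  have closed: "phi J j i (n, g) \<in> carrier (grp J j)" if "(n, g) \<in> carrier (component J i)" for n g
    using phi that by (rule hom_in_carrier)
  have mult: "phi J j i (m + n, g \<otimes>\<^bsub>grp J i\<^esub> h) = phi J j i (m, g) \<otimes>\<^bsub>grp J j\<^esub> phi J j i (n, h)"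
    if "(m, g) \<in> carrier (component J i)" "(n, h) \<in> carrier (component J i)" for m n g h
    using hom_mult[OF phi that] by simp
  have "\<exists>h. ?P h"
  proof (cases "i \<in> free J")
    case False
    then have "carrier (grothendieck J i) = carrier (component J i)"
      by (simp add: carrier_grothendieck carrier_component)
    with phi have "?P (restrict (phi J j i) (carrier (grothendieck J i)))"
      by (auto simp: hom_def Gi.m_closed carrier_component False)
    then show ?thesis by blast
  next
    case True
    then have tok: "(n, g) \<in> carrier (component J i) \<longleftrightarrow> 1 \<le> n \<and> g \<in> carrier (grp J i)" for n g
      by (simp add: carrier_component)
    define p where "p = phi J j i (1, \<one>\<^bsub>grp J i\<^esub>)"
    have p: "p \<in> carrier (grp J j)" unfolding p_def by (rule closed) (simp add: tok)
    \<comment> \<open>(n, g) is (1, g) plus n - 1 copies of the neutral pair of degree 1, whose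
      image \<open>p\<close> is invertible in \<open>G\<^sub>j\<close>; so the formula makes sense
      for all integers n.\<close>
    define h where "h = (\<lambda>(n, g). phi J j i (1, g) \<otimes>\<^bsub>grp J j\<^esub> p [^]\<^bsub>grp J j\<^esub> (n - 1 :: int))"
    have one: "phi J j i (1, g) \<in> carrier (grp J j)" if "g \<in> carrier (grp J i)" for g
      by (rule closed) (simp add: tok that)
    \<comment> \<open>\<phi>(1, _) is not additive, since (0, g) lies outside
      \<open>M\<^sub>i\<close>. The substitute comes from computing \<phi>(2, g + h) in two
      ways.\<close>
    have two: "phi J j i (1, g \<otimes>\<^bsub>grp J i\<^esub> h) \<otimes>\<^bsub>grp J j\<^esub> p = phi J j i (1, g) \<otimes>\<^bsub>grp J j\<^esub> phi J j i (1, h)"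
      if "g \<in> carrier (grp J i)" "h \<in> carrier (grp J i)" for g h
      using that mult[of 1 "g \<otimes>\<^bsub>grp J i\<^esub> h" 1 "\<one>\<^bsub>grp J i\<^esub>"] mult[of 1 g 1 h] by (simp add: p_def tok)
    have h_mult: "h (m + n, g \<otimes>\<^bsub>grp J i\<^esub> g') = h (m, g) \<otimes>\<^bsub>grp J j\<^esub> h (n, g')"
      if g: "g \<in> carrier (grp J i)" "g' \<in> carrier (grp J i)" for m n g g'
    proof -
      have "h (m, g) \<otimes>\<^bsub>grp J j\<^esub> h (n, g') =
        (phi J j i (1, g) \<otimes>\<^bsub>grp J j\<^esub> phi J j i (1, g')) \<otimes>\<^bsub>grp J j\<^esub>
        (p [^]\<^bsub>grp J j\<^esub> (m - 1) \<otimes>\<^bsub>grp J j\<^esub> p [^]\<^bsub>grp J j\<^esub> (n - 1))"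
        using one g p by (simp add: h_def Gj.m_ac)
      also have "\<dots> = phi J j i (1, g \<otimes>\<^bsub>grp J i\<^esub> g') \<otimes>\<^bsub>grp J j\<^esub>
        (p [^]\<^bsub>grp J j\<^esub> (1 :: int) \<otimes>\<^bsub>grp J j\<^esub> (p [^]\<^bsub>grp J j\<^esub> (m - 1) \<otimes>\<^bsub>grp J j\<^esub> p [^]\<^bsub>grp J j\<^esub> (n - 1)))"
        using one g p by (simp add: two[symmetric] Gj.m_assoc)
      also have "\<dots> = h (m + n, g \<otimes>\<^bsub>grp J i\<^esub> g')"
        using p by (simp add: h_def Gj.int_pow_mult[symmetric] del: Gj.int_pow_1)
      finally show ?thesis ..
    qed
    have h_phi: "h (n, g) = phi J j i (n, g)" if "1 \<le> n" "g \<in> carrier (grp J i)" for n g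
      using that(1)
    proof (induction n rule: int_ge_induct)
      case base
      then show ?case using one that p by (simp add: h_def)
    next
      case (step n)
      have "h (n + 1, g \<otimes>\<^bsub>grp J i\<^esub> \<one>\<^bsub>grp J i\<^esub>) = h (n, g) \<otimes>\<^bsub>grp J j\<^esub> h (1, \<one>\<^bsub>grp J i\<^esub>)"
        using that by (intro h_mult) auto
      moreover have "h (1, \<one>\<^bsub>grp J i\<^esub>) = p" using p by (simp add: h_def p_def)
      ultimately have "h (n + 1, g) = phi J j i (n, g) \<otimes>\<^bsub>grp J j\<^esub> p" using step that by simp
      also have "\<dots> = phi J j i (n + 1, g)"
        using mult[of n g 1 "\<one>\<^bsub>grp J i\<^esub>"] step that by (simp add: p_def tok)
      finally show ?case .
    qed
    have "h \<in> hom (grothendieck J i) (grp J j)"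
    proof (rule homI)
      fix u v assume "u \<in> carrier (grothendieck J i)" "v \<in> carrier (grothendieck J i)"
      then show "h (u \<otimes>\<^bsub>grothendieck J i\<^esub> v) = h u \<otimes>\<^bsub>grp J j\<^esub> h v"
        using h_mult[of "snd u" "snd v" "fst u" "fst v"] by (auto simp: carrier_grothendieck)
    qed (use one p in \<open>auto simp: carrier_grothendieck h_def\<close>)
    moreover have "u \<otimes>\<^bsub>grothendieck J i\<^esub> v \<in> carrier (grothendieck J i)"
      if "u \<in> carrier (grothendieck J i)" "v \<in> carrier (grothendieck J i)" for u v
      using that by (auto simp: carrier_grothendieck)
    ultimately have "restrict h (carrier (grothendieck J i)) \<in> hom (grothendieck J i) (grp J j)"
      by (auto simp: hom_def)
    moreover have "u \<in> carrier (grothendieck J i) \<and> h u = phi J j i u" if "u \<in> carrier (component J i)" for u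
      using that h_phi[of "fst u" "snd u"] by (auto simp: carrier_component carrier_grothendieck True)
    ultimately have "?P (restrict h (carrier (grothendieck J i)))" by simp
    then show ?thesis by blast
  qed
  moreover have "h = h'" if h: "?P h" and h': "?P h'" for h h'
  proof (rule extensionalityI)
    show "h \<in> extensional (carrier (grothendieck J i))" "h' \<in> extensional (carrier (grothendieck J i))"
      using h h' by simp_all
    fix u assume "u \<in> carrier (grothendieck J i)"
    then show "h u = h' u"
      using h h' by (rule_tac hom_grothendieck_unique[OF Gi Gj.is_group, of h h']) simp_all
  qed
  ultimately have "\<exists>!h. ?P h" by (rule ex_ex1I)
  then have "?P (phi_ext J j i)" unfolding phi_ext_def by (rule theI')
  then show "phi_ext J j i \<in> hom (grothendieck J i) (grp J j)"
    and "u \<in> carrier (component J i) \<Longrightarrow> phi_ext J j i u = phi J j i u" by simp_all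
qed

section \<open>Congruence modulo a subgroup of a commutative group\<close>

definition group_cong :: "('a, 'b) monoid_scheme \<Rightarrow> 'a set \<Rightarrow> 'a \<Rightarrow> 'a \<Rightarrow> bool" where
  "group_cong G U x y \<longleftrightarrow> x \<in> carrier G \<and> y \<in> carrier G \<and> x \<otimes>\<^bsub>G\<^esub> inv\<^bsub>G\<^esub> y \<in> U"

context comm_group
begin

lemma group_cong_refl: "subgroup U G \<Longrightarrow> x \<in> carrier G \<Longrightarrow> group_cong G U x x"
  by (simp add: group_cong_def subgroup.one_closed)

lemma group_cong_sym: "subgroup U G \<Longrightarrow> group_cong G U x y \<Longrightarrow> group_cong G U y x"
  using subgroup.m_inv_closed[of U G "x \<otimes> inv y"]
  by (auto simp: group_cong_def inv_mult_group)

lemma group_cong_mult: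
  assumes "subgroup U G" "group_cong G U x y" "group_cong G U x' y'"
  shows "group_cong G U (x \<otimes> x') (y \<otimes> y')"
proof -
  have "(x \<otimes> inv y) \<otimes> (x' \<otimes> inv y') \<in> U" using assms by (simp add: group_cong_def subgroup.m_closed)
  with assms(2,3) show ?thesis by (simp add: group_cong_def inv_mult m_ac)
qed

lemma group_cong_trans:
  assumes "subgroup U G" "group_cong G U x y" "group_cong G U y z"
  shows "group_cong G U x z"
proof -
  have "(x \<otimes> inv y) \<otimes> (y \<otimes> inv z) \<in> U" using assms by (simp add: group_cong_def subgroup.m_closed)
  moreover have "(x \<otimes> inv y) \<otimes> (y \<otimes> inv z) = x \<otimes> inv z"
    using assms(2,3) by (simp add: group_cong_def) (simp add: m_assoc inv_solve_left')
  ultimately show ?thesis using assms(2,3) by (simp add: group_cong_def)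
qed

end

text \<open>
  The token \<open>(i, g)\<close> stands for the element \<open>(deg J i, g)\<close> of \<open>M\<^sub>i\<close>; \<open>theta J j\<close> is the map from the
  tokens absorbed by \<open>j\<close> to \<open>G\<^sub>j\<close>.
\<close>

definition deg :: "('i, 'g) i_system \<Rightarrow> 'i \<Rightarrow> int" where
  "deg J i = (if i \<in> free J then 1 else 0)"

definition tokens :: "('i, 'g) i_system \<Rightarrow> ('i \<times> 'g) set" where
  "tokens J = (SIGMA i:index J. carrier (grp J i))"

definition theta :: "('i, 'g) i_system \<Rightarrow> 'i \<Rightarrow> 'i \<times> 'g \<Rightarrow> 'g" where
  "theta J j t = (if fst t = j then snd t else phi J j (fst t) (deg J (fst t), snd t))"

text \<open>Adding a token below \<open>j\<close> to a word with a token at \<open>j\<close> only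
  shifts the \<open>G\<^sub>j\<close> coordinate, by \<open>theta\<close>. A regular
  \<open>j\<close> absorbs its own tokens in the same way, since \<open>M\<^sub>j\<close> is a
  group; a free \<open>j\<close> counts them.\<close>

definition absorbed :: "('i, 'g) i_system \<Rightarrow> 'i \<Rightarrow> ('i \<times> 'g) set" where
  "absorbed J j = {t \<in> tokens J. below J (fst t) j \<or> fst t = j \<and> j \<notin> free J}"

definition sys_rule :: "('i, 'g) i_system \<Rightarrow> 'i \<times> 'g \<Rightarrow> ('i \<times> 'g) multiset \<Rightarrow> bool" where
  "sys_rule J t A \<longleftrightarrow> t \<in> tokens J \<and>
     (\<exists>y \<Gamma>. A = add_mset (fst t, y) \<Gamma> \<and> y \<in> carrier (grp J (fst t)) \<and> set_mset \<Gamma> \<subseteq> absorbed J (fst t) \<and>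
       snd t = y \<otimes>\<^bsub>grp J (fst t)\<^esub> mprod (grp J (fst t)) (theta J (fst t)) \<Gamma>)"

definition tokens_at :: "'i \<Rightarrow> ('i \<times> 'g) multiset \<Rightarrow> ('i \<times> 'g) multiset" where
  "tokens_at i \<alpha> = filter_mset (\<lambda>t. fst t = i) \<alpha>"

text \<open>The factor \<open>deg\<close> discards the number of tokens at a regular index, where
  the first coordinate has to stay 0.\<close>

definition coord :: "('i, 'g) i_system \<Rightarrow> 'i \<Rightarrow> ('i \<times> 'g) multiset \<Rightarrow> int \<times> 'g" where
  "coord J i \<alpha> = (deg J i * int (size (tokens_at i \<alpha>)), mprod (grp J i) snd (tokens_at i \<alpha>))"

definition vec :: "('i, 'g) i_system \<Rightarrow> 'i set \<Rightarrow> ('i \<times> 'g) multiset \<Rightarrow> 'i \<Rightarrow> int \<times> 'g" where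
  "vec J a \<alpha> = (\<lambda>i\<in>a. coord J i \<alpha>)"

text \<open>This is the lower set \<open>a\<close> for which the word represents an element of
  \<open>M\<^sub>a\<close>.\<close>

definition down :: "('i, 'g) i_system \<Rightarrow> ('i \<times> 'g) multiset \<Rightarrow> 'i set" where
  "down J \<alpha> = {i. \<exists>t\<in>#\<alpha>. (i, fst t) \<in> order_rel J}"

definition sys_class :: "('i, 'g) i_system \<Rightarrow> ('i \<times> 'g) multiset \<Rightarrow> 'i set \<times> ('i \<Rightarrow> int \<times> 'g) set" where
  "sys_class J \<alpha> = (down J \<alpha>, H_equiv J (down J \<alpha>) `` {vec J (down J \<alpha>) \<alpha>})"

lemma at_empty [simp]: "tokens_at i {#} = {#}" and at_add [simp]: "tokens_at i (\<alpha> + \<beta>) = tokens_at i \<alpha> + tokens_at i \<beta>"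
  by (simp_all add: tokens_at_def)

lemma at_add_mset: "tokens_at i (add_mset t \<alpha>) = (if fst t = i then add_mset t (tokens_at i \<alpha>) else tokens_at i \<alpha>)"
  by (simp add: tokens_at_def)

lemma at_id: "fst ` set_mset \<alpha> \<subseteq> {i} \<Longrightarrow> tokens_at i \<alpha> = \<alpha>"
  unfolding tokens_at_def by (auto simp: filter_mset_eq_conv)

lemma at_other: "i \<notin> fst ` set_mset \<alpha> \<Longrightarrow> tokens_at i \<alpha> = {#}"
  unfolding tokens_at_def by (induction \<alpha>) auto

lemma set_at: "set_mset (tokens_at i \<alpha>) \<subseteq> set_mset \<alpha>" "t \<in># tokens_at i \<alpha> \<Longrightarrow> fst t = i"
  by (auto simp: tokens_at_def)

lemma down_add [simp]: "down J (\<alpha> + \<beta>) = down J \<alpha> \<union> down J \<beta>"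
  and down_empty [simp]: "down J {#} = {}"
  by (auto simp: down_def)

section \<open>The rules of an I-system and their confluence\<close>

locale isys =
  fixes J :: "('i, 'g) i_system"
  assumes is_i_system: "is_i_system J"
begin

lemma partial_order: "partial_order_on (index J) (order_rel J)"
  using is_i_system by (simp add: is_i_system_def)

lemma order_refl: "i \<in> index J \<Longrightarrow> (i, i) \<in> order_rel J"
  using partial_order_onD(1)[OF partial_order] by (simp add: refl_on_def)

lemma order_trans: "(i, j) \<in> order_rel J \<Longrightarrow> (j, k) \<in> order_rel J \<Longrightarrow> (i, k) \<in> order_rel J"
  using partial_order_onD(2)[OF partial_order] by (rule transD)

lemma order_antisym: "(i, j) \<in> order_rel J \<Longrightarrow> (j, i) \<in> order_rel J \<Longrightarrow> i = j"
  using partial_order_onD(3)[OF partial_order] by (rule antisymD)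

lemma order_index: "(i, j) \<in> order_rel J \<Longrightarrow> i \<in> index J \<and> j \<in> index J"
  using partial_order_onD(4)[OF partial_order] by auto

lemma below_index: "below J i j \<Longrightarrow> i \<in> index J \<and> j \<in> index J"
  using order_index by (auto simp: below_def)

lemma below_trans: "below J i j \<Longrightarrow> below J j k \<Longrightarrow> below J i k"
  unfolding below_def by (metis order_trans order_antisym)

lemma below_irrefl [simp]: "\<not> below J i i"
  by (simp add: below_def)

lemma group: "i \<in> index J \<Longrightarrow> comm_group (grp J i)"
  using is_i_system by (simp add: is_i_system_def)

lemma phi_hom: "below J i j \<Longrightarrow> phi J j i \<in> hom (component J i) (grp J j)"
  using is_i_system by (simp add: is_i_system_def)

lemma phi_hat_functor:
  "(i, j) \<in> order_rel J \<Longrightarrow> (j, k) \<in> order_rel J \<Longrightarrow> u \<in> carrier (grothendieck J i) \<Longrightarrow>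
   phi_hat J k i u = phi_hat J k j (phi_hat J j i u)"
  using is_i_system by (simp add: is_i_system_def)

lemma free_generated:
  "i \<in> free J \<Longrightarrow> carrier (grp J i) =
     finite_sums (grp J i) {phi J i k x | k x. below J k i \<and> x \<in> carrier (component J k)}"
  using is_i_system by (simp add: is_i_system_def)

lemma free_index: "i \<in> free J \<Longrightarrow> i \<in> index J"
  using is_i_system by (auto simp: is_i_system_def)

lemma gr_group: "i \<in> index J \<Longrightarrow> comm_group (grothendieck J i)"
  by (rule comm_group_grothendieck) (rule group)

lemma gr_monoid: "i \<in> index J \<Longrightarrow> comm_monoid (grp J i)"
  by (rule comm_group.axioms(1)) (rule group)

lemma token_component: "(i, g) \<in> tokens J \<Longrightarrow> (deg J i, g) \<in> carrier (component J i)"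
  by (auto simp: tokens_def carrier_component deg_def)

lemma absorbed_tokens: "absorbed J j \<subseteq> tokens J"
  by (auto simp: absorbed_def)

lemma theta_closed:
  assumes "t \<in> absorbed J j" shows "theta J j t \<in> carrier (grp J j)"
proof (cases t)
  case (Pair i g)
  show ?thesis
  proof (cases "i = j")
    case True
    then show ?thesis using assms Pair by (auto simp: theta_def absorbed_def tokens_def)
  next
    case False
    with assms Pair have "below J i j" "(i, g) \<in> tokens J" by (auto simp: absorbed_def)
    then show ?thesis using False Pair
      by (auto simp: theta_def intro!: hom_in_carrier[OF phi_hom] token_component)
  qed
qed

lemma mprod_theta_add:
  assumes "j \<in> index J" "set_mset \<Gamma> \<subseteq> absorbed J j" "set_mset \<Delta> \<subseteq> absorbed J j"
  shows "mprod (grp J j) (theta J j) (\<Gamma> + \<Delta>) =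
    mprod (grp J j) (theta J j) \<Gamma> \<otimes>\<^bsub>grp J j\<^esub> mprod (grp J j) (theta J j) \<Delta>"
  using assms by (intro comm_monoid.mprod_add gr_monoid) (auto intro: theta_closed)

lemma sys_ruleI:
  assumes "j \<in> index J" "y \<in> carrier (grp J j)" "set_mset \<Gamma> \<subseteq> absorbed J j"
    and "x = y \<otimes>\<^bsub>grp J j\<^esub> mprod (grp J j) (theta J j) \<Gamma>"
  shows "sys_rule J (j, x) (add_mset (j, y) \<Gamma>)"
proof -
  interpret G: comm_group "grp J j" using assms by (intro group)
  show ?thesis using assms by (auto simp: sys_rule_def tokens_def)
qed

lemma sys_ruleE:
  assumes "sys_rule J t A"
  obtains j x y \<Gamma> where "t = (j, x)" "A = add_mset (j, y) \<Gamma>" "j \<in> index J"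
    "x \<in> carrier (grp J j)" "y \<in> carrier (grp J j)" "set_mset \<Gamma> \<subseteq> absorbed J j"
    "x = y \<otimes>\<^bsub>grp J j\<^esub> mprod (grp J j) (theta J j) \<Gamma>"
  using assms by (cases t) (auto simp: sys_rule_def tokens_def)

lemma sys_rule_closed: "sys_rule J t A \<Longrightarrow> t \<in> tokens J \<and> set_mset A \<subseteq> tokens J"
  using absorbed_tokens by (fastforce elim!: sys_ruleE simp: tokens_def)

lemma sys_confluent: "confluentp (rewrite (sys_rule J))"
proof (rule confluent_rewrite)
  fix t A B assume A: "sys_rule J t A" and B: "sys_rule J t B"
  from A obtain j x y \<Gamma> where 1: "t = (j, x)" "A = add_mset (j, y) \<Gamma>" "j \<in> index J"
    "x \<in> carrier (grp J j)" "y \<in> carrier (grp J j)" "set_mset \<Gamma> \<subseteq> absorbed J j"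
    "x = y \<otimes>\<^bsub>grp J j\<^esub> mprod (grp J j) (theta J j) \<Gamma>" by (rule sys_ruleE)
  from B 1(1) obtain z \<Delta> where 2: "B = add_mset (j, z) \<Delta>"
    "z \<in> carrier (grp J j)" "set_mset \<Delta> \<subseteq> absorbed J j"
    "x = z \<otimes>\<^bsub>grp J j\<^esub> mprod (grp J j) (theta J j) \<Delta>" by (auto elim!: sys_ruleE)
  interpret G: comm_group "grp J j" using 1 by (intro group)
  let ?\<theta> = "mprod (grp J j) (theta J j)"
  \<comment> \<open>This is what remains of \<open>x\<close> when both \<Gamma> and \<Delta> are
    split off, so that each rule can be followed by the other.\<close>
  define w where "w = x \<otimes>\<^bsub>grp J j\<^esub> inv\<^bsub>grp J j\<^esub> (?\<theta> \<Gamma> \<otimes>\<^bsub>grp J j\<^esub> ?\<theta> \<Delta>)"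
  have w: "w \<in> carrier (grp J j)" using 1 by (simp add: w_def)
  have "w \<otimes>\<^bsub>grp J j\<^esub> ?\<theta> \<Delta> = y"
    unfolding w_def using 1 by (simp add: G.inv_mult G.m_assoc G.m_lcomm)
  moreover have "w \<otimes>\<^bsub>grp J j\<^esub> ?\<theta> \<Gamma> = z"
    unfolding w_def 2(4) using 2 by (simp add: G.inv_mult G.m_assoc G.m_lcomm)
  ultimately have "sys_rule J (j, y) (add_mset (j, w) \<Delta>)" "sys_rule J (j, z) (add_mset (j, w) \<Gamma>)"
    using 1 2 w by (auto intro!: sys_ruleI)
  then have "rewrite (sys_rule J) A (add_mset (j, w) \<Delta> + \<Gamma>)" "rewrite (sys_rule J) B (add_mset (j, w) \<Gamma> + \<Delta>)"
    unfolding 1 2 by (auto intro: rewriteI simp del: add_mset_add_mset_same_iff union_mset_add_mset_left)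
  then show "\<exists>D. (rewrite (sys_rule J))\<^sup>=\<^sup>= A D \<and> (rewrite (sys_rule J))\<^sup>=\<^sup>= B D"
    by (auto simp: add.commute)
qed

lemma component_eq_coord:
  assumes i: "i \<in> index J" and x: "x \<in> carrier (component J i)"
  obtains A where "A \<noteq> {#}" "set_mset A \<subseteq> tokens J" "fst ` set_mset A \<subseteq> {i}" "coord J i A = x"
proof -
  interpret G: comm_group "grp J i" using i by (rule group)
  obtain n g where [simp]: "x = (n, g)" by (cases x)
  have g: "g \<in> carrier (grp J i)" using x by (auto simp: carrier_component)
  have one: "mprod (grp J i) snd (replicate_mset k (i, \<one>\<^bsub>grp J i\<^esub>)) = \<one>\<^bsub>grp J i\<^esub>" for k
    by (induction k) auto
  \<comment> \<open>One token carries \<open>g\<close>, the other n - 1 are neutral. At a regular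
    index n = 0, and \<open>nat\<close> truncates the number of further tokens to 0.\<close>
  let ?A = "add_mset (i, g) (replicate_mset (nat (n - 1)) (i, \<one>\<^bsub>grp J i\<^esub>))"
  have "tokens_at i ?A = ?A" by (rule at_id) (auto split: if_splits)
  moreover have "deg J i * (1 + int (nat (n - 1))) = n"
    using x by (auto simp: carrier_component deg_def split: if_splits)
  ultimately have "coord J i ?A = x" using g by (simp add: coord_def one)
  then show thesis
    by (intro that[of ?A]) (use g i in \<open>auto simp: tokens_def split: if_splits\<close>)
qed

text \<open>The tokens of a nonempty word at \<open>i\<close> add up inside
  \<open>M\<^sub>i\<close>, where \<phi> is additive; the empty word has no value there when
  \<open>i\<close> is free.\<close>

lemma phi_coord:
  assumes ij: "below J i j" and A: "A \<noteq> {#}" "set_mset A \<subseteq> tokens J" "fst ` set_mset A \<subseteq> {i}"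
  shows "coord J i A \<in> carrier (component J i) \<and>
    phi J j i (coord J i A) = mprod (grp J j) (theta J j) A"
  using A
proof (induction A rule: multiset_induct)
  case (add t A)
  interpret Gi: comm_group "grp J i" using ij below_index by (intro group) auto
  interpret Gj: comm_group "grp J j" using ij below_index by (intro group) auto
  obtain g where t: "t = (i, g)" and g: "g \<in> carrier (grp J i)" using add by (cases t) (auto simp: tokens_def)
  have tok: "(deg J i, g) \<in> carrier (component J i)" using add.prems t by (intro token_component) auto
  have \<theta>: "theta J j t = phi J j i (deg J i, g)" "theta J j t \<in> carrier (grp J j)"
    using ij t hom_in_carrier[OF phi_hom[OF ij] tok] by (auto simp: theta_def below_def)
  show ?case
  proof (cases "A = {#}")
    case True
    then show ?thesis using \<theta> tok t g by (simp add: coord_def at_add_mset)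
  next
    case False
    with add have IH: "coord J i A \<in> carrier (component J i)"
      "phi J j i (coord J i A) = mprod (grp J j) (theta J j) A" by auto
    have eq: "coord J i (add_mset t A) = (deg J i, g) \<otimes>\<^bsub>component J i\<^esub> coord J i A"
      using g t by (simp add: coord_def at_add_mset algebra_simps)
    have "coord J i (add_mset t A) \<in> carrier (component J i)"
      unfolding eq using IH tok by (auto simp: carrier_component split: if_splits)
    moreover have "phi J j i (coord J i (add_mset t A)) = mprod (grp J j) (theta J j) (add_mset t A)"
      unfolding eq using hom_mult[OF phi_hom[OF ij] tok IH(1)] IH(2) \<theta> by simp
    ultimately show ?thesis by simp
  qed
qed simp

text \<open>Condition (c2) in terms of tokens: each generator \<phi>(x) of \<open>G\<^sub>j\<close>
  is the \<open>theta\<close> value of a word that represents x.\<close>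

lemma free_group_element:
  assumes j: "j \<in> free J" and g: "g \<in> carrier (grp J j)"
  obtains \<Gamma> where "set_mset \<Gamma> \<subseteq> absorbed J j" "mprod (grp J j) (theta J j) \<Gamma> = g"
proof -
  interpret G: comm_group "grp J j" using j by (intro group free_index)
  from g free_generated[OF j] obtain xs where g: "g = foldr (\<otimes>\<^bsub>grp J j\<^esub>) xs \<one>\<^bsub>grp J j\<^esub>"
    and "set xs \<subseteq> {phi J j k x | k x. below J k j \<and> x \<in> carrier (component J k)}"
    by (auto simp: finite_sums_def)
  then have "\<exists>\<Gamma>. set_mset \<Gamma> \<subseteq> absorbed J j \<and> mprod (grp J j) (theta J j) \<Gamma> = foldr (\<otimes>\<^bsub>grp J j\<^esub>) xs \<one>\<^bsub>grp J j\<^esub>"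
  proof (induction xs arbitrary: g)
    case Nil
    show ?case by (intro exI[of _ "{#}"]) simp
  next
    case (Cons y ys)
    then obtain \<Gamma> where \<Gamma>: "set_mset \<Gamma> \<subseteq> absorbed J j"
      "mprod (grp J j) (theta J j) \<Gamma> = foldr (\<otimes>\<^bsub>grp J j\<^esub>) ys \<one>\<^bsub>grp J j\<^esub>" by auto
    from Cons.prems obtain k x where kx: "below J k j" "x \<in> carrier (component J k)" "y = phi J j k x" by auto
    then obtain A where A: "A \<noteq> {#}" "set_mset A \<subseteq> tokens J" "fst ` set_mset A \<subseteq> {k}" "coord J k A = x"
      using component_eq_coord below_index by metis
    have "mprod (grp J j) (theta J j) A = y" using phi_coord[OF kx(1) A(1-3)] A(4) kx(3) by simp
    moreover have "set_mset A \<subseteq> absorbed J j" using A kx by (auto simp: absorbed_def)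
    ultimately show ?case using \<Gamma> j
      by (intro exI[of _ "A + \<Gamma>"]) (simp add: mprod_theta_add free_index)
  qed
  with g that show thesis by blast
qed

lemma group_element:
  assumes j: "j \<in> index J" and g: "g \<in> carrier (grp J j)"
  obtains \<Gamma> where "set_mset \<Gamma> \<subseteq> absorbed J j" "mprod (grp J j) (theta J j) \<Gamma> = g"
proof (cases "j \<in> free J")
  case True
  then show ?thesis using free_group_element g that by blast
next
  case False
  interpret G: comm_group "grp J j" using j by (intro group)
  show ?thesis
    using False j g by (intro that[of "{#(j, g)#}"]) (auto simp: absorbed_def tokens_def theta_def)
qed

end

section \<open>Words with equal vectors are convertible\<close>

lemma conv_sum:
  assumes "finite S" "\<And>i. i \<in> S \<Longrightarrow> conv R (f i) (g i)"
  shows "conv R (\<Sum>i\<in>S. f i) (\<Sum>i\<in>S. g i)"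
  using assms by (induction S rule: finite_induct) (auto intro: conv_add)

lemma sum_at: "finite S \<Longrightarrow> fst ` set_mset \<alpha> \<subseteq> S \<Longrightarrow> (\<Sum>i\<in>S. tokens_at i \<alpha>) = \<alpha>"
proof (induction \<alpha>)
  case (add t \<alpha>)
  have "(\<Sum>i\<in>S. tokens_at i (add_mset t \<alpha>)) = (\<Sum>i\<in>S. (if i = fst t then {#t#} else {#}) + tokens_at i \<alpha>)"
    by (rule sum.cong) (auto simp: at_add_mset)
  with add show ?case by (simp add: sum.distrib)
qed simp

context isys
begin

abbreviation eqv :: "('i \<times> 'g) multiset \<Rightarrow> ('i \<times> 'g) multiset \<Rightarrow> bool" where
  "eqv \<equiv> conv (sys_rule J)"

lemma eqv_rule: "sys_rule J t A \<Longrightarrow> eqv {#t#} A"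
  by (intro r_into_equivclp rewrite_single)

text \<open>Both words are reducts of one single token, the one with group part y +
  \<theta>(\<Gamma>).\<close>

lemma eqv_same_value:
  assumes "j \<in> index J" "y \<in> carrier (grp J j)" "set_mset \<Gamma> \<subseteq> absorbed J j" "set_mset \<Delta> \<subseteq> absorbed J j"
    and eq: "mprod (grp J j) (theta J j) \<Gamma> = mprod (grp J j) (theta J j) \<Delta>"
  shows "eqv (add_mset (j, y) \<Gamma>) (add_mset (j, y) \<Delta>)"
proof -
  let ?x = "y \<otimes>\<^bsub>grp J j\<^esub> mprod (grp J j) (theta J j) \<Gamma>"
  have "eqv {#(j, ?x)#} (add_mset (j, y) \<Gamma>)" using assms by (intro eqv_rule sys_ruleI) auto
  moreover have "eqv {#(j, ?x)#} (add_mset (j, y) \<Delta>)"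
    using assms by (intro eqv_rule sys_ruleI) auto
  ultimately show ?thesis by (meson conv_trans equivclp_sym)
qed

text \<open>No rule merges the group parts of two tokens. Instead (c2) moves each group part into
  absorbed tokens and leaves neutral tokens, whose number is the degree.\<close>

lemma eqv_free_normal_form:
  assumes i: "i \<in> free J" and A: "set_mset A \<subseteq> tokens J" "fst ` set_mset A \<subseteq> {i}"
  shows "\<exists>\<Gamma>. set_mset \<Gamma> \<subseteq> absorbed J i \<and> mprod (grp J i) (theta J i) \<Gamma> = mprod (grp J i) snd A \<and>
    eqv A (replicate_mset (size A) (i, \<one>\<^bsub>grp J i\<^esub>) + \<Gamma>)"
  using A
proof (induction A)
  case empty
  interpret G: comm_group "grp J i" using i by (intro group free_index)
  show ?case by (intro exI[of _ "{#}"]) simp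
next
  case (add t A)
  interpret G: comm_group "grp J i" using i by (intro group free_index)
  obtain g where t: "t = (i, g)" and g: "g \<in> carrier (grp J i)" using add.prems by (cases t) (auto simp: tokens_def)
  from add obtain \<Gamma> where \<Gamma>: "set_mset \<Gamma> \<subseteq> absorbed J i" "mprod (grp J i) (theta J i) \<Gamma> = mprod (grp J i) snd A"
    "eqv A (replicate_mset (size A) (i, \<one>\<^bsub>grp J i\<^esub>) + \<Gamma>)" by auto
  obtain \<Delta> where \<Delta>: "set_mset \<Delta> \<subseteq> absorbed J i" "mprod (grp J i) (theta J i) \<Delta> = g"
    by (rule free_group_element[OF i g])
  have "eqv {#t#} ({#(i, \<one>\<^bsub>grp J i\<^esub>)#} + \<Delta>)"
    unfolding t using \<Delta> g i by (simp add: eqv_rule sys_ruleI free_index)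
  from conv_add[OF this \<Gamma>(3)] show ?case
    using \<Gamma> \<Delta> g t i by (intro exI[of _ "\<Delta> + \<Gamma>"]) (simp add: mprod_theta_add free_index ac_simps)
qed

lemma theta_at:
  assumes "fst ` set_mset A \<subseteq> {i}" "i \<in> index J" "set_mset A \<subseteq> tokens J"
  shows "mprod (grp J i) (theta J i) A = mprod (grp J i) snd A"
proof (rule comm_monoid.mprod_cong[OF gr_monoid])
  have fst: "fst t = i" if "t \<in># A" for t using assms(1) that by auto
  show "theta J i t = snd t" if "t \<in># A" for t using fst[OF that] by (simp add: theta_def)
  show "snd ` set_mset A \<subseteq> carrier (grp J i)"
    using fst assms(3) unfolding tokens_def by force
qed (rule assms)

text \<open>At a free index the two normal forms have the same number of neutral tokens, and
  \<open>eqv_same_value\<close> compares the absorbed parts. At a regular index both words are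
  reducts of the single token with the total group part. Nonemptiness matters: the empty word has
  the same coordinate as a neutral regular token.\<close>

lemma eqv_component:
  assumes i: "i \<in> index J" and A: "set_mset A \<subseteq> tokens J" "fst ` set_mset A \<subseteq> {i}" "A \<noteq> {#}"
    and B: "set_mset B \<subseteq> tokens J" "fst ` set_mset B \<subseteq> {i}" "B \<noteq> {#}"
    and eq: "coord J i A = coord J i B"
  shows "eqv A B"
proof -
  interpret G: comm_group "grp J i" using i by (rule group)
  have snd_eq: "mprod (grp J i) snd A = mprod (grp J i) snd B"
    using eq A B by (simp add: coord_def at_id)
  show ?thesis
  proof (cases "i \<in> free J")
    case True
    then have size: "size A = size B" using eq A B by (simp add: coord_def at_id deg_def)
    obtain \<Gamma> where \<Gamma>: "set_mset \<Gamma> \<subseteq> absorbed J i" "mprod (grp J i) (theta J i) \<Gamma> = mprod (grp J i) snd A"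
      "eqv A (replicate_mset (size A) (i, \<one>\<^bsub>grp J i\<^esub>) + \<Gamma>)"
      using eqv_free_normal_form[OF True A(1,2)] by blast
    obtain \<Delta> where \<Delta>: "set_mset \<Delta> \<subseteq> absorbed J i" "mprod (grp J i) (theta J i) \<Delta> = mprod (grp J i) snd B"
      "eqv B (replicate_mset (size B) (i, \<one>\<^bsub>grp J i\<^esub>) + \<Delta>)"
      using eqv_free_normal_form[OF True B(1,2)] by blast
    obtain k where k: "size A = Suc k" using A(3) by (cases "size A") auto
    have "eqv (add_mset (i, \<one>\<^bsub>grp J i\<^esub>) \<Gamma>) (add_mset (i, \<one>\<^bsub>grp J i\<^esub>) \<Delta>)"
      using \<Gamma> \<Delta> i snd_eq by (intro eqv_same_value) auto
    from conv_add_right[OF this, of "replicate_mset k (i, \<one>\<^bsub>grp J i\<^esub>)"]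
    have "eqv (replicate_mset (size A) (i, \<one>\<^bsub>grp J i\<^esub>) + \<Gamma>) (replicate_mset (size A) (i, \<one>\<^bsub>grp J i\<^esub>) + \<Delta>)"
      by (simp add: k ac_simps)
    with \<Gamma>(3) \<Delta>(3)[folded size] show ?thesis by (meson conv_trans equivclp_sym)
  next
    case False
    have "eqv {#(i, mprod (grp J i) snd A)#} C"
      if C: "set_mset C \<subseteq> tokens J" "fst ` set_mset C \<subseteq> {i}" "C \<noteq> {#}"
        "mprod (grp J i) snd C = mprod (grp J i) snd A" for C
    proof -
      from C(3) obtain t \<Gamma> where "C = add_mset t \<Gamma>" by (meson multiset_cases)
      moreover obtain y where "t = (i, y)" using C calculation by (cases t) auto
      ultimately have t: "C = add_mset (i, y) \<Gamma>" by simp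
      then have y: "y \<in> carrier (grp J i)" using C by (auto simp: tokens_def)
      have "set_mset \<Gamma> \<subseteq> absorbed J i" using C False by (auto simp: t absorbed_def)
      moreover have "mprod (grp J i) snd A = y \<otimes>\<^bsub>grp J i\<^esub> mprod (grp J i) (theta J i) \<Gamma>"
        using C y i unfolding t by (subst theta_at) auto
      ultimately show ?thesis unfolding t using i y by (intro eqv_rule sys_ruleI) auto
    qed
    from this[OF A refl] this[OF B snd_eq[symmetric]] show ?thesis by (meson conv_trans equivclp_sym)
  qed
qed

text \<open>A neutral token at a regular \<open>i\<close> is idempotent, so \<phi> sends it to an
  idempotent of the group \<open>G\<^sub>j\<close>, which is neutral. Any token at or above
  \<open>i\<close> can therefore emit it.\<close>

lemma eqv_absorb_one:
  assumes "i \<in> down J \<alpha>" "i \<in> index J" "i \<notin> free J" "set_mset \<alpha> \<subseteq> tokens J"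
  shows "eqv \<alpha> (add_mset (i, \<one>\<^bsub>grp J i\<^esub>) \<alpha>)"
proof -
  interpret Gi: comm_group "grp J i" using assms by (intro group)
  from assms(1) obtain t where t: "t \<in># \<alpha>" "(i, fst t) \<in> order_rel J" by (auto simp: down_def)
  obtain j x where [simp]: "t = (j, x)" by (cases t)
  have j: "j \<in> index J" "x \<in> carrier (grp J j)" using t assms by (auto simp: tokens_def)
  interpret Gj: comm_group "grp J j" using j by (intro group)
  have tok: "(i, \<one>\<^bsub>grp J i\<^esub>) \<in> tokens J" using assms by (simp add: tokens_def)
  have abs: "(i, \<one>\<^bsub>grp J i\<^esub>) \<in> absorbed J j"
    using t tok assms by (auto simp: absorbed_def below_def)
  have "theta J j (i, \<one>\<^bsub>grp J i\<^esub>) = \<one>\<^bsub>grp J j\<^esub>"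
  proof (cases "i = j")
    case False
    then have "below J i j" using t by (simp add: below_def)
    moreover have "(deg J i, \<one>\<^bsub>grp J i\<^esub>) \<otimes>\<^bsub>component J i\<^esub> (deg J i, \<one>\<^bsub>grp J i\<^esub>) = (deg J i, \<one>\<^bsub>grp J i\<^esub>)"
      using assms by (simp add: deg_def)
    ultimately have "theta J j (i, \<one>\<^bsub>grp J i\<^esub>) \<otimes>\<^bsub>grp J j\<^esub> theta J j (i, \<one>\<^bsub>grp J i\<^esub>) = theta J j (i, \<one>\<^bsub>grp J i\<^esub>)"
      using hom_mult[OF phi_hom token_component[OF tok] token_component[OF tok]] False
      by (simp add: theta_def)
    then show ?thesis using theta_closed[OF abs] by (metis Gj.r_cancel_one')
  qed (simp add: theta_def)
  then have "eqv {#(j, x)#} {#(j, x), (i, \<one>\<^bsub>grp J i\<^esub>)#}"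
    using sys_ruleI[of j x "{#(i, \<one>\<^bsub>grp J i\<^esub>)#}"] abs j by (intro eqv_rule) simp
  from conv_add_right[OF this, of "\<alpha> - {#t#}"] t show ?thesis
    by (auto dest!: multi_member_split simp: add_mset_commute)
qed

lemma coord_add:
  assumes "i \<in> index J" "set_mset \<alpha> \<subseteq> tokens J" "set_mset \<beta> \<subseteq> tokens J"
  shows "coord J i (\<alpha> + \<beta>) = coord J i \<alpha> \<otimes>\<^bsub>grothendieck J i\<^esub> coord J i \<beta>"
proof -
  have "snd ` set_mset (tokens_at i \<alpha>) \<subseteq> carrier (grp J i)" "snd ` set_mset (tokens_at i \<beta>) \<subseteq> carrier (grp J i)"
    using assms by (auto simp: tokens_at_def tokens_def)
  then show ?thesis
    using assms by (simp add: coord_def comm_monoid.mprod_add[OF gr_monoid] algebra_simps)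
qed

lemma coord_closed: "i \<in> index J \<Longrightarrow> coord J i \<alpha> \<in> carrier (grothendieck J i)"
  by (auto simp: coord_def carrier_grothendieck deg_def intro: comm_monoid.mprod_closed[OF gr_monoid])

lemma coord_other: "i \<in> index J \<Longrightarrow> i \<notin> fst ` set_mset \<alpha> \<Longrightarrow> coord J i \<alpha> = \<one>\<^bsub>grothendieck J i\<^esub>"
  by (simp add: coord_def at_other comm_monoid.mprod_empty[OF gr_monoid])

lemma coord_at: "coord J i (tokens_at i \<alpha>) = coord J i \<alpha>"
  by (simp add: coord_def tokens_at_def filter_filter_mset)

lemma free_support:
  assumes "i \<in> free J" "fst (coord J i \<alpha>) = fst (coord J i \<beta>)"
  shows "i \<in> fst ` set_mset \<alpha> \<longleftrightarrow> i \<in> fst ` set_mset \<beta>"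
proof -
  have "tokens_at i \<alpha> = {#} \<longleftrightarrow> tokens_at i \<beta> = {#}" using assms by (simp add: coord_def deg_def flip: size_eq_0_iff_empty)
  moreover have "i \<in> fst ` set_mset \<gamma> \<longleftrightarrow> tokens_at i \<gamma> \<noteq> {#}" for \<gamma> :: "('i \<times> 'g) multiset"
    unfolding tokens_at_def by (induction \<gamma>) auto
  ultimately show ?thesis by simp
qed

text \<open>Comparing index by index with \<open>eqv_component\<close> needs nonempty parts on both
  sides, which is what equal supports provide.\<close>

lemma eqv_same_support:
  assumes T: "set_mset \<alpha> \<subseteq> tokens J" "set_mset \<beta> \<subseteq> tokens J"
    and supp: "fst ` set_mset \<alpha> = fst ` set_mset \<beta>"
    and coord: "\<And>i. i \<in> index J \<Longrightarrow> coord J i \<alpha> = coord J i \<beta>"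
  shows "eqv \<alpha> \<beta>"
proof -
  let ?S = "fst ` set_mset \<alpha>"
  have "eqv (\<Sum>i\<in>?S. tokens_at i \<alpha>) (\<Sum>i\<in>?S. tokens_at i \<beta>)"
  proof (rule conv_sum)
    fix i assume i: "i \<in> ?S"
    then have "i \<in> index J" using T by (auto simp: tokens_def)
    moreover have "tokens_at i \<alpha> \<noteq> {#}" using i by (auto simp: tokens_at_def multiset_eq_iff)
    moreover have "tokens_at i \<beta> \<noteq> {#}"
      using i unfolding supp by (auto simp: tokens_at_def multiset_eq_iff)
    ultimately show "eqv (tokens_at i \<alpha>) (tokens_at i \<beta>)"
      using coord[of i] T set_at(1)[of i] set_at(2) by (intro eqv_component[of i]) (auto simp: coord_at)
  qed simp
  then show ?thesis by (simp add: sum_at supp)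
qed

lemma eqv_absorb_ones:
  assumes "finite D" "D \<subseteq> down J \<alpha>" "D \<subseteq> index J - free J" "set_mset \<alpha> \<subseteq> tokens J"
  shows "eqv \<alpha> (\<alpha> + image_mset (\<lambda>i. (i, \<one>\<^bsub>grp J i\<^esub>)) (mset_set D))"
  using assms
proof (induction D rule: finite_induct)
  case (insert i D)
  let ?\<beta> = "\<alpha> + image_mset (\<lambda>i. (i, \<one>\<^bsub>grp J i\<^esub>)) (mset_set D)"
  have "i \<in> down J ?\<beta>" using insert by auto
  moreover have "set_mset ?\<beta> \<subseteq> tokens J"
    using insert monoid.one_closed[OF comm_monoid.axioms(1)[OF gr_monoid]] by (auto simp: tokens_def)
  ultimately have "eqv ?\<beta> (add_mset (i, \<one>\<^bsub>grp J i\<^esub>) ?\<beta>)" using insert by (intro eqv_absorb_one) auto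
  with insert show ?case by (auto intro: conv_trans)
qed simp

lemma coord_ones:
  assumes "i \<in> index J" "finite D" "D \<subseteq> index J - free J"
  shows "coord J i (image_mset (\<lambda>i. (i, \<one>\<^bsub>grp J i\<^esub>)) (mset_set D)) = \<one>\<^bsub>grothendieck J i\<^esub>"
proof -
  interpret G: comm_group "grp J i" using assms by (intro group)
  have "mprod (grp J i) snd (tokens_at i (image_mset (\<lambda>i. (i, \<one>\<^bsub>grp J i\<^esub>)) M)) = \<one>\<^bsub>grp J i\<^esub>" for M
    by (induction M) (auto simp: at_add_mset)
  moreover have "i \<in> D \<Longrightarrow> deg J i = 0" using assms by (auto simp: deg_def)
  moreover have "i \<notin> D \<Longrightarrow> tokens_at i (image_mset (\<lambda>i. (i, \<one>\<^bsub>grp J i\<^esub>)) (mset_set D)) = {#}"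
    using assms by (intro at_other) auto
  ultimately show ?thesis by (auto simp: coord_def)
qed

lemma support_down:
  assumes "set_mset \<gamma> \<subseteq> tokens J" shows "fst ` set_mset \<gamma> \<subseteq> down J \<gamma>"
proof
  fix i assume "i \<in> fst ` set_mset \<gamma>"
  then obtain t where t: "t \<in># \<gamma>" "i = fst t" by blast
  then have "fst t \<in> index J" using assms by (auto simp: tokens_def)
  with t show "i \<in> down J \<gamma>" using order_refl by (auto simp: down_def)
qed

text \<open>Equal vectors force equal supports at free indices only, because neutral regular tokens
  leave no trace. Adding a neutral token at every regular index that occurs in either word makes the
  supports equal, and both words absorb these tokens because they generate the same lower
  set.\<close>

lemma eqv_of_vec_eq:
  assumes T: "set_mset \<alpha> \<subseteq> tokens J" "set_mset \<beta> \<subseteq> tokens J"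
    and down: "down J \<alpha> = down J \<beta>" and vec: "vec J (down J \<alpha>) \<alpha> = vec J (down J \<alpha>) \<beta>"
  shows "eqv \<alpha> \<beta>"
proof -
  note supp = support_down
  have coord: "coord J i \<alpha> = coord J i \<beta>" if i: "i \<in> index J" for i
  proof (cases "i \<in> down J \<alpha>")
    case True
    then show ?thesis using fun_cong[OF vec, of i] by (simp add: vec_def)
  next
    case False
    then have "i \<notin> fst ` set_mset \<alpha>" "i \<notin> fst ` set_mset \<beta>" using subsetD[OF supp[OF T(1)], of i] subsetD[OF supp[OF T(2)], of i] down by auto
    then show ?thesis using i by (simp add: coord_other)
  qed
  define D where "D = (fst ` set_mset \<alpha> \<union> fst ` set_mset \<beta>) - free J"
  define ones where "ones = image_mset (\<lambda>i. (i, \<one>\<^bsub>grp J i\<^esub>)) (mset_set D)"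
  have D: "finite D" "D \<subseteq> index J - free J" using T by (auto simp: D_def tokens_def)
  have DD: "D \<subseteq> down J \<alpha>" using supp[OF T(1)] supp[OF T(2)] down by (auto simp: D_def)
  have ones: "set_mset ones \<subseteq> tokens J" "fst ` set_mset ones = D"
    using D monoid.one_closed[OF comm_monoid.axioms(1)[OF gr_monoid]] by (auto simp: ones_def tokens_def image_image)
  have "eqv (\<alpha> + ones) (\<beta> + ones)"
  proof (rule eqv_same_support)
    have "i \<in> fst ` set_mset \<alpha> \<longleftrightarrow> i \<in> fst ` set_mset \<beta>" if "i \<in> free J" for i
      by (rule free_support[OF that]) (simp add: coord[OF free_index[OF that]])
    then show "fst ` set_mset (\<alpha> + ones) = fst ` set_mset (\<beta> + ones)"
      unfolding set_mset_union image_Un ones(2) D_def by blast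
    show "coord J i (\<alpha> + ones) = coord J i (\<beta> + ones)" if "i \<in> index J" for i
      using that T ones coord by (simp add: coord_add)
  qed (use T ones in auto)
  moreover have "eqv \<alpha> (\<alpha> + ones)" unfolding ones_def using D DD T by (intro eqv_absorb_ones) auto
  moreover have "eqv \<beta> (\<beta> + ones)" unfolding ones_def using D DD T down by (intro eqv_absorb_ones) auto
  ultimately show ?thesis by (meson conv_trans equivclp_sym)
qed

section \<open>The groups \<open>H_hat\<close> and congruence modulo \<open>U_rel\<close>\<close>

lemma carrier_H:
  assumes "a \<subseteq> index J"
  shows "carrier (H_hat J a) = {z \<in> \<Pi>\<^sub>E i\<in>a. carrier (grothendieck J i).
    finite {i \<in> a. z i \<noteq> \<one>\<^bsub>grothendieck J i\<^esub>}}"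
  unfolding H_hat_def using assms by (intro carrier_sum_group comm_group.axioms(2) gr_group) auto

lemma mult_H: "x \<otimes>\<^bsub>H_hat J a\<^esub> y = (\<lambda>i\<in>a. x i \<otimes>\<^bsub>grothendieck J i\<^esub> y i)"
  by (simp add: H_hat_def del: mult_grothendieck)

lemma one_H: "\<one>\<^bsub>H_hat J a\<^esub> = (\<lambda>i\<in>a. \<one>\<^bsub>grothendieck J i\<^esub>)"
  by (simp add: H_hat_def del: one_grothendieck)

lemma H_group:
  assumes "a \<subseteq> index J" shows "comm_group (H_hat J a)"
proof (rule group.group_comm_groupI)
  show "group (H_hat J a)"
    unfolding H_hat_def using assms by (intro sum_group comm_group.axioms(2) gr_group) auto
  fix x y assume "x \<in> carrier (H_hat J a)" "y \<in> carrier (H_hat J a)"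
  then have "x i \<otimes>\<^bsub>grothendieck J i\<^esub> y i = y i \<otimes>\<^bsub>grothendieck J i\<^esub> x i" if "i \<in> a" for i
    using that assms comm_monoid.m_comm[OF comm_group.axioms(1)[OF gr_group], of i "x i" "y i"]
    by (auto simp: carrier_H simp del: mult_grothendieck)
  then show "x \<otimes>\<^bsub>H_hat J a\<^esub> y = y \<otimes>\<^bsub>H_hat J a\<^esub> x"
    by (auto simp: mult_H simp del: mult_grothendieck)
qed

lemma vec_closed:
  assumes "a \<subseteq> index J" shows "vec J a \<alpha> \<in> carrier (H_hat J a)"
proof -
  have "{i \<in> a. vec J a \<alpha> i \<noteq> \<one>\<^bsub>grothendieck J i\<^esub>} \<subseteq> fst ` set_mset \<alpha>"
    using assms coord_other by (auto simp: vec_def simp del: one_grothendieck)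
  then have "finite {i \<in> a. vec J a \<alpha> i \<noteq> \<one>\<^bsub>grothendieck J i\<^esub>}" by (rule finite_subset) simp
  then show ?thesis using assms coord_closed by (auto simp: carrier_H vec_def simp del: one_grothendieck)
qed

lemma vec_add:
  assumes "a \<subseteq> index J" "set_mset \<alpha> \<subseteq> tokens J" "set_mset \<beta> \<subseteq> tokens J"
  shows "vec J a (\<alpha> + \<beta>) = vec J a \<alpha> \<otimes>\<^bsub>H_hat J a\<^esub> vec J a \<beta>"
proof (rule ext)
  show "vec J a (\<alpha> + \<beta>) i = (vec J a \<alpha> \<otimes>\<^bsub>H_hat J a\<^esub> vec J a \<beta>) i" for i
    using assms coord_add[of i \<alpha> \<beta>] by (auto simp: vec_def mult_H simp del: mult_grothendieck)
qed

lemma chi_closed: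
  assumes "a \<subseteq> index J" "i \<in> a" "u \<in> carrier (grothendieck J i)"
  shows "chi J a i u \<in> carrier (H_hat J a)"
proof -
  have "{k \<in> a. chi J a i u k \<noteq> \<one>\<^bsub>grothendieck J k\<^esub>} \<subseteq> {i}"
    by (auto simp: chi_def simp del: one_grothendieck)
  then have "finite {k \<in> a. chi J a i u k \<noteq> \<one>\<^bsub>grothendieck J k\<^esub>}" by (rule finite_subset) simp
  then show ?thesis using assms monoid.one_closed[OF comm_monoid.axioms(1)[OF comm_group.axioms(1)[OF gr_group]]]
    by (auto simp: carrier_H chi_def simp del: one_grothendieck)
qed

lemma chi_mult:
  assumes "a \<subseteq> index J"
  shows "chi J a i (u \<otimes>\<^bsub>grothendieck J i\<^esub> v) = chi J a i u \<otimes>\<^bsub>H_hat J a\<^esub> chi J a i v"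
proof -
  have "\<one>\<^bsub>grothendieck J k\<^esub> \<otimes>\<^bsub>grothendieck J k\<^esub> \<one>\<^bsub>grothendieck J k\<^esub> = \<one>\<^bsub>grothendieck J k\<^esub>" if "k \<in> a" for k
    using that assms monoid.l_one[OF comm_monoid.axioms(1)[OF comm_group.axioms(1)[OF gr_group]]]
      monoid.one_closed[OF comm_monoid.axioms(1)[OF comm_group.axioms(1)[OF gr_group]]] by (metis subsetD)
  then show ?thesis by (auto simp: chi_def mult_H simp del: mult_grothendieck one_grothendieck)
qed

lemma chi_one: "chi J a i \<one>\<^bsub>grothendieck J i\<^esub> = \<one>\<^bsub>H_hat J a\<^esub>"
  by (auto simp: chi_def one_H)

lemma vec_single_index:
  assumes "a \<subseteq> index J" "fst ` set_mset A \<subseteq> {i}"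
  shows "vec J a A = chi J a i (coord J i A)"
proof (rule ext)
  fix k
  have "coord J k A = \<one>\<^bsub>grothendieck J k\<^esub>" if "k \<in> a" "k \<noteq> i"
    using that assms by (intro coord_other) auto
  then show "vec J a A k = chi J a i (coord J i A) k"
    by (auto simp: vec_def chi_def simp del: one_grothendieck)
qed

lemma coord_token: "(i, g) \<in> tokens J \<Longrightarrow> coord J i {#(i, g)#} = (deg J i, g)"
proof -
  assume t: "(i, g) \<in> tokens J"
  then interpret G: comm_group "grp J i" by (intro group) (auto simp: tokens_def)
  show ?thesis using t by (simp add: coord_def at_add_mset tokens_def)
qed

lemma vec_token:
  assumes "a \<subseteq> index J" "(i, g) \<in> tokens J"
  shows "vec J a {#(i, g)#} = chi J a i (deg J i, g)"
  using assms vec_single_index[of a "{#(i, g)#}" i] by (simp add: coord_token)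

lemma phi_ext_hom': "below J i j \<Longrightarrow> phi_ext J j i \<in> hom (grothendieck J i) (grp J j)"
  using below_index by (intro phi_ext_hom group phi_hom) auto

lemma phi_hat_component:
  "below J i j \<Longrightarrow> u \<in> carrier (component J i) \<Longrightarrow> phi_hat J j i u = (0, phi J j i u)"
  using phi_ext_component[OF group group phi_hom, of i j u] below_index
  by (auto simp: phi_hat_def below_def)

lemma phi_hat_closed:
  "below J i j \<Longrightarrow> u \<in> carrier (grothendieck J i) \<Longrightarrow> phi_hat J j i u \<in> carrier (grothendieck J j)"
  using hom_in_carrier[OF phi_ext_hom', of i j u] by (auto simp: phi_hat_def below_def carrier_grothendieck)

lemma phi_hat_mult:
  "below J i j \<Longrightarrow> u \<in> carrier (grothendieck J i) \<Longrightarrow> v \<in> carrier (grothendieck J i) \<Longrightarrow>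
   phi_hat J j i (u \<otimes>\<^bsub>grothendieck J i\<^esub> v) = phi_hat J j i u \<otimes>\<^bsub>grothendieck J j\<^esub> phi_hat J j i v"
  using hom_mult[OF phi_ext_hom', of i j u v] by (auto simp: phi_hat_def below_def)

lemma lower_setsD:
  assumes "a \<in> lower_sets J"
  shows "a \<subseteq> index J" "j \<in> a \<Longrightarrow> (i, j) \<in> order_rel J \<Longrightarrow> i \<in> a" "finite (max_elems J a)"
    "i \<in> a \<Longrightarrow> \<exists>m\<in>max_elems J a. (i, m) \<in> order_rel J"
  using assms unfolding lower_sets_def by blast+

lemma max_elems_subset: "max_elems J a \<subseteq> a"
  by (auto simp: max_elems_def)

definition gens :: "'i set \<Rightarrow> ('i \<Rightarrow> int \<times> 'g) set" where
  "gens a = {chi J a i u \<otimes>\<^bsub>H_hat J a\<^esub> inv\<^bsub>H_hat J a\<^esub> chi J a j (phi_hat J j i u) | i j u.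
        below J i j \<and> j \<in> max_elems J a \<and> u \<in> carrier (grothendieck J i)}"

lemma U_rel_eq: "U_rel J a = generate (H_hat J a) (gens a)"
  by (simp add: U_rel_def gens_def)

lemma below_lower: "a \<in> lower_sets J \<Longrightarrow> below J i j \<Longrightarrow> j \<in> a \<Longrightarrow> i \<in> a"
  unfolding below_def using lower_setsD(2) by blast

lemma gens_closed:
  assumes a: "a \<in> lower_sets J" shows "gens a \<subseteq> carrier (H_hat J a)"
proof -
  interpret H: comm_group "H_hat J a" using a by (intro H_group lower_setsD)
  show ?thesis
    unfolding gens_def using a max_elems_subset[of a]
    by (auto intro!: H.m_closed H.inv_closed chi_closed lower_setsD(1) phi_hat_closed intro: below_lower)
qed

lemma U_subgroup: "a \<in> lower_sets J \<Longrightarrow> subgroup (U_rel J a) (H_hat J a)"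
  unfolding U_rel_eq
  by (intro group.generate_is_subgroup comm_group.axioms(2) H_group lower_setsD gens_closed)

abbreviation cong :: "'i set \<Rightarrow> ('i \<Rightarrow> int \<times> 'g) \<Rightarrow> ('i \<Rightarrow> int \<times> 'g) \<Rightarrow> bool" where
  "cong a \<equiv> group_cong (H_hat J a) (U_rel J a)"

lemmas cong_refl = comm_group.group_cong_refl[OF H_group U_subgroup]
  and cong_sym = comm_group.group_cong_sym[OF H_group U_subgroup]
  and cong_trans = comm_group.group_cong_trans[OF H_group U_subgroup]
  and cong_mult = comm_group.group_cong_mult[OF H_group U_subgroup]

lemma cong_gen:
  assumes a: "a \<in> lower_sets J" and ij: "below J i j" "j \<in> max_elems J a" "u \<in> carrier (grothendieck J i)"
  shows "cong a (chi J a i u) (chi J a j (phi_hat J j i u))"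
proof -
  have "chi J a i u \<otimes>\<^bsub>H_hat J a\<^esub> inv\<^bsub>H_hat J a\<^esub> chi J a j (phi_hat J j i u) \<in> gens a"
    unfolding gens_def using ij by blast
  moreover have "j \<in> a" using ij max_elems_subset by blast
  ultimately show ?thesis
    using a ij unfolding group_cong_def U_rel_eq
    by (auto intro!: chi_closed lower_setsD(1) phi_hat_closed generate.incl intro: below_lower)
qed

text \<open>The generators of \<open>U_rel\<close> only concern maximal indices. For other
  \<open>j\<close>, both sides are congruent to the same element at a maximal index above
  \<open>j\<close>, by functoriality of \<open>phi_hat\<close>.\<close>

lemma cong_chi:
  assumes a: "a \<in> lower_sets J" and ij: "below J i j" "j \<in> a" "u \<in> carrier (grothendieck J i)"
  shows "cong a (chi J a i u) (chi J a j (phi_hat J j i u))"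
proof -
  obtain m where m: "m \<in> max_elems J a" "(j, m) \<in> order_rel J" using lower_setsD(4)[OF a ij(2)] by blast
  show ?thesis
  proof (cases "j = m")
    case True
    then show ?thesis using cong_gen a ij m by simp
  next
    case False
    then have jm: "below J j m" using m by (simp add: below_def)
    have "phi_hat J m i u = phi_hat J m j (phi_hat J j i u)"
      using ij jm by (intro phi_hat_functor) (auto simp: below_def)
    moreover have "cong a (chi J a i u) (chi J a m (phi_hat J m i u))"
      using a ij jm m by (intro cong_gen) (auto intro: below_trans)
    moreover have "cong a (chi J a j (phi_hat J j i u)) (chi J a m (phi_hat J m j (phi_hat J j i u)))"
      using a ij jm m by (intro cong_gen phi_hat_closed)
    ultimately show ?thesis using cong_trans cong_sym a lower_setsD(1)[OF a] by metis
  qed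
qed

lemma phi_hat_theta:
  "below J i j \<Longrightarrow> (i, g) \<in> tokens J \<Longrightarrow> phi_hat J j i (deg J i, g) = (0, theta J j (i, g))"
  by (simp add: phi_hat_component token_component) (simp add: theta_def below_def)

text \<open>A token below \<open>j\<close> moves to \<open>j\<close> by \<open>cong_chi\<close>; a
  token at a regular \<open>j\<close> itself already has the required form.\<close>

lemma cong_theta:
  assumes a: "a \<in> lower_sets J" and j: "j \<in> a" and \<Gamma>: "set_mset \<Gamma> \<subseteq> absorbed J j"
  shows "cong a (vec J a \<Gamma>) (chi J a j (0, mprod (grp J j) (theta J j) \<Gamma>))"
  using \<Gamma>
proof (induction \<Gamma>)
  case empty
  have j: "j \<in> index J" using a j lower_setsD(1) by blast
  then interpret G: comm_group "grp J j" by (rule group)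
  have "vec J a {#} = \<one>\<^bsub>H_hat J a\<^esub>"
    using vec_single_index[OF lower_setsD(1)[OF a], of "{#}" j] coord_other[OF j, of "{#}"] chi_one[of a j]
    by simp
  then show ?case using chi_one[of a j] cong_refl[OF lower_setsD(1)[OF a] a]
      vec_closed[OF lower_setsD(1)[OF a], of "{#}"] by simp
next
  case (add t \<Gamma>)
  have j': "j \<in> index J" using a j lower_setsD(1) by blast
  then interpret G: comm_group "grp J j" by (rule group)
  obtain i g where t: "t = (i, g)" by (cases t)
  have tok: "(i, g) \<in> tokens J" and \<theta>: "theta J j t \<in> carrier (grp J j)"
    using add.prems absorbed_tokens theta_closed t by auto
  have "cong a (vec J a {#t#}) (chi J a j (0, theta J j t))"
  proof (cases "i = j")
    case True
    then have "deg J i = 0" using add.prems t by (auto simp: absorbed_def deg_def)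
    then have "vec J a {#t#} = chi J a j (0, theta J j t)"
      using tok True a by (simp add: t vec_token lower_setsD(1) theta_def)
    then show ?thesis using cong_refl[OF lower_setsD(1)[OF a] a] vec_closed[OF lower_setsD(1)[OF a]] by metis
  next
    case False
    then have ij: "below J i j" using add.prems t by (auto simp: absorbed_def)
    show ?thesis
      using cong_chi[OF a ij j, of "(deg J i, g)"] token_component[OF tok] component_subset[of J i] tok ij
      by (auto simp: t vec_token[OF lower_setsD(1)[OF a]] phi_hat_theta)
  qed
  with add have "cong a (vec J a {#t#} \<otimes>\<^bsub>H_hat J a\<^esub> vec J a \<Gamma>)
    (chi J a j (0, theta J j t) \<otimes>\<^bsub>H_hat J a\<^esub> chi J a j (0, mprod (grp J j) (theta J j) \<Gamma>))"
    using a by (intro cong_mult lower_setsD(1)) auto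
  moreover have "vec J a {#t#} \<otimes>\<^bsub>H_hat J a\<^esub> vec J a \<Gamma> = vec J a (add_mset t \<Gamma>)"
    using vec_add[OF lower_setsD(1)[OF a], of "{#t#}" \<Gamma>] subset_trans[OF add.prems absorbed_tokens] by auto
  moreover have "chi J a j (0, theta J j t) \<otimes>\<^bsub>H_hat J a\<^esub> chi J a j (0, mprod (grp J j) (theta J j) \<Gamma>) =
      chi J a j (0, mprod (grp J j) (theta J j) (add_mset t \<Gamma>))"
    using \<theta> by (simp add: chi_mult[OF lower_setsD(1)[OF a], symmetric])
  ultimately show ?case by simp
qed

text \<open>The rewritten index survives, and the absorbed tokens lie at or below it.\<close>

lemma rewrite_down: "rewrite (sys_rule J) \<alpha> \<beta> \<Longrightarrow> down J \<alpha> = down J \<beta>"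
proof -
  assume "rewrite (sys_rule J) \<alpha> \<beta>"
  then obtain t A \<Gamma> where R: "sys_rule J t A" and [simp]: "\<alpha> = add_mset t \<Gamma>" "\<beta> = A + \<Gamma>"
    by (auto elim: rewrite.cases)
  from R obtain j x y \<Delta> where [simp]: "t = (j, x)" "A = add_mset (j, y) \<Delta>" and \<Delta>: "set_mset \<Delta> \<subseteq> absorbed J j"
    by (auto elim: sys_ruleE)
  have "i \<in> down J {#(j, x)#}" if "i \<in> down J \<Delta>" for i
    using that \<Delta> order_trans by (fastforce simp: down_def absorbed_def below_def)
  then show ?thesis by (auto simp: down_def)
qed

lemma rewrite_tokens: "rewrite (sys_rule J) \<alpha> \<beta> \<Longrightarrow> set_mset \<alpha> \<subseteq> tokens J \<longleftrightarrow> set_mset \<beta> \<subseteq> tokens J"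
  by (auto elim!: rewrite.cases dest: sys_rule_closed[THEN conjunct1] sys_rule_closed[THEN conjunct2, THEN subsetD])

text \<open>A rule says x = y + \<theta>(\<Delta>) in \<open>G\<^sub>j\<close>, and by
  \<open>cong_theta\<close> the vector of \<Delta> is congruent to \<theta>(\<Delta>) placed at
  \<open>j\<close>.\<close>

lemma rewrite_cong:
  assumes a: "a \<in> lower_sets J" "down J \<alpha> \<subseteq> a" and \<alpha>: "set_mset \<alpha> \<subseteq> tokens J"
    and \<alpha>\<beta>: "rewrite (sys_rule J) \<alpha> \<beta>"
  shows "cong a (vec J a \<alpha>) (vec J a \<beta>)"
proof -
  note ai = lower_setsD(1)[OF a(1)]
  interpret H: comm_group "H_hat J a" by (rule H_group) (rule ai)
  from \<alpha>\<beta> obtain t A \<Gamma> where R: "sys_rule J t A" and \<alpha>_eq: "\<alpha> = {#t#} + \<Gamma>" and \<beta>_eq: "\<beta> = A + \<Gamma>"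
    by (auto elim: rewrite.cases)
  from R obtain j x y \<Delta> where t: "t = (j, x)" and A: "A = {#(j, y)#} + \<Delta>" and j: "j \<in> index J" and
    xy: "x \<in> carrier (grp J j)" "y \<in> carrier (grp J j)" and \<Delta>: "set_mset \<Delta> \<subseteq> absorbed J j"
    and x: "x = y \<otimes>\<^bsub>grp J j\<^esub> mprod (grp J j) (theta J j) \<Delta>"
    by (auto elim: sys_ruleE)
  interpret G: comm_group "grp J j" using j by (rule group)
  have ja: "j \<in> a" using a(2) support_down[OF \<alpha>] by (auto simp: \<alpha>_eq t)
  have tok: "(j, x) \<in> tokens J" "(j, y) \<in> tokens J" using j xy by (auto simp: tokens_def)
  have gr: "(deg J j, y) \<in> carrier (grothendieck J j)"
    using token_component[OF tok(2)] component_subset by (rule_tac subsetD)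
  have "vec J a {#t#} = chi J a j (deg J j, y) \<otimes>\<^bsub>H_hat J a\<^esub> chi J a j (0, mprod (grp J j) (theta J j) \<Delta>)"
    using tok by (simp add: t vec_token ai x chi_mult[symmetric])
  moreover have "cong a (chi J a j (deg J j, y)) (vec J a {#(j, y)#})"
    using tok gr ja by (simp add: vec_token ai cong_refl a chi_closed)
  ultimately have "cong a (vec J a {#t#}) (vec J a {#(j, y)#} \<otimes>\<^bsub>H_hat J a\<^esub> vec J a \<Delta>)"
    using cong_sym[OF ai a(1) cong_theta[OF a(1) ja \<Delta>]] by (simp add: cong_mult ai a)
  also have "vec J a {#(j, y)#} \<otimes>\<^bsub>H_hat J a\<^esub> vec J a \<Delta> = vec J a A"
    unfolding A using \<Delta> absorbed_tokens[of j] tok by (intro vec_add[symmetric] ai) auto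
  finally have "cong a (vec J a {#t#} \<otimes>\<^bsub>H_hat J a\<^esub> vec J a \<Gamma>) (vec J a A \<otimes>\<^bsub>H_hat J a\<^esub> vec J a \<Gamma>)"
    using cong_refl[OF ai a(1) vec_closed[OF ai]] by (intro cong_mult ai a)
  moreover have "vec J a {#t#} \<otimes>\<^bsub>H_hat J a\<^esub> vec J a \<Gamma> = vec J a \<alpha>"
    unfolding \<alpha>_eq using \<alpha> by (intro vec_add[symmetric] ai) (auto simp: \<alpha>_eq)
  moreover have "vec J a A \<otimes>\<^bsub>H_hat J a\<^esub> vec J a \<Gamma> = vec J a \<beta>"
    unfolding \<beta>_eq using \<alpha> sys_rule_closed[OF R] by (intro vec_add[symmetric] ai) (auto simp: \<alpha>_eq)
  ultimately show ?thesis by simp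
qed

lemma eqv_invariants:
  assumes "eqv \<alpha> \<beta>"
  shows "down J \<alpha> = down J \<beta>" "set_mset \<alpha> \<subseteq> tokens J \<longleftrightarrow> set_mset \<beta> \<subseteq> tokens J"
    "a \<in> lower_sets J \<Longrightarrow> down J \<alpha> \<subseteq> a \<Longrightarrow> set_mset \<alpha> \<subseteq> tokens J \<Longrightarrow> cong a (vec J a \<alpha>) (vec J a \<beta>)"
proof -
  have "down J \<alpha> = down J \<beta> \<and> (set_mset \<alpha> \<subseteq> tokens J \<longleftrightarrow> set_mset \<beta> \<subseteq> tokens J) \<and>
    (a \<in> lower_sets J \<longrightarrow> down J \<alpha> \<subseteq> a \<longrightarrow> set_mset \<alpha> \<subseteq> tokens J \<longrightarrow> cong a (vec J a \<alpha>) (vec J a \<beta>))"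
    using assms
  proof (induction rule: equivclp_induct)
    case base
    show ?case using cong_refl[OF lower_setsD(1) _ vec_closed[OF lower_setsD(1)]] by simp
  next
    case (step \<beta> \<gamma>)
    have *: "down J \<beta> = down J \<gamma>" "set_mset \<beta> \<subseteq> tokens J \<longleftrightarrow> set_mset \<gamma> \<subseteq> tokens J"
      using step(2) rewrite_down rewrite_tokens by metis+
    have "cong a (vec J a \<alpha>) (vec J a \<gamma>)"
      if a: "a \<in> lower_sets J" "down J \<alpha> \<subseteq> a" "set_mset \<alpha> \<subseteq> tokens J"
    proof -
      have "cong a (vec J a \<beta>) (vec J a \<gamma>)"
        using step(2)
      proof
        assume "rewrite (sys_rule J) \<beta> \<gamma>"
        then show ?thesis using a step.IH by (intro rewrite_cong) auto
      next
        assume "rewrite (sys_rule J) \<gamma> \<beta>"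
        then have "cong a (vec J a \<gamma>) (vec J a \<beta>)" using a step.IH * by (intro rewrite_cong) auto
        then show ?thesis by (rule cong_sym[OF lower_setsD(1)[OF a(1)] a(1)])
      qed
      moreover have "cong a (vec J a \<alpha>) (vec J a \<beta>)" using a step.IH by simp
      ultimately show ?thesis using cong_trans[OF lower_setsD(1)[OF a(1)] a(1)] by simp
    qed
    with step.IH * show ?case by simp
  qed
  then show "down J \<alpha> = down J \<beta>" "set_mset \<alpha> \<subseteq> tokens J \<longleftrightarrow> set_mset \<beta> \<subseteq> tokens J"
    "a \<in> lower_sets J \<Longrightarrow> down J \<alpha> \<subseteq> a \<Longrightarrow> set_mset \<alpha> \<subseteq> tokens J \<Longrightarrow> cong a (vec J a \<alpha>) (vec J a \<beta>)"
    by simp_all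
qed

end

section \<open>Elements of \<open>H_pos\<close> as vectors of words, and completeness of the
  rules\<close>

lemma finite_maximal_above:
  assumes F: "finite F" "antisym r" "trans r" and refl: "\<And>k. k \<in> F \<Longrightarrow> (k, k) \<in> r" and "i \<in> F"
  shows "\<exists>m\<in>F. (i, m) \<in> r \<and> (\<forall>k\<in>F. (m, k) \<in> r \<longrightarrow> k = m)"
  using \<open>i \<in> F\<close>
proof (induction "card {k \<in> F. (i, k) \<in> r}" arbitrary: i rule: less_induct)
  case less
  show ?case
  proof (cases "\<forall>k\<in>F. (i, k) \<in> r \<longrightarrow> k = i")
    case False
    then obtain k where k: "k \<in> F" "(i, k) \<in> r" "k \<noteq> i" by blast
    have "{l \<in> F. (k, l) \<in> r} \<subset> {l \<in> F. (i, l) \<in> r}"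
      using k less.prems F(2,3) refl by (auto dest: transD antisymD)
    then have "card {l \<in> F. (k, l) \<in> r} < card {l \<in> F. (i, l) \<in> r}"
      using F(1) by (intro psubset_card_mono) auto
    from less.hyps[OF this k(1)] obtain m where "m \<in> F" "(k, m) \<in> r" "\<forall>l\<in>F. (m, l) \<in> r \<longrightarrow> l = m" by blast
    then show ?thesis using k(2) F(3) by (meson transD)
  qed (use less.prems refl in blast)
qed

context isys
begin

lemma down_closed: "j \<in> down J \<alpha> \<Longrightarrow> (i, j) \<in> order_rel J \<Longrightarrow> i \<in> down J \<alpha>"
  unfolding down_def using order_trans by blast

lemma max_elems_down: 
  assumes "set_mset \<alpha> \<subseteq> tokens J" shows "max_elems J (down J \<alpha>) \<subseteq> fst ` set_mset \<alpha>"
proof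
  fix m assume m: "m \<in> max_elems J (down J \<alpha>)"
  then obtain t where t: "t \<in># \<alpha>" "(m, fst t) \<in> order_rel J" by (auto simp: max_elems_def down_def)
  then have "fst t \<in> down J \<alpha>" using support_down[OF assms] by blast
  with m t have "m = fst t" by (auto simp: max_elems_def below_def)
  with t show "m \<in> fst ` set_mset \<alpha>" by blast
qed

text \<open>Finitely many indices occur in a word. Those maximal among them are maximal in the
  generated lower set, and every maximal element of that set occurs in the word.\<close>

lemma down_lower_set:
  assumes T: "set_mset \<alpha> \<subseteq> tokens J" shows "down J \<alpha> \<in> lower_sets J"
proof -
  have "\<exists>m\<in>max_elems J (down J \<alpha>). (i, m) \<in> order_rel J" if "i \<in> down J \<alpha>" for i
  proof -
    from that obtain t where t: "t \<in># \<alpha>" "(i, fst t) \<in> order_rel J" by (auto simp: down_def)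
    obtain m where m: "m \<in> fst ` set_mset \<alpha>" "(fst t, m) \<in> order_rel J"
      "\<forall>k\<in>fst ` set_mset \<alpha>. (m, k) \<in> order_rel J \<longrightarrow> k = m"
    proof (rule bexE[OF finite_maximal_above])
      show "antisym (order_rel J)" "trans (order_rel J)" using partial_order_onD[OF partial_order] by simp_all
      show "fst t \<in> fst ` set_mset \<alpha>" using t by simp
      show "(k, k) \<in> order_rel J" if "k \<in> fst ` set_mset \<alpha>" for k
        using that T by (auto simp: tokens_def intro: order_refl)
    qed auto
    have "m \<in> max_elems J (down J \<alpha>)"
    proof -
      have "\<not> below J m k" if k: "k \<in> down J \<alpha>" for k
      proof
        assume mk: "below J m k"
        from k obtain s where "s \<in># \<alpha>" "(k, fst s) \<in> order_rel J" by (auto simp: down_def)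
        with m mk have "fst s = m" using order_trans by (auto simp: below_def)
        with mk \<open>(k, fst s) \<in> order_rel J\<close> show False using order_antisym by (auto simp: below_def)
      qed
      moreover have "m \<in> down J \<alpha>" using m(1) support_down[OF T] by blast
      ultimately show ?thesis by (auto simp: max_elems_def)
    qed
    with m(2) t(2) show ?thesis using order_trans by blast
  qed
  moreover have "down J \<alpha> \<subseteq> index J" using order_index by (auto simp: down_def)
  moreover have "finite (max_elems J (down J \<alpha>))"
    using max_elems_down[OF T] by (rule finite_subset) simp
  ultimately show ?thesis unfolding lower_sets_def using down_closed by blast
qed

lemma vec_pos:
  assumes T: "set_mset \<alpha> \<subseteq> tokens J" shows "vec J (down J \<alpha>) \<alpha> \<in> H_pos J (down J \<alpha>)"
proof -
  have "coord J i \<alpha> \<in> carrier (component J i) \<or> i \<notin> max_elems J (down J \<alpha>) \<and> coord J i \<alpha> = \<one>\<^bsub>grothendieck J i\<^esub>"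
    if i: "i \<in> index J" "i \<in> free J" for i
  proof (cases "i \<in> fst ` set_mset \<alpha>")
    case True
    then have "tokens_at i \<alpha> \<noteq> {#}" by (auto simp: tokens_at_def multiset_eq_iff)
    then have "1 \<le> size (tokens_at i \<alpha>)" by (simp add: Suc_le_eq nonempty_has_size)
    then have "coord J i \<alpha> \<in> carrier (component J i)"
      using coord_closed[OF i(1), of \<alpha>] i by (auto simp: coord_def carrier_component carrier_grothendieck deg_def)
    then show ?thesis ..
  next
    case False
    then show ?thesis using coord_other[OF i(1)] max_elems_down[OF T] by blast
  qed
  moreover have "down J \<alpha> \<subseteq> index J" using down_lower_set[OF T] by (rule lower_setsD)
  ultimately show ?thesis using vec_closed[of "down J \<alpha>" \<alpha>]
    by (auto simp: H_pos_def vec_def simp del: one_grothendieck)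
qed

lemma coord_sum:
  assumes "finite S" "i \<in> index J" "\<And>k. k \<in> S \<Longrightarrow> set_mset (A k) \<subseteq> tokens J \<and> fst ` set_mset (A k) \<subseteq> {k}"
  shows "coord J i (\<Sum>k\<in>S. A k) = (if i \<in> S then coord J i (A i) else \<one>\<^bsub>grothendieck J i\<^esub>)"
  using assms(1,3)
proof (induction S rule: finite_induct)
  case empty
  then show ?case using coord_other[OF assms(2), of "{#}"] by simp
next
  case (insert k S)
  interpret G: comm_group "grothendieck J i" using assms(2) by (rule gr_group)
  have "set_mset (\<Sum>k\<in>S. A k) \<subseteq> tokens J"
    using insert.hyps(1) insert.prems by (induction S rule: finite_induct) auto
  then have "coord J i (\<Sum>k\<in>insert k S. A k) = coord J i (A k) \<otimes>\<^bsub>grothendieck J i\<^esub> coord J i (\<Sum>k\<in>S. A k)"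
    using insert by (simp add: coord_add[OF assms(2)] del: mult_grothendieck)
  moreover have "coord J i (A k) = \<one>\<^bsub>grothendieck J i\<^esub>" if "i \<noteq> k"
    using that insert.prems[of k] by (intro coord_other assms(2)) auto
  moreover have "coord J i \<gamma> \<otimes>\<^bsub>grothendieck J i\<^esub> \<one>\<^bsub>grothendieck J i\<^esub> = coord J i \<gamma>"
    "\<one>\<^bsub>grothendieck J i\<^esub> \<otimes>\<^bsub>grothendieck J i\<^esub> coord J i \<gamma> = coord J i \<gamma>" for \<gamma>
    using coord_closed[OF assms(2)] G.r_one G.l_one by blast+
  ultimately show ?case
    using insert G.l_one[OF G.one_closed]
    by (cases "i = k"; cases "i \<in> S") (simp_all del: mult_grothendieck one_grothendieck)
qed

lemma pos_eq_vec:
  assumes a: "a \<in> lower_sets J" and z: "z \<in> H_pos J a"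
  obtains \<alpha> where "set_mset \<alpha> \<subseteq> tokens J" "down J \<alpha> = a" "z = vec J a \<alpha>"
proof -
  note ai = lower_setsD(1)[OF a]
  have zc: "z \<in> carrier (H_hat J a)" using z by (simp add: H_pos_def)
  then have zi: "\<And>i. i \<in> a \<Longrightarrow> z i \<in> carrier (grothendieck J i)"
    and fin: "finite {i \<in> a. z i \<noteq> \<one>\<^bsub>grothendieck J i\<^esub>}" and ext: "z \<in> extensional a"
    by (auto simp: carrier_H[OF ai] PiE_iff)
  \<comment> \<open>Maximal indices are included even where \<open>z\<close> is neutral, as can
    happen at regular ones: the word needs a token there to generate all of
    \<open>a\<close>.\<close>
  define S where "S = max_elems J a \<union> {i \<in> a. z i \<noteq> \<one>\<^bsub>grothendieck J i\<^esub>}"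
  have S: "finite S" "S \<subseteq> a" using fin lower_setsD(3)[OF a] max_elems_subset by (auto simp: S_def)
  have "\<exists>A. A \<noteq> {#} \<and> set_mset A \<subseteq> tokens J \<and> fst ` set_mset A \<subseteq> {i} \<and> coord J i A = z i" if i: "i \<in> S" for i
  proof -
    have "z i \<in> carrier (component J i)"
    proof (cases "i \<in> free J")
      case True
      then show ?thesis using i z S by (auto simp: H_pos_def S_def max_elems_def)
    next
      case False
      then show ?thesis using zi[of i] i S by (auto simp: carrier_component carrier_grothendieck)
    qed
    then show ?thesis using component_eq_coord[of i "z i"] i S ai by (metis subsetD)
  qed
  then obtain A where A: "\<And>i. i \<in> S \<Longrightarrow> A i \<noteq> {#} \<and> set_mset (A i) \<subseteq> tokens J \<and> fst ` set_mset (A i) \<subseteq> {i} \<and> coord J i (A i) = z i"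
    by metis
  define \<alpha> where "\<alpha> = (\<Sum>i\<in>S. A i)"
  have set\<alpha>: "set_mset \<alpha> = (\<Union>i\<in>S. set_mset (A i))"
    unfolding \<alpha>_def using S(1) by (induction S rule: finite_induct) auto
  then have T: "set_mset \<alpha> \<subseteq> tokens J" using A by auto
  have supp: "fst ` set_mset \<alpha> = S"
  proof -
    have "fst ` set_mset (A i) = {i}" if "i \<in> S" for i using A[OF that] by (cases "A i") auto
    then show ?thesis by (auto simp: set\<alpha> image_UN)
  qed
  have "down J \<alpha> = {i. \<exists>k\<in>S. (i, k) \<in> order_rel J}" using supp by (auto simp: down_def)
  also have "\<dots> = a"
  proof (intro equalityI subsetI)
    fix i assume "i \<in> {i. \<exists>k\<in>S. (i, k) \<in> order_rel J}"
    then show "i \<in> a" using S lower_setsD(2)[OF a] by blast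
  next
    fix i assume "i \<in> a"
    then show "i \<in> {i. \<exists>k\<in>S. (i, k) \<in> order_rel J}" using lower_setsD(4)[OF a] by (auto simp: S_def)
  qed
  finally have "down J \<alpha> = a" .
  moreover have "z = vec J a \<alpha>"
  proof (rule extensionalityI[OF ext])
    show "vec J a \<alpha> \<in> extensional a" by (simp add: vec_def)
    fix i assume i: "i \<in> a"
    then have "coord J i \<alpha> = (if i \<in> S then coord J i (A i) else \<one>\<^bsub>grothendieck J i\<^esub>)"
      unfolding \<alpha>_def using S A ai by (intro coord_sum) auto
    then show "z i = vec J a \<alpha> i" using i A by (auto simp: vec_def S_def simp del: one_grothendieck)
  qed
  ultimately show thesis using that T by blast
qed

text \<open>
  The vectors that can be added to a token vector within its class. The generators of \<open>U\<^sub>a\<close> with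
  \<open>u \<in> M\<^sub>i\<close> are shifts, hence every element of \<open>U\<^sub>a\<close> is a difference of two shifts.
\<close>

definition shifts :: "'i set \<Rightarrow> ('i \<Rightarrow> int \<times> 'g) set" where
  "shifts a = {y \<in> carrier (H_hat J a). \<forall>\<alpha>. set_mset \<alpha> \<subseteq> tokens J \<longrightarrow> down J \<alpha> = a \<longrightarrow>
     (\<exists>\<beta>. eqv \<alpha> \<beta> \<and> vec J a \<beta> = vec J a \<alpha> \<otimes>\<^bsub>H_hat J a\<^esub> y)}"

lemma shiftsE:
  assumes "y \<in> shifts a" "set_mset \<alpha> \<subseteq> tokens J" "down J \<alpha> = a"
  obtains \<beta> where "eqv \<alpha> \<beta>" "set_mset \<beta> \<subseteq> tokens J" "down J \<beta> = a" "vec J a \<beta> = vec J a \<alpha> \<otimes>\<^bsub>H_hat J a\<^esub> y"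
  using assms eqv_invariants unfolding shifts_def by blast

lemma shifts_mult:
  assumes a: "a \<in> lower_sets J" and y: "y \<in> shifts a" "y' \<in> shifts a"
  shows "y \<otimes>\<^bsub>H_hat J a\<^esub> y' \<in> shifts a"
proof -
  interpret H: comm_group "H_hat J a" using a by (intro H_group lower_setsD)
  have yc: "y \<in> carrier (H_hat J a)" "y' \<in> carrier (H_hat J a)" using y by (auto simp: shifts_def)
  have "\<exists>\<gamma>. eqv \<alpha> \<gamma> \<and> vec J a \<gamma> = vec J a \<alpha> \<otimes>\<^bsub>H_hat J a\<^esub> (y \<otimes>\<^bsub>H_hat J a\<^esub> y')"
    if \<alpha>: "set_mset \<alpha> \<subseteq> tokens J" "down J \<alpha> = a" for \<alpha>
  proof -
    from shiftsE[OF y(1) \<alpha>] obtain \<beta> where \<beta>: "eqv \<alpha> \<beta>" "set_mset \<beta> \<subseteq> tokens J" "down J \<beta> = a"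
      "vec J a \<beta> = vec J a \<alpha> \<otimes>\<^bsub>H_hat J a\<^esub> y" .
    from shiftsE[OF y(2) \<beta>(2,3)] obtain \<gamma> where "eqv \<beta> \<gamma>" "vec J a \<gamma> = vec J a \<beta> \<otimes>\<^bsub>H_hat J a\<^esub> y'" .
    with \<beta> yc vec_closed[OF lower_setsD(1)[OF a]] show ?thesis
      by (auto simp: H.m_assoc intro: conv_trans)
  qed
  then show ?thesis using yc by (simp add: shifts_def)
qed

lemma shifts_one:
  assumes a: "a \<in> lower_sets J" shows "\<one>\<^bsub>H_hat J a\<^esub> \<in> shifts a"
proof -
  interpret H: comm_group "H_hat J a" using a by (intro H_group lower_setsD)
  show ?thesis using vec_closed[OF lower_setsD(1)[OF a]] by (auto simp: shifts_def intro: equivclp_refl)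
qed

text \<open>A word that generates \<open>a\<close> has a token at every maximal \<open>j\<close>.
  Its group part is w = v + g with g = \<phi>(x), so a rule replaces it by the token with group part
  v and a word that represents x. This adds x at \<open>i\<close> and removes g at
  \<open>j\<close>.\<close>

lemma shifts_gen:
  assumes a: "a \<in> lower_sets J" and ij: "below J i j" "j \<in> max_elems J a" and x: "x \<in> carrier (component J i)"
  shows "chi J a i x \<otimes>\<^bsub>H_hat J a\<^esub> inv\<^bsub>H_hat J a\<^esub> chi J a j (phi_hat J j i x) \<in> shifts a"
proof -
  note ai = lower_setsD(1)[OF a]
  interpret H: comm_group "H_hat J a" by (rule H_group) (rule ai)
  have ja: "j \<in> a" and ia: "i \<in> a" using ij max_elems_subset a below_lower by blast+
  then have j: "j \<in> index J" and i: "i \<in> index J" using ai by auto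
  interpret G: comm_group "grp J j" using j by (rule group)
  have xg: "x \<in> carrier (grothendieck J i)" using x component_subset by (rule_tac subsetD)
  obtain A where A: "A \<noteq> {#}" "set_mset A \<subseteq> tokens J" "fst ` set_mset A \<subseteq> {i}" "coord J i A = x"
    by (rule component_eq_coord[OF i x])
  define g where "g = mprod (grp J j) (theta J j) A"
  have g: "g \<in> carrier (grp J j)" by (simp add: g_def)
  have \<phi>x: "phi_hat J j i x = (0, g)"
    using phi_coord[OF ij(1) A(1-3)] by (simp add: phi_hat_component ij x A g_def)
  have g0: "(0, g) \<in> carrier (grothendieck J j)" using g by (simp add: carrier_grothendieck)
  have Aabs: "set_mset A \<subseteq> absorbed J j" using A ij by (auto simp: absorbed_def)
  have "\<exists>\<beta>. eqv \<alpha> \<beta> \<and> vec J a \<beta> = vec J a \<alpha> \<otimes>\<^bsub>H_hat J a\<^esub>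
      (chi J a i x \<otimes>\<^bsub>H_hat J a\<^esub> inv\<^bsub>H_hat J a\<^esub> chi J a j (0, g))"
    if \<alpha>: "set_mset \<alpha> \<subseteq> tokens J" "down J \<alpha> = a" for \<alpha>
  proof -
    have "j \<in> fst ` set_mset \<alpha>" using max_elems_down[OF \<alpha>(1)] \<alpha>(2) ij by blast
    then obtain w where "(j, w) \<in># \<alpha>" by auto
    then obtain \<gamma> where \<gamma>: "\<alpha> = {#(j, w)#} + \<gamma>" by (metis add_mset_add_single add.commute multi_member_split)
    have w: "w \<in> carrier (grp J j)" using \<alpha> by (auto simp: \<gamma> tokens_def)
    define v where "v = w \<otimes>\<^bsub>grp J j\<^esub> inv\<^bsub>grp J j\<^esub> g"
    have v: "v \<in> carrier (grp J j)" using w g by (simp add: v_def)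
    have vg: "w = v \<otimes>\<^bsub>grp J j\<^esub> g" using w g by (simp add: v_def G.m_assoc)
    have tok: "(j, w) \<in> tokens J" "(j, v) \<in> tokens J" using j v w by (auto simp: tokens_def)
    define \<beta> where "\<beta> = ({#(j, v)#} + A) + \<gamma>"
    have "sys_rule J (j, w) ({#(j, v)#} + A)"
      using sys_ruleI[of j v A w] j v Aabs vg by (simp add: g_def)
    then have "eqv \<alpha> \<beta>" unfolding \<gamma> \<beta>_def by (intro conv_add_right eqv_rule)
    moreover have "vec J a \<beta> = vec J a \<alpha> \<otimes>\<^bsub>H_hat J a\<^esub>
      (chi J a i x \<otimes>\<^bsub>H_hat J a\<^esub> inv\<^bsub>H_hat J a\<^esub> chi J a j (0, g))"
    proof -
      have \<gamma>T: "set_mset \<gamma> \<subseteq> tokens J" using \<alpha> by (auto simp: \<gamma>)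
      have dv: "(deg J j, v) \<in> carrier (grothendieck J j)"
        using token_component[OF tok(2)] component_subset by (rule_tac subsetD)
      have "vec J a \<beta> = vec J a {#(j, v)#} \<otimes>\<^bsub>H_hat J a\<^esub> vec J a A \<otimes>\<^bsub>H_hat J a\<^esub> vec J a \<gamma>"
        unfolding \<beta>_def using tok A \<gamma>T by (simp add: vec_add[OF ai] del: union_mset_add_mset_left)
      then have 1: "vec J a \<beta> = chi J a j (deg J j, v) \<otimes>\<^bsub>H_hat J a\<^esub> chi J a i x \<otimes>\<^bsub>H_hat J a\<^esub> vec J a \<gamma>"
        using tok A by (simp add: vec_token[OF ai] vec_single_index[OF ai A(3)])
      have "vec J a \<alpha> = vec J a {#(j, w)#} \<otimes>\<^bsub>H_hat J a\<^esub> vec J a \<gamma>"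
        unfolding \<gamma> using tok \<gamma>T by (intro vec_add[OF ai]) auto
      also have "vec J a {#(j, w)#} = chi J a j (deg J j, v) \<otimes>\<^bsub>H_hat J a\<^esub> chi J a j (0, g)"
        using tok by (simp add: vec_token[OF ai] vg chi_mult[OF ai, symmetric])
      finally have 2: "vec J a \<alpha> = chi J a j (deg J j, v) \<otimes>\<^bsub>H_hat J a\<^esub> chi J a j (0, g) \<otimes>\<^bsub>H_hat J a\<^esub> vec J a \<gamma>" .
      have c: "chi J a j (deg J j, v) \<in> carrier (H_hat J a)" "chi J a j (0, g) \<in> carrier (H_hat J a)"
        "chi J a i x \<in> carrier (H_hat J a)" "vec J a \<gamma> \<in> carrier (H_hat J a)"
        using dv g0 xg ja ia by (simp_all add: chi_closed vec_closed ai)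
      have alg: "V \<otimes>\<^bsub>H_hat J a\<^esub> X \<otimes>\<^bsub>H_hat J a\<^esub> C = V \<otimes>\<^bsub>H_hat J a\<^esub> K \<otimes>\<^bsub>H_hat J a\<^esub> C \<otimes>\<^bsub>H_hat J a\<^esub> (X \<otimes>\<^bsub>H_hat J a\<^esub> inv\<^bsub>H_hat J a\<^esub> K)"
        if "V \<in> carrier (H_hat J a)" "K \<in> carrier (H_hat J a)" "X \<in> carrier (H_hat J a)" "C \<in> carrier (H_hat J a)" for V X C K
      proof -
        have "V \<otimes>\<^bsub>H_hat J a\<^esub> K \<otimes>\<^bsub>H_hat J a\<^esub> C \<otimes>\<^bsub>H_hat J a\<^esub> (X \<otimes>\<^bsub>H_hat J a\<^esub> inv\<^bsub>H_hat J a\<^esub> K)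
          = V \<otimes>\<^bsub>H_hat J a\<^esub> X \<otimes>\<^bsub>H_hat J a\<^esub> C \<otimes>\<^bsub>H_hat J a\<^esub> (K \<otimes>\<^bsub>H_hat J a\<^esub> inv\<^bsub>H_hat J a\<^esub> K)"
          using that by (simp only: H.m_ac H.m_closed H.inv_closed)
        then show ?thesis using that by simp
      qed
      show ?thesis unfolding 1 2 by (rule alg) (rule c)+
    qed
    ultimately show ?thesis by blast
  qed
  moreover have "chi J a i x \<otimes>\<^bsub>H_hat J a\<^esub> inv\<^bsub>H_hat J a\<^esub> chi J a j (0, g) \<in> carrier (H_hat J a)"
    using g0 xg ja ia by (auto intro!: chi_closed ai)
  ultimately show ?thesis unfolding \<phi>x shifts_def by blast
qed

lemma U_rel_shifts:
  assumes a: "a \<in> lower_sets J" and u: "u \<in> U_rel J a"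
  shows "\<exists>y\<in>shifts a. \<exists>y'\<in>shifts a. u \<otimes>\<^bsub>H_hat J a\<^esub> y' = y"
proof -
  note ai = lower_setsD(1)[OF a]
  interpret H: comm_group "H_hat J a" by (rule H_group) (rule ai)
  have sc: "y \<in> carrier (H_hat J a)" if "y \<in> shifts a" for y using that by (simp add: shifts_def)
  have gen: "\<exists>y\<in>shifts a. \<exists>y'\<in>shifts a. h \<otimes>\<^bsub>H_hat J a\<^esub> y' = y" if "h \<in> gens a" for h
  proof -
    from that obtain i j u where h: "h = chi J a i u \<otimes>\<^bsub>H_hat J a\<^esub> inv\<^bsub>H_hat J a\<^esub> chi J a j (phi_hat J j i u)"
      and ij: "below J i j" "j \<in> max_elems J a" and u: "u \<in> carrier (grothendieck J i)"
      by (auto simp: gens_def)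
    have ja: "j \<in> a" and ia: "i \<in> a" using ij max_elems_subset a below_lower by blast+
    then have i: "i \<in> index J" using ai by auto
    \<comment> \<open>With u = x - y for x, y in \<open>M\<^sub>i\<close>, the generator for u is
      the difference of the generators for x and y, and these are shifts.\<close>
    obtain x y where xy: "x \<in> carrier (component J i)" "y \<in> carrier (component J i)"
      "u \<otimes>\<^bsub>grothendieck J i\<^esub> y = x" by (rule grothendieck_fraction[OF group[OF i] u])
    let ?s = "\<lambda>u. chi J a i u \<otimes>\<^bsub>H_hat J a\<^esub> inv\<^bsub>H_hat J a\<^esub> chi J a j (phi_hat J j i u)"
    have yg: "y \<in> carrier (grothendieck J i)" using xy(2) component_subset by (rule_tac subsetD)
    have c: "chi J a i u \<in> carrier (H_hat J a)" "chi J a i y \<in> carrier (H_hat J a)"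
      "chi J a j (phi_hat J j i u) \<in> carrier (H_hat J a)" "chi J a j (phi_hat J j i y) \<in> carrier (H_hat J a)"
      using u yg ia ja ij by (auto intro!: chi_closed ai phi_hat_closed)
    have "?s x = ?s u \<otimes>\<^bsub>H_hat J a\<^esub> ?s y"
      unfolding xy(3)[symmetric] phi_hat_mult[OF ij(1) u yg] chi_mult[OF ai]
      using c by (simp add: H.inv_mult H.m_ac)
    then show ?thesis using shifts_gen[OF a ij] xy h by metis
  qed
  from u show ?thesis unfolding U_rel_eq
  proof (induction rule: generate.induct)
    case one
    then show ?case using shifts_one[OF a] by (intro bexI[of _ "\<one>\<^bsub>H_hat J a\<^esub>"]) auto
  next
    case (incl h)
    then show ?case by (rule gen)
  next
    case (inv h)
    then obtain y y' where "y \<in> shifts a" "y' \<in> shifts a" "h \<otimes>\<^bsub>H_hat J a\<^esub> y' = y" using gen by blast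
    moreover from this have "inv\<^bsub>H_hat J a\<^esub> h \<otimes>\<^bsub>H_hat J a\<^esub> y = y'"
      using inv gens_closed[OF a] sc by (auto simp: H.m_assoc[symmetric])
    ultimately show ?case by blast
  next
    case (eng h h')
    then obtain x x' y y' where *: "y \<in> shifts a" "y' \<in> shifts a" "h \<otimes>\<^bsub>H_hat J a\<^esub> y' = y"
      "x \<in> shifts a" "x' \<in> shifts a" "h' \<otimes>\<^bsub>H_hat J a\<^esub> x' = x" by blast
    have hc: "h \<in> carrier (H_hat J a)" "h' \<in> carrier (H_hat J a)"
      using eng.hyps H.generate_in_carrier[OF gens_closed[OF a]] by auto
    have "h \<otimes>\<^bsub>H_hat J a\<^esub> h' \<otimes>\<^bsub>H_hat J a\<^esub> (y' \<otimes>\<^bsub>H_hat J a\<^esub> x') = y \<otimes>\<^bsub>H_hat J a\<^esub> x"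
      unfolding *(3)[symmetric] *(6)[symmetric] using hc sc *(2,5) by (simp add: H.m_ac)
    then show ?case using * shifts_mult[OF a] by blast
  qed
qed

text \<open>The difference of the two vectors is y - y' for shifts y and y'. Shifting \<alpha> by y'
  and \<beta> by y gives words with equal vectors, to which \<open>eqv_of_vec_eq\<close>
  applies.\<close>

lemma eqv_of_cong:
  assumes T: "set_mset \<alpha> \<subseteq> tokens J" "set_mset \<beta> \<subseteq> tokens J" and down: "down J \<alpha> = a" "down J \<beta> = a"
    and cong: "cong a (vec J a \<alpha>) (vec J a \<beta>)"
  shows "eqv \<alpha> \<beta>"
proof -
  have a: "a \<in> lower_sets J" using down_lower_set[OF T(1)] down by simp
  note ai = lower_setsD(1)[OF a]
  interpret H: comm_group "H_hat J a" by (rule H_group) (rule ai)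
  note vc = vec_closed[OF ai]
  from cong obtain y y' where y: "y \<in> shifts a" "y' \<in> shifts a"
    and eq: "(vec J a \<alpha> \<otimes>\<^bsub>H_hat J a\<^esub> inv\<^bsub>H_hat J a\<^esub> vec J a \<beta>) \<otimes>\<^bsub>H_hat J a\<^esub> y' = y"
    using U_rel_shifts[OF a] unfolding group_cong_def by blast
  have yc: "y' \<in> carrier (H_hat J a)" using y by (simp add: shifts_def)
  have "vec J a \<beta> \<otimes>\<^bsub>H_hat J a\<^esub> y = (vec J a \<beta> \<otimes>\<^bsub>H_hat J a\<^esub> inv\<^bsub>H_hat J a\<^esub> vec J a \<beta>) \<otimes>\<^bsub>H_hat J a\<^esub> (vec J a \<alpha> \<otimes>\<^bsub>H_hat J a\<^esub> y')"
    unfolding eq[symmetric] using vc yc by (simp only: H.m_ac H.m_closed H.inv_closed)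
  then have eq': "vec J a \<alpha> \<otimes>\<^bsub>H_hat J a\<^esub> y' = vec J a \<beta> \<otimes>\<^bsub>H_hat J a\<^esub> y" using vc yc by simp
  from shiftsE[OF y(2) T(1) down(1)] obtain \<alpha>' where \<alpha>': "eqv \<alpha> \<alpha>'" "set_mset \<alpha>' \<subseteq> tokens J"
    "down J \<alpha>' = a" "vec J a \<alpha>' = vec J a \<alpha> \<otimes>\<^bsub>H_hat J a\<^esub> y'" .
  from shiftsE[OF y(1) T(2) down(2)] obtain \<beta>' where \<beta>': "eqv \<beta> \<beta>'" "set_mset \<beta>' \<subseteq> tokens J"
    "down J \<beta>' = a" "vec J a \<beta>' = vec J a \<beta> \<otimes>\<^bsub>H_hat J a\<^esub> y" .
  have "eqv \<alpha>' \<beta>'" using \<alpha>' \<beta>' eq' by (intro eqv_of_vec_eq) auto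
  with \<alpha>'(1) \<beta>'(1) show ?thesis by (meson conv_trans equivclp_sym)
qed

section \<open>Classes, embeddings and the multiplication of \<open>monoid_of\<close>\<close>

lemma H_equiv_iff: "(x, y) \<in> H_equiv J a \<longleftrightarrow> x \<in> H_pos J a \<and> y \<in> H_pos J a \<and> cong a x y"
  by (auto simp: H_equiv_def group_cong_def H_pos_def)

lemma equiv_H_equiv: "a \<in> lower_sets J \<Longrightarrow> equiv (H_pos J a) (H_equiv J a)"
  by (rule equivI; (rule refl_onI symI transI)?)
    (auto simp: H_equiv_iff intro: cong_sym[OF lower_setsD(1)] cong_trans[OF lower_setsD(1)],
      auto simp: H_pos_def intro: cong_refl[OF lower_setsD(1)])

lemma sys_class_eq_iff:
  assumes T: "set_mset \<alpha> \<subseteq> tokens J" "set_mset \<beta> \<subseteq> tokens J"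
  shows "sys_class J \<alpha> = sys_class J \<beta> \<longleftrightarrow> eqv \<alpha> \<beta>"
proof
  assume eq: "sys_class J \<alpha> = sys_class J \<beta>"
  define a where "a = down J \<alpha>"
  have a: "down J \<alpha> = a" "down J \<beta> = a" using eq by (auto simp: a_def sys_class_def)
  have al: "a \<in> lower_sets J" using down_lower_set[OF T(1)] by (simp add: a)
  from eq have "H_equiv J a `` {vec J a \<alpha>} = H_equiv J a `` {vec J a \<beta>}" by (simp add: sys_class_def a)
  then have "(vec J a \<alpha>, vec J a \<beta>) \<in> H_equiv J a"
    using vec_pos[OF T(2)] by (intro eq_equiv_class[OF _ equiv_H_equiv[OF al]]) (auto simp: a)
  then show "eqv \<alpha> \<beta>" using T a by (intro eqv_of_cong) (auto simp: H_equiv_iff)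
next
  assume eqv: "eqv \<alpha> \<beta>"
  define a where "a = down J \<alpha>"
  have a: "down J \<alpha> = a" "down J \<beta> = a" using eqv_invariants(1)[OF eqv] by (auto simp: a_def)
  have al: "a \<in> lower_sets J" using down_lower_set[OF T(1)] by (simp add: a)
  have "(vec J a \<alpha>, vec J a \<beta>) \<in> H_equiv J a"
    using vec_pos[OF T(1)] vec_pos[OF T(2)] eqv_invariants(3)[OF eqv al] T by (simp add: a H_equiv_iff)
  then show "sys_class J \<alpha> = sys_class J \<beta>"
    using equiv_class_eq[OF equiv_H_equiv[OF al]] by (simp add: sys_class_def a)
qed

lemma embed_closed:
  assumes ab: "a \<subseteq> b" "b \<subseteq> index J" and z: "z \<in> carrier (H_hat J a)"
  shows "embed J a b z \<in> carrier (H_hat J b)"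
proof -
  have ai: "a \<subseteq> index J" using ab by blast
  have "{i \<in> b. embed J a b z i \<noteq> \<one>\<^bsub>grothendieck J i\<^esub>} \<subseteq> {i \<in> a. z i \<noteq> \<one>\<^bsub>grothendieck J i\<^esub>}"
    by (auto simp: embed_def simp del: one_grothendieck)
  then have "finite {i \<in> b. embed J a b z i \<noteq> \<one>\<^bsub>grothendieck J i\<^esub>}"
    using z by (rule_tac finite_subset) (auto simp: carrier_H[OF ai])
  moreover have "\<one>\<^bsub>grothendieck J i\<^esub> \<in> carrier (grothendieck J i)" if "i \<in> b" for i
    using that ab monoid.one_closed[OF comm_monoid.axioms(1)[OF comm_group.axioms(1)[OF gr_group]]] by blast
  moreover have "z i \<in> carrier (grothendieck J i)" if "i \<in> a" for i
    using z that by (auto simp: carrier_H[OF ai])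
  ultimately show ?thesis
    unfolding carrier_H[OF ab(2)] by (simp add: embed_def del: one_grothendieck)
qed

lemma embed_mult:
  assumes "b \<subseteq> index J"
  shows "embed J a b (x \<otimes>\<^bsub>H_hat J a\<^esub> y) = embed J a b x \<otimes>\<^bsub>H_hat J b\<^esub> embed J a b y"
proof -
  have "\<one>\<^bsub>grothendieck J k\<^esub> \<otimes>\<^bsub>grothendieck J k\<^esub> \<one>\<^bsub>grothendieck J k\<^esub> = \<one>\<^bsub>grothendieck J k\<^esub>" if "k \<in> b" for k
    using that assms monoid.l_one[OF comm_monoid.axioms(1)[OF comm_group.axioms(1)[OF gr_group]]]
      monoid.one_closed[OF comm_monoid.axioms(1)[OF comm_group.axioms(1)[OF gr_group]]] by (metis subsetD)
  then show ?thesis by (auto simp: embed_def mult_H simp del: mult_grothendieck one_grothendieck)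
qed

lemma embed_vec:
  assumes "a \<subseteq> b" "b \<subseteq> index J" "fst ` set_mset \<alpha> \<subseteq> a"
  shows "embed J a b (vec J a \<alpha>) = vec J b \<alpha>"
proof (rule ext)
  fix i
  have "coord J i \<alpha> = \<one>\<^bsub>grothendieck J i\<^esub>" if "i \<in> b" "i \<notin> a"
    using that assms by (intro coord_other) auto
  then show "embed J a b (vec J a \<alpha>) i = vec J b \<alpha> i"
    using assms by (auto simp: embed_def vec_def simp del: one_grothendieck)
qed

text \<open>An index maximal in \<open>a\<close> need not be maximal in \<open>b\<close>, so the
  image of a generator may fail to be one; \<open>cong_chi\<close> still puts it into
  \<open>U_rel J b\<close>.\<close>

lemma embed_gen:
  assumes a: "a \<in> lower_sets J" and b: "b \<in> lower_sets J" and ab: "a \<subseteq> b" and h: "h \<in> gens a"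
  shows "embed J a b h \<in> U_rel J b"
proof -
  note ai = lower_setsD(1)[OF a] and bi = lower_setsD(1)[OF b]
  interpret Ha: comm_group "H_hat J a" by (rule H_group) (rule ai)
  interpret Hb: comm_group "H_hat J b" by (rule H_group) (rule bi)
  interpret emb: group_hom "H_hat J a" "H_hat J b" "embed J a b"
    by unfold_locales (auto simp: hom_def embed_closed[OF ab bi] embed_mult[OF bi])
  from h obtain i j u where h: "h = chi J a i u \<otimes>\<^bsub>H_hat J a\<^esub> inv\<^bsub>H_hat J a\<^esub> chi J a j (phi_hat J j i u)"
    and ij: "below J i j" "j \<in> max_elems J a" and u: "u \<in> carrier (grothendieck J i)"
    by (auto simp: gens_def)
  have ja: "j \<in> a" and ia: "i \<in> a" using ij max_elems_subset a below_lower by blast+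
  have emb: "embed J a b (chi J a k v) = chi J b k v" if "k \<in> a" for k v
    using ab that by (auto simp: embed_def chi_def)
  have "cong b (chi J b i u) (chi J b j (phi_hat J j i u))"
    using cong_chi[OF b ij(1) _ u] ja ab by blast
  moreover have "embed J a b h = chi J b i u \<otimes>\<^bsub>H_hat J b\<^esub> inv\<^bsub>H_hat J b\<^esub> chi J b j (phi_hat J j i u)"
    unfolding h using u ia ja ij by (simp add: chi_closed ai phi_hat_closed emb)
  ultimately show ?thesis by (simp add: group_cong_def)
qed

lemma embed_cong:
  assumes a: "a \<in> lower_sets J" and b: "b \<in> lower_sets J" and ab: "a \<subseteq> b" and xy: "cong a x y"
  shows "cong b (embed J a b x) (embed J a b y)"
proof -
  note ai = lower_setsD(1)[OF a] and bi = lower_setsD(1)[OF b]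
  interpret Ha: comm_group "H_hat J a" by (rule H_group) (rule ai)
  interpret Hb: comm_group "H_hat J b" by (rule H_group) (rule bi)
  have c: "embed J a b z \<in> carrier (H_hat J b)" if "z \<in> carrier (H_hat J a)" for z
    using that by (rule embed_closed[OF ab bi])
  interpret emb: group_hom "H_hat J a" "H_hat J b" "embed J a b"
    by unfold_locales (auto simp: hom_def c embed_mult[OF bi])
  have "embed J a b u \<in> U_rel J b" if "u \<in> U_rel J a" for u
    using that unfolding U_rel_eq[of a]
  proof (induction rule: generate.induct)
    case one
    then show ?case using subgroup.one_closed[OF U_subgroup[OF b]] by simp
  next
    case (eng h h')
    then have "h \<in> carrier (H_hat J a)" "h' \<in> carrier (H_hat J a)"
      using Ha.generate_in_carrier[OF gens_closed[OF a]] by auto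
    with eng show ?case using subgroup.m_closed[OF U_subgroup[OF b]] by simp
  next
    case (incl h)
    show ?case using incl by (rule embed_gen[OF a b ab])
  next
    case (inv h)
    have "h \<in> carrier (H_hat J a)" using inv gens_closed[OF a] by blast
    with embed_gen[OF a b ab inv] show ?case using subgroup.m_inv_closed[OF U_subgroup[OF b]] by simp
  qed
  with xy show ?thesis unfolding group_cong_def by (auto simp: c emb.hom_mult[symmetric] emb.hom_inv[symmetric] simp del: emb.hom_mult emb.hom_inv)
qed

lemma mult_sys_class:
  assumes T: "set_mset \<alpha> \<subseteq> tokens J" "set_mset \<beta> \<subseteq> tokens J"
  shows "sys_class J \<alpha> \<otimes>\<^bsub>monoid_of J\<^esub> sys_class J \<beta> = sys_class J (\<alpha> + \<beta>)"
proof -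
  define a b where "a = down J \<alpha>" and "b = down J \<beta>"
  have a: "a \<in> lower_sets J" and b: "b \<in> lower_sets J" and ab: "a \<union> b \<in> lower_sets J"
    using down_lower_set[OF T(1)] down_lower_set[OF T(2)] down_lower_set[of "\<alpha> + \<beta>"] T by (auto simp: a_def b_def)
  note abi = lower_setsD(1)[OF ab]
  have ab_down: "down J (\<alpha> + \<beta>) = a \<union> b" by (simp add: a_def b_def)
  have cls: "H_equiv J (a \<union> b) `` {embed J a (a \<union> b) x \<otimes>\<^bsub>H_hat J (a \<union> b)\<^esub> embed J b (a \<union> b) y} =
      H_equiv J (a \<union> b) `` {vec J (a \<union> b) (\<alpha> + \<beta>)}"
    if x: "(vec J a \<alpha>, x) \<in> H_equiv J a" and y: "(vec J b \<beta>, y) \<in> H_equiv J b" for x y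
  proof -
    from x y have pos: "x \<in> H_pos J a" "y \<in> H_pos J b" and c: "cong a (vec J a \<alpha>) x" "cong b (vec J b \<beta>) y"
      by (auto simp: H_equiv_iff)
    \<comment> \<open>Arbitrary representatives are vectors of words as well. So the sum of their
      embeddings is the vector of a word that generates the union of \<open>a\<close> and
      \<open>b\<close>, and hence lies in \<open>H_pos\<close>.\<close>
    obtain \<alpha>' where \<alpha>': "set_mset \<alpha>' \<subseteq> tokens J" "down J \<alpha>' = a" "x = vec J a \<alpha>'"
      by (rule pos_eq_vec[OF a pos(1)])
    obtain \<beta>' where \<beta>': "set_mset \<beta>' \<subseteq> tokens J" "down J \<beta>' = b" "y = vec J b \<beta>'"
      by (rule pos_eq_vec[OF b pos(2)])
    have ev: "embed J a (a \<union> b) (vec J a \<gamma>) = vec J (a \<union> b) \<gamma>"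
      if "set_mset \<gamma> \<subseteq> tokens J" "down J \<gamma> = a" for \<gamma>
      using support_down[OF that(1)] that(2) by (intro embed_vec abi) auto
    have ev': "embed J b (a \<union> b) (vec J b \<gamma>) = vec J (a \<union> b) \<gamma>"
      if "set_mset \<gamma> \<subseteq> tokens J" "down J \<gamma> = b" for \<gamma>
      using support_down[OF that(1)] that(2) by (intro embed_vec abi) auto
    have "cong (a \<union> b) (embed J a (a \<union> b) (vec J a \<alpha>) \<otimes>\<^bsub>H_hat J (a \<union> b)\<^esub> embed J b (a \<union> b) (vec J b \<beta>))
      (embed J a (a \<union> b) x \<otimes>\<^bsub>H_hat J (a \<union> b)\<^esub> embed J b (a \<union> b) y)"
      using c by (intro cong_mult abi ab embed_cong a b) auto
    moreover have "embed J a (a \<union> b) (vec J a \<alpha>) \<otimes>\<^bsub>H_hat J (a \<union> b)\<^esub> embed J b (a \<union> b) (vec J b \<beta>) = vec J (a \<union> b) (\<alpha> + \<beta>)"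
      using T by (simp add: ev ev' a_def[symmetric] b_def[symmetric] vec_add[OF abi])
    moreover have e: "embed J a (a \<union> b) x \<otimes>\<^bsub>H_hat J (a \<union> b)\<^esub> embed J b (a \<union> b) y = vec J (a \<union> b) (\<alpha>' + \<beta>')"
      using \<alpha>' \<beta>' by (simp add: ev ev' vec_add[OF abi])
    ultimately have "(vec J (a \<union> b) (\<alpha> + \<beta>), embed J a (a \<union> b) x \<otimes>\<^bsub>H_hat J (a \<union> b)\<^esub> embed J b (a \<union> b) y) \<in> H_equiv J (a \<union> b)"
      using vec_pos[of "\<alpha> + \<beta>"] vec_pos[of "\<alpha>' + \<beta>'"] T \<alpha>' \<beta>' ab_down by (simp add: H_equiv_iff)
    from equiv_class_eq[OF equiv_H_equiv[OF ab] this] show ?thesis by simp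
  qed
  have ne: "(vec J a \<alpha>, vec J a \<alpha>) \<in> H_equiv J a" "(vec J b \<beta>, vec J b \<beta>) \<in> H_equiv J b"
    using equiv_H_equiv[OF a] equiv_H_equiv[OF b] vec_pos[OF T(1)] vec_pos[OF T(2)]
    unfolding equiv_def refl_on_def a_def b_def by blast+
  have "(\<Union>x\<in>H_equiv J a `` {vec J a \<alpha>}. \<Union>y\<in>H_equiv J b `` {vec J b \<beta>}. H_equiv J (a \<union> b) ``
        {embed J a (a \<union> b) x \<otimes>\<^bsub>H_hat J (a \<union> b)\<^esub> embed J b (a \<union> b) y}) = H_equiv J (a \<union> b) `` {vec J (a \<union> b) (\<alpha> + \<beta>)}"
    using cls ne by blast
  then show ?thesis
    unfolding sys_class_def ab_down a_def[symmetric] b_def[symmetric] monoid_of_def by simp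
qed

lemma carrier_monoid_of: "carrier (monoid_of J) = sys_class J ` {\<alpha>. set_mset \<alpha> \<subseteq> tokens J}"
proof (intro equalityI subsetI)
  fix X assume "X \<in> carrier (monoid_of J)"
  then obtain a z where a: "a \<in> lower_sets J" and z: "z \<in> H_pos J a" and X: "X = (a, H_equiv J a `` {z})"
    by (auto simp: monoid_of_def quotient_def)
  obtain \<alpha> where "set_mset \<alpha> \<subseteq> tokens J" "down J \<alpha> = a" "z = vec J a \<alpha>" by (rule pos_eq_vec[OF a z])
  then show "X \<in> sys_class J ` {\<alpha>. set_mset \<alpha> \<subseteq> tokens J}"
    by (intro image_eqI[of _ _ \<alpha>]) (auto simp: X sys_class_def)
next
  fix X assume "X \<in> sys_class J ` {\<alpha>. set_mset \<alpha> \<subseteq> tokens J}"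
  then show "X \<in> carrier (monoid_of J)"
    using down_lower_set vec_pos by (auto simp: monoid_of_def sys_class_def quotient_def)
qed

lemma one_monoid_of: "\<one>\<^bsub>monoid_of J\<^esub> = sys_class J {#}"
proof -
  have "vec J {} {#} = \<one>\<^bsub>H_hat J {}\<^esub>" by (auto simp: vec_def one_H)
  then show ?thesis by (simp add: monoid_of_def sys_class_def)
qed

theorem presented_monoid_of: "presented_monoid (monoid_of J) (tokens J) (sys_rule J) (sys_class J)"
proof -
  have "comm_monoid (monoid_of J)"
    by (rule comm_monoidI) (auto simp: carrier_monoid_of one_monoid_of mult_sys_class add_ac)
  then interpret comm_monoid "monoid_of J" .
  show ?thesis
    by unfold_locales
      (use sys_rule_closed sys_confluent carrier_monoid_of one_monoid_of mult_sys_class sys_class_eq_iff in auto)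
qed

lemma sys_rule_class: "sys_rule J t A \<Longrightarrow> \<exists>t'\<in>#A. fst t' = fst t"
  by (auto elim!: sys_ruleE)

text \<open>The two group parts differ by an element of \<open>G\<^sub>j\<close>, and each such
  element is the value of absorbed tokens: by (c2) for free \<open>j\<close>, by a token at
  \<open>j\<close> for regular \<open>j\<close>.\<close>

lemma eqv_exchange:
  assumes t: "t \<in> tokens J" "t' \<in> tokens J" "fst t' = fst t"
  shows "\<exists>\<Gamma>. set_mset \<Gamma> \<subseteq> tokens J \<and> eqv {#t'#} (add_mset t \<Gamma>)"
proof -
  obtain j x x' where [simp]: "t = (j, x)" "t' = (j, x')" using t(3) by (cases t; cases t') auto
  have j: "j \<in> index J" and x: "x \<in> carrier (grp J j)" "x' \<in> carrier (grp J j)" using t by (auto simp: tokens_def)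
  interpret G: comm_group "grp J j" using j by (rule group)
  obtain \<Gamma> where \<Gamma>: "set_mset \<Gamma> \<subseteq> absorbed J j"
    "mprod (grp J j) (theta J j) \<Gamma> = inv\<^bsub>grp J j\<^esub> x \<otimes>\<^bsub>grp J j\<^esub> x'"
    by (rule group_element[OF j, of "inv\<^bsub>grp J j\<^esub> x \<otimes>\<^bsub>grp J j\<^esub> x'"]) (use x in auto)
  then have "sys_rule J t' (add_mset t \<Gamma>)"
    using sys_ruleI[of j x \<Gamma> x'] j x by (simp add: G.m_assoc[symmetric])
  with \<Gamma> absorbed_tokens[of j] show ?thesis by (blast intro: eqv_rule)
qed

theorem monoid_of_properties:
  "comm_monoid (monoid_of J)" "primely_generated (monoid_of J)" "conical (monoid_of J)"
  "refinement_monoid (monoid_of J)"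
proof -
  interpret P: presented_monoid "monoid_of J" "tokens J" "sys_rule J" "sys_class J"
    by (rule presented_monoid_of)
  show "comm_monoid (monoid_of J)" by (rule P.comm_monoid_axioms)
  show "primely_generated (monoid_of J)"
    by (intro P.primely_generated P.prime_token[of fst] sys_rule_class eqv_exchange)
  show "conical (monoid_of J)" using sys_rule_class by (intro P.conical) fastforce
  show "refinement_monoid (monoid_of J)" by (rule P.refinement)
qed

end

section \<open>The I-system of a primely generated refinement monoid\<close>

text \<open>
  With the operation \<open>x \<circ> (j + a) = x + a\<close> the elements associated to \<open>j\<close> form a group, for free and
  regular \<open>j\<close> alike. It agrees with the addition of \<open>M\<close> when \<open>j\<close> is idempotent, which is why
  representatives of regular primes are chosen idempotent below.
\<close>

definition absorbs :: "('a, 'b) monoid_scheme \<Rightarrow> 'a \<Rightarrow> 'a set" where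
  "absorbs M j = {a \<in> carrier M. (j \<otimes>\<^bsub>M\<^esub> a) divides\<^bsub>M\<^esub> j}"

definition assoc_group :: "('a, 'b) monoid_scheme \<Rightarrow> 'a \<Rightarrow> 'a monoid" where
  "assoc_group M j = \<lparr>carrier = {x \<in> carrier M. x \<sim>\<^bsub>M\<^esub> j},
     monoid.mult = (\<lambda>x y. THE z. \<exists>a\<in>carrier M. y = j \<otimes>\<^bsub>M\<^esub> a \<and> z = x \<otimes>\<^bsub>M\<^esub> a), one = j\<rparr>"

lemma one_assoc_group [simp]: "\<one>\<^bsub>assoc_group M j\<^esub> = j"
  by (simp add: assoc_group_def)

section \<open>Absorbed elements and the group of elements associated to a given one\<close>

context comm_monoid
begin

lemma divides_one: "x \<in> carrier G \<Longrightarrow> conical G \<Longrightarrow> x divides \<one> \<Longrightarrow> x = \<one>"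
  unfolding factor_def conical_def by metis

lemma divides_mult_left: "x \<in> carrier G \<Longrightarrow> y \<in> carrier G \<Longrightarrow> x divides x \<otimes> y"
  by (auto simp: factor_def)

lemma divides_mult_right: "x \<in> carrier G \<Longrightarrow> y \<in> carrier G \<Longrightarrow> y divides x \<otimes> y"
  by (metis divides_mult_left m_comm)

lemma absorbs_carrier: "a \<in> absorbs G j \<Longrightarrow> a \<in> carrier G"
  by (simp add: absorbs_def)

lemma absorbs_one: "j \<in> carrier G \<Longrightarrow> \<one> \<in> absorbs G j"
  by (simp add: absorbs_def)

lemma absorbs_mult:
  assumes "j \<in> carrier G" "a \<in> absorbs G j" "b \<in> absorbs G j" shows "a \<otimes> b \<in> absorbs G j"
proof -
  have c: "a \<in> carrier G" "b \<in> carrier G" using assms by (auto simp: absorbs_def)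
  have "(j \<otimes> a) \<otimes> b divides j \<otimes> b" using assms c by (intro divides_mult_rI) (auto simp: absorbs_def)
  also have "j \<otimes> b divides j" using assms by (simp add: absorbs_def)
  finally show ?thesis using assms c by (simp add: absorbs_def m_assoc)
qed

lemma absorbs_divides:
  assumes "j \<in> carrier G" "a \<in> absorbs G j" "b \<in> carrier G" "b divides a" shows "b \<in> absorbs G j"
proof -
  have c: "a \<in> carrier G" using assms by (auto simp: absorbs_def)
  have "j \<otimes> b divides j \<otimes> a" using assms c by (intro divides_mult_lI) auto
  also have "j \<otimes> a divides j" using assms by (simp add: absorbs_def)
  finally show ?thesis using assms by (simp add: absorbs_def)
qed

lemma absorbs_pow: "j \<in> carrier G \<Longrightarrow> a \<in> absorbs G j \<Longrightarrow> a [^] (n :: nat) \<in> absorbs G j"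
  by (induction n) (auto simp: absorbs_one absorbs_mult)

lemma absorbs_mprod:
  "j \<in> carrier G \<Longrightarrow> v ` set_mset \<alpha> \<subseteq> absorbs G j \<Longrightarrow> mprod G v \<alpha> \<in> absorbs G j"
  by (induction \<alpha>) (auto simp: absorbs_one absorbs_mult absorbs_carrier)

text \<open>Write q = p + t. As q is prime and not below p, it is below t; hence p + q is below p +
  t = q.\<close>

lemma absorbs_prime:
  assumes q: "Divisibility.prime G q" "q \<in> carrier G" and p: "p \<in> carrier G" "p divides q" "\<not> q divides p"
  shows "p \<in> absorbs G q"
proof -
  obtain t where t: "t \<in> carrier G" "q = p \<otimes> t" using p by (auto simp: factor_def)
  have "q divides p \<otimes> t" using q t by simp
  with q p t have "q divides t" unfolding Divisibility.prime_def by blast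
  then have "p \<otimes> q divides p \<otimes> t" using q p t by (intro divides_mult_lI) auto
  then have "p \<otimes> q divides q" unfolding t(2)[symmetric] .
  then show ?thesis using p q by (simp add: absorbs_def m_comm)
qed

lemma carrier_assoc_group:
  assumes "j \<in> carrier G" shows "carrier (assoc_group G j) = (\<lambda>a. j \<otimes> a) ` absorbs G j"
proof (intro equalityI subsetI)
  fix x assume "x \<in> carrier (assoc_group G j)"
  then have "x \<in> carrier G" "x divides j" "j divides x" by (auto simp: assoc_group_def associated_def)
  then obtain a where "a \<in> carrier G" "x = j \<otimes> a" by (auto simp: factor_def)
  with \<open>x divides j\<close> show "x \<in> (\<lambda>a. j \<otimes> a) ` absorbs G j" by (auto simp: absorbs_def)
next
  fix x assume "x \<in> (\<lambda>a. j \<otimes> a) ` absorbs G j"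
  then show "x \<in> carrier (assoc_group G j)"
    using assms by (auto simp: assoc_group_def absorbs_def associated_def divides_mult_left)
qed

lemma assoc_groupD:
  "x \<in> carrier (assoc_group G j) \<Longrightarrow> x \<in> carrier G \<and> x divides j \<and> j divides x"
  by (auto simp: assoc_group_def associated_def)

text \<open>The definite description is justified because x = j + b for some b: then x + a = (j + a)
  + b depends on j + a only.\<close>

lemma assoc_group_mult:
  assumes j: "j \<in> carrier G" and x: "x \<in> carrier (assoc_group G j)" and a: "a \<in> carrier G"
  shows "x \<otimes>\<^bsub>assoc_group G j\<^esub> (j \<otimes> a) = x \<otimes> a"
proof -
  obtain b where b: "b \<in> carrier G" "x = j \<otimes> b"
    using x absorbs_carrier by (auto simp: carrier_assoc_group[OF j])
  have "z = x \<otimes> a" if "\<exists>c\<in>carrier G. j \<otimes> a = j \<otimes> c \<and> z = x \<otimes> c" for z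
  proof -
    from that obtain c where c: "c \<in> carrier G" "j \<otimes> a = j \<otimes> c" "z = x \<otimes> c" by blast
    have "z = (j \<otimes> c) \<otimes> b" using j b c by (simp add: m_ac)
    also have "\<dots> = x \<otimes> a" unfolding c(2)[symmetric] using j b a by (simp add: m_ac)
    finally show ?thesis .
  qed
  then have "(THE z. \<exists>c\<in>carrier G. j \<otimes> a = j \<otimes> c \<and> z = x \<otimes> c) = x \<otimes> a"
    using a by (intro the_equality) auto
  then show ?thesis by (simp add: assoc_group_def)
qed

text \<open>When j = j + a + c, the inverse of j + a is j + c; here c is absorbed too, since j + c
  divides j.\<close>

lemma comm_group_assoc_group:
  assumes j: "j \<in> carrier G" shows "comm_group (assoc_group G j)"
proof -
  let ?A = "absorbs G j"
  note C = carrier_assoc_group[OF j]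
  have mult: "(j \<otimes> a) \<otimes>\<^bsub>assoc_group G j\<^esub> (j \<otimes> b) = j \<otimes> (a \<otimes> b)" if "a \<in> ?A" "b \<in> ?A" for a b
    using that j by (subst assoc_group_mult) (auto simp: C absorbs_carrier m_assoc)
  show ?thesis
  proof (rule comm_groupI)
    show "\<one>\<^bsub>assoc_group G j\<^esub> \<in> carrier (assoc_group G j)"
      using j absorbs_one[OF j] by (auto simp: C image_iff intro!: bexI[of _ "\<one>"])
    show "\<one>\<^bsub>assoc_group G j\<^esub> \<otimes>\<^bsub>assoc_group G j\<^esub> x = x" if "x \<in> carrier (assoc_group G j)" for x
      using that mult[of "\<one>"] j absorbs_one[OF j] by (auto simp: C absorbs_carrier)
    show "\<exists>y\<in>carrier (assoc_group G j). y \<otimes>\<^bsub>assoc_group G j\<^esub> x = \<one>\<^bsub>assoc_group G j\<^esub>"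
      if x: "x \<in> carrier (assoc_group G j)" for x
    proof -
      from x obtain a where a: "a \<in> ?A" "x = j \<otimes> a" by (auto simp: C)
      then obtain c where c: "c \<in> carrier G" "j = j \<otimes> a \<otimes> c" by (auto simp: absorbs_def factor_def)
      have "j \<otimes> c divides j"
        using c(2) j a c(1) by (auto simp: factor_def absorbs_carrier m_ac intro!: bexI[of _ a])
      then have cA: "c \<in> ?A" using c by (simp add: absorbs_def)
      have "j \<otimes> (c \<otimes> a) = j" using c j a by (metis m_assoc m_comm absorbs_carrier)
      then show ?thesis using a cA mult[OF cA a(1)] by (auto simp: C)
    qed
  qed (auto simp: C mult absorbs_mult[OF j] m_ac absorbs_carrier)
qed

text \<open>From p = p + p + t it follows that (p + t) + (p + t) = (p + p + t) + t = p + t.\<close>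

lemma regular_idempotent:
  assumes p: "p \<in> carrier G" "p \<otimes> p divides p"
  obtains e where "e \<in> carrier G" "e \<sim> p" "e \<otimes> e = e"
proof -
  obtain t where t: "t \<in> carrier G" "p = p \<otimes> p \<otimes> t" using p by (auto simp: factor_def)
  have "(p \<otimes> t) \<otimes> (p \<otimes> t) = (p \<otimes> p \<otimes> t) \<otimes> t" using p(1) t(1) by (simp add: m_ac)
  also have "\<dots> = p \<otimes> t" using t by simp
  finally have "(p \<otimes> t) \<otimes> (p \<otimes> t) = p \<otimes> t" .
  moreover have "p \<otimes> t divides p" using p t by (auto simp: factor_def m_ac intro!: bexI[of _ p])
  ultimately show thesis
    using p t by (intro that[of "p \<otimes> t"]) (auto simp: associated_def divides_mult_left)
qed

lemma prime_divides_mprod: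
  assumes p: "Divisibility.prime G p" "p \<in> carrier G" and "v ` set_mset \<alpha> \<subseteq> carrier G"
    and "p divides mprod G v \<alpha>" "conical G"
  shows "\<exists>t\<in>#\<alpha>. p divides v t"
  using assms(3,4)
proof (induction \<alpha>)
  case empty
  then have "p = \<one>" using divides_one assms by simp
  then show ?case using p unfolding Divisibility.prime_def by simp
next
  case (add t \<alpha>)
  then have "p divides v t \<or> p divides mprod G v \<alpha>" using p unfolding Divisibility.prime_def by auto
  with add show ?case by auto
qed

lemma mprod_divides:
  assumes "t \<in># \<alpha>" "v ` set_mset \<alpha> \<subseteq> carrier G" shows "v t divides mprod G v \<alpha>"
proof -
  obtain \<beta> where "\<alpha> = add_mset t \<beta>" using assms(1) by (metis multi_member_split)
  with assms show ?thesis by (auto intro: divides_mult_left)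
qed

lemma prime_associated:
  assumes p: "Divisibility.prime G p" "p \<in> carrier G" and q: "q \<in> carrier G" "q \<sim> p"
  shows "Divisibility.prime G q"
  unfolding Divisibility.prime_def
proof (intro conjI ballI impI)
  have qp: "q divides p" "p divides q" using q by (auto simp: associated_def)
  show "q \<notin> Units G" using divides_unit[OF qp(2) p(2)] p(1) unfolding Divisibility.prime_def by blast
  fix a b assume ab: "a \<in> carrier G" "b \<in> carrier G" "q divides a \<otimes> b"
  then have "p divides a \<otimes> b" using divides_trans[OF qp(2) _ p(2)] by blast
  with p ab have "p divides a \<or> p divides b" unfolding Divisibility.prime_def by blast
  then show "q divides a \<or> q divides b" using divides_trans[OF qp(1) _ q(1)] by blast
qed

lemma foldr_eq_mprod: "set xs \<subseteq> carrier G \<Longrightarrow> foldr (\<otimes>) xs \<one> = mprod G (\<lambda>x. x) (mset xs)"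
  by (induction xs) auto

end

locale pg_monoid = comm_monoid +
  assumes pg: "primely_generated G" and con: "conical G" and ref: "refinement_monoid G"
begin

definition primes :: "'a set" where
  "primes = {p \<in> carrier G. Divisibility.prime G p}"

lemma primes_carrier: "p \<in> primes \<Longrightarrow> p \<in> carrier G"
  by (simp add: primes_def)

lemma primes_prime: "p \<in> primes \<Longrightarrow> Divisibility.prime G p"
  by (simp add: primes_def)

lemma prime_decomposition:
  assumes "x \<in> carrier G"
  obtains \<alpha> where "set_mset \<alpha> \<subseteq> primes" "x = mprod G (\<lambda>x. x) \<alpha>"
proof (cases "x \<in> Units G")
  case True
  then have "x = \<one>" using con unfolding conical_def Units_def by blast
  then show ?thesis by (intro that[of "{#}"]) auto
next
  case False
  then obtain xs where xs: "x = foldr (\<otimes>) xs \<one>" "set xs \<subseteq> primes"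
    using pg assms unfolding primely_generated_def finite_sums_def primes_def by blast
  then have "x = mprod G (\<lambda>x. x) (mset xs)" using foldr_eq_mprod[of xs] primes_carrier by auto
  with xs show ?thesis by (intro that[of "mset xs"]) auto
qed

lemma regular_cong:
  assumes "p \<in> carrier G" "q \<in> carrier G" "p \<sim> q"
  shows "p \<otimes> p divides p \<longleftrightarrow> q \<otimes> q divides q"
proof -
  have *: "q \<otimes> q divides q" if c: "p \<in> carrier G" "q \<in> carrier G" and pq: "p divides q" "q divides p" and "p \<otimes> p divides p" for p q
  proof -
    have "q \<otimes> q divides p \<otimes> q" using c pq by (intro divides_mult_rI) auto
    also have "p \<otimes> q divides p \<otimes> p" using c pq by (intro divides_mult_lI) auto
    also have "p \<otimes> p divides p" by fact
    also have "p divides q" by fact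
    finally show ?thesis using c by simp
  qed
  show ?thesis using *[of p q] *[of q p] assms by (auto simp: associated_def)
qed

definition rep :: "'a \<Rightarrow> 'a" where
  "rep p = (SOME e. e \<in> carrier G \<and> e \<sim> p \<and> (p \<otimes> p divides p \<longrightarrow> e \<otimes> e = e))"

lemma rep:
  assumes "p \<in> carrier G"
  shows "rep p \<in> carrier G" "rep p \<sim> p" "p \<otimes> p divides p \<Longrightarrow> rep p \<otimes> rep p = rep p"
proof -
  have "\<exists>e. e \<in> carrier G \<and> e \<sim> p \<and> (p \<otimes> p divides p \<longrightarrow> e \<otimes> e = e)"
  proof (cases "p \<otimes> p divides p")
    case True
    obtain e where "e \<in> carrier G" "e \<sim> p" "e \<otimes> e = e" by (rule regular_idempotent[OF assms True])
    then show ?thesis by blast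
  next
    case False
    then show ?thesis using assms by (intro exI[of _ p]) (auto simp: associated_def)
  qed
  from someI_ex[OF this, folded rep_def]
  show "rep p \<in> carrier G" "rep p \<sim> p" "p \<otimes> p divides p \<Longrightarrow> rep p \<otimes> rep p = rep p" by blast+
qed

lemma rep_prime: "p \<in> primes \<Longrightarrow> rep p \<in> primes"
  using rep prime_associated[of p "rep p"] by (simp add: primes_def)

lemma assoc_trans:
  "p \<in> carrier G \<Longrightarrow> q \<in> carrier G \<Longrightarrow> r \<in> carrier G \<Longrightarrow> p \<sim> q \<Longrightarrow> q \<sim> r \<Longrightarrow> p \<sim> r"
  unfolding associated_def by (meson divides_trans)

lemma assoc_sym: "p \<sim> q \<Longrightarrow> q \<sim> p"
  by (simp add: associated_def)

text \<open>The choice operator is applied to the same predicate for both elements, since regularity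
  depends on the class only.\<close>

lemma rep_cong:
  assumes "p \<in> carrier G" "q \<in> carrier G" "p \<sim> q" shows "rep p = rep q"
proof -
  have "e \<sim> p \<longleftrightarrow> e \<sim> q" if "e \<in> carrier G" for e
    using assoc_trans[of e p q] assoc_trans[of e q p] assms assoc_sym that by blast
  then have "(e \<in> carrier G \<and> e \<sim> p \<and> (p \<otimes> p divides p \<longrightarrow> e \<otimes> e = e)) =
    (e \<in> carrier G \<and> e \<sim> q \<and> (q \<otimes> q divides q \<longrightarrow> e \<otimes> e = e))" for e
    using regular_cong[OF assms] by blast
  then show ?thesis unfolding rep_def by simp
qed

end

section \<open>The I-system of classes of associated primes\<close>

context pg_monoid
begin

text \<open>The neutral element of \<open>G\<^sub>i\<close> is \<open>i\<close>, so \<open>g\<close>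
  already contains one copy of \<open>i\<close>, and the pair (n, g) stands for (n - 1) i + g in the
  given monoid. At a regular index the pair is (0, g), and \<open>nat\<close> truncates the exponent
  to 0. The map \<phi> adds this element to \<open>j\<close>.\<close>

definition prime_sys :: "('a, 'a) i_system" where
  "prime_sys = \<lparr>index = rep ` primes,
     order_rel = {(i, j) \<in> rep ` primes \<times> rep ` primes. i divides j},
     free = {i \<in> rep ` primes. \<not> i \<otimes> i divides i},
     grp = assoc_group G,
     phi = (\<lambda>j i (n, g). j \<otimes> (i [^] nat (n - 1) \<otimes> g))\<rparr>"

lemma sys_sel [simp]:
  "index prime_sys = rep ` primes" "grp prime_sys = assoc_group G"
  "phi prime_sys j i (n, g) = j \<otimes> (i [^] nat (n - 1) \<otimes> g)"
  "i \<in> free prime_sys \<longleftrightarrow> i \<in> rep ` primes \<and> \<not> i \<otimes> i divides i"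
  "(i, j) \<in> order_rel prime_sys \<longleftrightarrow> i \<in> rep ` primes \<and> j \<in> rep ` primes \<and> i divides j"
  by (simp_all add: prime_sys_def)

lemma index_prime: "i \<in> rep ` primes \<Longrightarrow> i \<in> primes"
  using rep_prime by auto

lemma index_carrier: "i \<in> rep ` primes \<Longrightarrow> i \<in> carrier G"
  using index_prime primes_carrier by blast

lemma rep_index:
  assumes "i \<in> rep ` primes" "x \<in> carrier G" "x \<sim> i" shows "rep x = i"
proof -
  obtain p where p: "p \<in> primes" "i = rep p" using assms(1) by blast
  then have pc: "p \<in> carrier G" by (simp add: primes_carrier)
  have "x \<sim> p" using assms p rep[OF pc] assoc_trans[of x i p] pc by simp
  then show ?thesis using rep_cong[OF assms(2) pc] p by simp
qed

lemma index_antisym: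
  "i \<in> rep ` primes \<Longrightarrow> j \<in> rep ` primes \<Longrightarrow> i divides j \<Longrightarrow> j divides i \<Longrightarrow> i = j"
  using rep_index[of i j] rep_index[of j j] index_carrier by (auto simp: associated_def)

lemma idempotent_index:
  assumes "i \<in> rep ` primes" "i \<otimes> i divides i" shows "i \<otimes> i = i"
proof -
  obtain p where p: "p \<in> primes" "i = rep p" using assms(1) by blast
  then have pc: "p \<in> carrier G" by (simp add: primes_carrier)
  have "p \<otimes> p divides p" using regular_cong[OF rep(1)[OF pc] pc rep(2)[OF pc]] assms p by simp
  then show ?thesis using rep(3)[OF pc] p by simp
qed

lemma below_sys: "below prime_sys i j \<longleftrightarrow> i \<in> rep ` primes \<and> j \<in> rep ` primes \<and> i divides j \<and> i \<noteq> j"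
  by (auto simp: below_def)

lemma below_absorbs:
  assumes ij: "below prime_sys i j" shows "i \<in> absorbs G j"
proof (rule absorbs_prime)
  show "Divisibility.prime G j" "j \<in> carrier G" "i \<in> carrier G" "i divides j" "\<not> j divides i"
    using ij index_antisym[of i j] index_prime[of j] index_carrier by (auto simp: below_sys primes_prime)
qed

lemma assoc_group_absorbs:
  assumes ij: "below prime_sys i j" and x: "x \<in> carrier (assoc_group G i)" shows "x \<in> absorbs G j"
proof (rule absorbs_divides)
  show "j \<in> carrier G" using ij index_carrier by (simp add: below_sys)
  show "i \<in> absorbs G j" using ij by (rule below_absorbs)
  show "x \<in> carrier G" "x divides i" using assoc_groupD[OF x] by auto
qed

lemma grp_closed: "j \<in> carrier G \<Longrightarrow> a \<in> absorbs G j \<Longrightarrow> j \<otimes> a \<in> carrier (assoc_group G j)"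
  by (simp add: carrier_assoc_group)

lemma grp_mult:
  "j \<in> carrier G \<Longrightarrow> a \<in> absorbs G j \<Longrightarrow> b \<in> absorbs G j \<Longrightarrow>
   (j \<otimes> a) \<otimes>\<^bsub>assoc_group G j\<^esub> (j \<otimes> b) = j \<otimes> (a \<otimes> b)"
  by (simp add: assoc_group_mult grp_closed absorbs_carrier m_assoc)

lemma component_value:
  assumes "below prime_sys i j" "(n, g) \<in> carrier (component prime_sys i)"
  shows "i [^] nat (n - 1) \<otimes> g \<in> absorbs G j"
  using assms below_absorbs[OF assms(1)] assoc_group_absorbs[OF assms(1), of g] index_carrier
  by (intro absorbs_mult absorbs_pow) (auto simp: below_sys carrier_component)

text \<open>With neutral element \<open>i\<close>, the group operation is addition with one copy of
  \<open>i\<close> removed.\<close>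

lemma mult_assoc_group_self:
  assumes i: "i \<in> carrier G" and g: "g \<in> carrier (assoc_group G i)" "h \<in> carrier (assoc_group G i)"
  shows "i \<otimes> (g \<otimes>\<^bsub>assoc_group G i\<^esub> h) = g \<otimes> h"
proof -
  obtain a where a: "a \<in> carrier G" "h = i \<otimes> a"
    using g(2) absorbs_carrier by (auto simp: carrier_assoc_group[OF i])
  have "g \<in> carrier G" using g assoc_groupD by blast
  then show ?thesis using assoc_group_mult[OF i g(1) a(1)] a i by (simp add: m_ac)
qed

lemma phi_sys_hom:
  assumes ij: "below prime_sys i j" shows "phi prime_sys j i \<in> hom (component prime_sys i) (assoc_group G j)"
proof (rule homI)
  have ic: "i \<in> carrier G" and jc: "j \<in> carrier G" using ij index_carrier by (auto simp: below_sys)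
  show "phi prime_sys j i u \<in> carrier (assoc_group G j)" if "u \<in> carrier (component prime_sys i)" for u
    using that component_value[OF ij] jc by (cases u) (auto intro: grp_closed)
  fix u v assume u: "u \<in> carrier (component prime_sys i)" and v: "v \<in> carrier (component prime_sys i)"
  obtain m g n h where [simp]: "u = (m, g)" "v = (n, h)" by (cases u; cases v)
  have g: "g \<in> carrier (assoc_group G i)" "h \<in> carrier (assoc_group G i)"
    using u v by (auto simp: carrier_component)
  then have gc: "g \<in> carrier G" "h \<in> carrier G" "g \<otimes>\<^bsub>assoc_group G i\<^esub> h \<in> carrier G"
    using assoc_groupD comm_group.axioms(2)[OF comm_group_assoc_group[OF ic]]
    by (meson group.is_monoid monoid.m_closed)+
  have "i [^] nat (m + n - 1) \<otimes> (g \<otimes>\<^bsub>assoc_group G i\<^esub> h) = i [^] nat (m - 1) \<otimes> g \<otimes> (i [^] nat (n - 1) \<otimes> h)"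
  proof (cases "i \<in> free prime_sys")
    case True
    then have mn: "1 \<le> m" "1 \<le> n" using u v by (auto simp: carrier_component)
    \<comment> \<open>The exponents m - 1 and n - 1 leave one surplus copy of \<open>i\<close>,
      which \<open>mult_assoc_group_self\<close> consumes.\<close>
    then have "nat (m + n - 1) = nat (m - 1) + nat (n - 1) + 1" by linarith
    then have "i [^] nat (m + n - 1) \<otimes> (g \<otimes>\<^bsub>assoc_group G i\<^esub> h) =
      i [^] nat (m - 1) \<otimes> i [^] nat (n - 1) \<otimes> (i \<otimes> (g \<otimes>\<^bsub>assoc_group G i\<^esub> h))"
    proof -
      have "i [^] (a + b + 1) \<otimes> c = i [^] a \<otimes> i [^] b \<otimes> (i \<otimes> c)" if "c \<in> carrier G" for a b :: nat and c
        using ic that by (simp add: nat_pow_mult[symmetric] m_assoc)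
      from this[OF gc(3), of "nat (m - 1)" "nat (n - 1)"] show ?thesis
        unfolding \<open>nat (m + n - 1) = nat (m - 1) + nat (n - 1) + 1\<close> .
    qed
    also have "\<dots> = i [^] nat (m - 1) \<otimes> i [^] nat (n - 1) \<otimes> (g \<otimes> h)"
      by (simp add: mult_assoc_group_self ic g)
    finally show ?thesis using ic gc by (simp add: m_ac)
  next
    case False
    then have mn: "m = 0" "n = 0" using u v by (auto simp: carrier_component)
    have "i \<otimes> i = i" using False ij by (intro idempotent_index) (auto simp: below_sys)
    obtain a where a: "a \<in> carrier G" "h = i \<otimes> a"
      using g(2) absorbs_carrier by (auto simp: carrier_assoc_group[OF ic])
    obtain b where b: "b \<in> carrier G" "g = i \<otimes> b"
      using g(1) absorbs_carrier by (auto simp: carrier_assoc_group[OF ic])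
    have "g \<otimes> h = (i \<otimes> i) \<otimes> b \<otimes> a" using a b ic by (simp add: m_ac)
    also have "\<dots> = g \<otimes> a" using \<open>i \<otimes> i = i\<close> b by simp
    also have "\<dots> = g \<otimes>\<^bsub>assoc_group G i\<^esub> h" using assoc_group_mult[OF ic g(1) a(1)] a by simp
    finally show ?thesis using mn gc by simp
  qed
  then show "phi prime_sys j i (u \<otimes>\<^bsub>component prime_sys i\<^esub> v) = phi prime_sys j i u \<otimes>\<^bsub>assoc_group G j\<^esub> phi prime_sys j i v"
    using component_value[OF ij] u v jc by (simp add: grp_mult)
qed

lemma group_index: "i \<in> rep ` primes \<Longrightarrow> comm_group (grp prime_sys i)"
  by (simp add: comm_group_assoc_group index_carrier)

lemma phi_sys_hom': "below prime_sys i j \<Longrightarrow> phi prime_sys j i \<in> hom (component prime_sys i) (grp prime_sys j)"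
  using phi_sys_hom by simp

text \<open>For free \<open>j\<close> the pair (0, j + w) lies outside \<open>M\<^sub>j\<close>. Its
  image is found from (0, j + w) + (1, j) = (1, j + w) by cancelling in \<open>G\<^sub>k\<close>.
  Functoriality needs it, because the map to \<open>G\<^sub>k\<close> is applied to images in
  \<open>G\<^sub>j\<close>.\<close>

lemma phi_ext_sys_zero:
  assumes jk: "below prime_sys j k" and w: "w \<in> absorbs G j"
  shows "phi_ext prime_sys k j (0, j \<otimes> w) = k \<otimes> w"
proof -
  have jI: "j \<in> rep ` primes" "k \<in> rep ` primes" and jc: "j \<in> carrier G" and kc: "k \<in> carrier G"
    using jk index_carrier by (auto simp: below_sys)
  interpret K: comm_group "assoc_group G k" by (rule comm_group_assoc_group) (rule kc)
  interpret J: comm_group "assoc_group G j" by (rule comm_group_assoc_group) (rule jc)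
  note wc = absorbs_carrier[OF w]
  have jw: "j \<otimes> w \<in> carrier (assoc_group G j)" using jc w by (rule grp_closed)
  have jk': "j \<in> absorbs G k" using jk by (rule below_absorbs)
  have wk: "w \<in> absorbs G k"
    using assoc_group_absorbs[OF jk jw] divides_mult_right[OF jc wc] absorbs_divides kc wc by blast
  note ext = phi_ext_component[OF group_index[OF jI(1)] group_index[OF jI(2)] phi_sys_hom'[OF jk]]
  note exth = phi_ext_hom[OF group_index[OF jI(1)] group_index[OF jI(2)] phi_sys_hom'[OF jk]]
  show ?thesis
  proof (cases "j \<in> free prime_sys")
    case False
    then have "(0, j \<otimes> w) \<in> carrier (component prime_sys j)" using jw by (auto simp: carrier_component)
    then have "phi_ext prime_sys k j (0, j \<otimes> w) = k \<otimes> (j \<otimes> w)"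
      using ext jc wc by simp
    moreover have "k \<otimes> j = k"
    proof -
      have "j \<otimes> j = j" using False jI by (intro idempotent_index) auto
      moreover obtain s where "s \<in> carrier G" "k = j \<otimes> s" using jk by (auto simp: below_sys factor_def)
      ultimately show ?thesis using jc by (metis m_assoc m_comm)
    qed
    ultimately show ?thesis using jc kc wc by (simp add: m_assoc[symmetric])
  next
    case True
    have tok: "(1, g) \<in> carrier (component prime_sys j)" if "g \<in> carrier (assoc_group G j)" for g
      using True that by (auto simp: carrier_component)
    have gr: "(0, j \<otimes> w) \<in> carrier (grothendieck prime_sys j)" "(1, j) \<in> carrier (grothendieck prime_sys j)"
      using True jw J.one_closed by (auto simp: carrier_grothendieck)
    have "(0, j \<otimes> w) \<otimes>\<^bsub>grothendieck prime_sys j\<^esub> (1, j) = (1, j \<otimes> w)"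
      using J.r_one[OF jw] by simp
    then have "phi_ext prime_sys k j (1, j \<otimes> w) = phi_ext prime_sys k j (0, j \<otimes> w) \<otimes>\<^bsub>assoc_group G k\<^esub> phi_ext prime_sys k j (1, j)"
      using hom_mult[OF exth gr] by simp
    moreover have "phi_ext prime_sys k j (1, j \<otimes> w) = k \<otimes> (j \<otimes> w)" "phi_ext prime_sys k j (1, j) = k \<otimes> j"
      using ext[OF tok[OF jw]] ext[OF tok] J.one_closed jc wc by simp_all
    ultimately have eq: "k \<otimes> (j \<otimes> w) = phi_ext prime_sys k j (0, j \<otimes> w) \<otimes>\<^bsub>assoc_group G k\<^esub> (k \<otimes> j)" by simp
    have "k \<otimes> (j \<otimes> w) = (k \<otimes> w) \<otimes>\<^bsub>assoc_group G k\<^esub> (k \<otimes> j)"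
      unfolding grp_mult[OF kc wk jk'] using kc jc wc by (simp add: m_ac)
    with eq have "(k \<otimes> w) \<otimes>\<^bsub>assoc_group G k\<^esub> (k \<otimes> j) = phi_ext prime_sys k j (0, j \<otimes> w) \<otimes>\<^bsub>assoc_group G k\<^esub> (k \<otimes> j)" by simp
    moreover have "phi_ext prime_sys k j (0, j \<otimes> w) \<in> carrier (assoc_group G k)"
      using hom_in_carrier[OF exth gr(1)] by simp
    ultimately show ?thesis using kc wk jk' by (auto simp: grp_closed)
  qed
qed

text \<open>Both sides are homomorphisms on the Grothendieck group, so it suffices to compare them
  on \<open>M\<^sub>i\<close>, where \<open>phi_ext_sys_zero\<close> evaluates the outer
  map.\<close>

lemma phi_hat_sys_functor:
  assumes ij: "(i, j) \<in> order_rel prime_sys" and jk: "(j, k) \<in> order_rel prime_sys" and u: "u \<in> carrier (grothendieck prime_sys i)"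
  shows "phi_hat prime_sys k i u = phi_hat prime_sys k j (phi_hat prime_sys j i u)"
proof (cases "i = j \<or> j = k")
  case True
  then show ?thesis by (auto simp: phi_hat_def)
next
  case False
  have ij': "below prime_sys i j" and jk': "below prime_sys j k" using ij jk False by (auto simp: below_sys)
  have I: "i \<in> rep ` primes" "j \<in> rep ` primes" "k \<in> rep ` primes" using ij jk by auto
  have ic: "i \<in> carrier G" "j \<in> carrier G" "k \<in> carrier G" using I index_carrier by auto
  have "i divides k" using ij jk divides_trans ic by auto
  moreover have "i \<noteq> k" using ij jk False index_antisym by auto
  ultimately have ik: "below prime_sys i k" using I by (simp add: below_sys)
  note ext = phi_ext_component[OF group_index[OF I(1)] group_index phi_sys_hom']
  note exth = phi_ext_hom[OF group_index group_index phi_sys_hom']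
  have zero: "(\<lambda>g. (0, g)) \<in> hom (grp prime_sys j) (grothendieck prime_sys j)"
    by (auto simp: hom_def carrier_grothendieck)
  have "phi_ext prime_sys k j \<circ> ((\<lambda>g. (0, g)) \<circ> phi_ext prime_sys j i) \<in> hom (grothendieck prime_sys i) (grp prime_sys k)"
    by (intro hom_compose[OF hom_compose[OF exth zero] exth] I ij' jk')
  moreover have "phi_ext prime_sys k i x = (phi_ext prime_sys k j \<circ> ((\<lambda>g. (0, g)) \<circ> phi_ext prime_sys j i)) x"
    if x: "x \<in> carrier (component prime_sys i)" for x
  proof -
    obtain n g where [simp]: "x = (n, g)" by (cases x)
    show ?thesis
      using ext[OF I(2) ij' x] ext[OF I(3) ik x] component_value[OF ij', of n g] x
      by (simp add: phi_ext_sys_zero[OF jk'])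
  qed
  ultimately have "phi_ext prime_sys k i u = (phi_ext prime_sys k j \<circ> ((\<lambda>g. (0, g)) \<circ> phi_ext prime_sys j i)) u"
    by (rule hom_grothendieck_unique[OF group_index[OF I(1)] comm_group.axioms(2)[OF group_index[OF I(3)]]
          exth[OF I(1,3) ik] _ _ u])
  then show ?thesis using ij' jk' ik by (simp add: phi_hat_def below_def)
qed

text \<open>An element of \<open>G\<^sub>i\<close> is i + a with \<open>a\<close> absorbed, and
  \<open>a\<close> is a sum of primes q. Each q lies strictly below \<open>i\<close>, since i below
  q would make \<open>i\<close> absorb itself; so i + q is a value of \<phi>.\<close>

lemma sys_generated:
  assumes i: "i \<in> free prime_sys"
  shows "carrier (grp prime_sys i) =
    finite_sums (grp prime_sys i) {phi prime_sys i k x | k x. below prime_sys k i \<and> x \<in> carrier (component prime_sys k)}"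
proof (intro equalityI subsetI)
  have iI: "i \<in> rep ` primes" and fr: "\<not> i \<otimes> i divides i" using i by auto
  then have ic: "i \<in> carrier G" by (simp add: index_carrier)
  let ?S = "{phi prime_sys i k x | k x. below prime_sys k i \<and> x \<in> carrier (component prime_sys k)}"
  interpret A: comm_group "assoc_group G i" by (rule comm_group_assoc_group) (rule ic)
  fix g assume "g \<in> carrier (grp prime_sys i)"
  then obtain a where a: "a \<in> absorbs G i" "g = i \<otimes> a" by (auto simp: carrier_assoc_group[OF ic])
  obtain \<alpha> where \<alpha>: "set_mset \<alpha> \<subseteq> primes" "a = mprod G (\<lambda>x. x) \<alpha>"
    by (rule prime_decomposition[OF absorbs_carrier[OF a(1)]])
  obtain qs where qs: "mset qs = \<alpha>" by (metis ex_mset)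
  have q: "q \<in> absorbs G i \<and> i \<otimes> q \<in> ?S" if "q \<in> set qs" for q
  proof -
    have qp: "q \<in> primes" using that \<alpha> qs by auto
    then have qc: "q \<in> carrier G" by (rule primes_carrier)
    have "q divides a" using \<alpha> that qs primes_carrier
      unfolding \<alpha>(2) by (intro mprod_divides[of q \<alpha> "\<lambda>x. x"]) auto
    then have qa: "q \<in> absorbs G i" using absorbs_divides[OF ic a(1) qc] by simp
    have "q divides i \<otimes> q" using ic qc by (rule divides_mult_right)
    also have "i \<otimes> q divides i" using qa by (simp add: absorbs_def)
    finally have qi: "q divides i" using qc by simp
    have niq: "\<not> i divides q"
    proof
      assume "i divides q"
      then have "i \<in> absorbs G i" using absorbs_divides[OF ic qa ic] by simp
      with fr show False by (simp add: absorbs_def)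
    qed
    have rq: "rep q \<in> carrier G" "rep q divides q" "q divides rep q" using rep[OF qc] by (auto simp: associated_def)
    have "rep q divides i" using divides_trans[OF rq(2) qi rq(1)] .
    moreover have "rep q \<noteq> i" using rq niq by auto
    ultimately have b: "below prime_sys (rep q) i" using iI qp by (simp add: below_sys)
    have "(deg prime_sys (rep q), q) \<in> carrier (component prime_sys (rep q))"
      using rq qc by (auto simp: carrier_component deg_def assoc_group_def associated_def)
    moreover have "phi prime_sys i (rep q) (deg prime_sys (rep q), q) = i \<otimes> q" using qc by (simp add: deg_def)
    ultimately have "\<exists>k x. i \<otimes> q = phi prime_sys i k x \<and> below prime_sys k i \<and> x \<in> carrier (component prime_sys k)"
      using b by (intro exI[of _ "rep q"] exI[of _ "(deg prime_sys (rep q), q)"]) auto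
    then show ?thesis using qa by blast
  qed
  have "i \<otimes> mprod G (\<lambda>x. x) (mset qs) = foldr (\<otimes>\<^bsub>assoc_group G i\<^esub>) (map (\<lambda>q. i \<otimes> q) qs) i"
    using q
  proof (induction qs)
    case (Cons q qs)
    have qa: "q \<in> absorbs G i" and qsa: "(\<lambda>x. x) ` set_mset (mset qs) \<subseteq> absorbs G i" using Cons.prems by auto
    then have "mprod G (\<lambda>x. x) (mset qs) \<in> absorbs G i" using ic by (intro absorbs_mprod) auto
    then have "i \<otimes> mprod G (\<lambda>x. x) (mset (q # qs)) =
      (i \<otimes> q) \<otimes>\<^bsub>assoc_group G i\<^esub> (i \<otimes> mprod G (\<lambda>x. x) (mset qs))"
      using grp_mult[OF ic qa] absorbs_carrier[OF qa] by simp
    with Cons.IH Cons.prems show ?case by simp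
  qed (simp add: ic)
  then have "g = foldr (\<otimes>\<^bsub>assoc_group G i\<^esub>) (map (\<lambda>q. i \<otimes> q) qs) i" by (simp add: a \<alpha> qs)
  moreover have "set (map (\<lambda>q. i \<otimes> q) qs) \<subseteq> ?S" using q by auto
  ultimately show "g \<in> finite_sums (grp prime_sys i) ?S"
    unfolding finite_sums_def by (intro CollectI exI[of _ "map (\<lambda>q. i \<otimes> q) qs"]) simp
next
  have iI: "i \<in> rep ` primes" using i by auto
  interpret A: comm_group "assoc_group G i" by (rule comm_group_assoc_group) (rule index_carrier[OF iI])
  fix g assume "g \<in> finite_sums (grp prime_sys i) {phi prime_sys i k x | k x. below prime_sys k i \<and> x \<in> carrier (component prime_sys k)}"
  then obtain xs where g: "g = foldr (\<otimes>\<^bsub>grp prime_sys i\<^esub>) xs \<one>\<^bsub>grp prime_sys i\<^esub>"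
    and xs: "set xs \<subseteq> {phi prime_sys i k x | k x. below prime_sys k i \<and> x \<in> carrier (component prime_sys k)}"
    unfolding finite_sums_def by blast
  have "set xs \<subseteq> carrier (assoc_group G i)" using xs hom_in_carrier[OF phi_sys_hom] by blast
  then show "g \<in> carrier (grp prime_sys i)" unfolding g using A.one_closed by (induction xs) auto
qed

lemma is_i_system_sys: "is_i_system prime_sys"
  unfolding is_i_system_def
proof (intro conjI)
  show "partial_order_on (index prime_sys) (order_rel prime_sys)"
    unfolding partial_order_on_def preorder_on_def
  proof (intro conjI)
    show "order_rel prime_sys \<subseteq> index prime_sys \<times> index prime_sys" by auto
    show "refl_on (index prime_sys) (order_rel prime_sys)" using index_carrier by (auto simp: refl_on_def)
    show "trans (order_rel prime_sys)" using divides_trans index_carrier by (intro transI) (auto simp del: image_iff)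
    show "antisym (order_rel prime_sys)" using index_antisym by (intro antisymI) auto
  qed
  show "free prime_sys \<subseteq> index prime_sys" by auto
  show "\<forall>i\<in>index prime_sys. comm_group (grp prime_sys i)" using group_index by simp
  show "\<forall>i j. below prime_sys i j \<longrightarrow> phi prime_sys j i \<in> hom (component prime_sys i) (grp prime_sys j)" using phi_sys_hom' by blast
  show "\<forall>i j k. (i, j) \<in> order_rel prime_sys \<longrightarrow> (j, k) \<in> order_rel prime_sys \<longrightarrow>
      (\<forall>u\<in>carrier (grothendieck prime_sys i). phi_hat prime_sys k i u = phi_hat prime_sys k j (phi_hat prime_sys j i u))"
    using phi_hat_sys_functor by blast
  show "\<forall>i\<in>free prime_sys. carrier (grp prime_sys i) =
      finite_sums (grp prime_sys i) {phi prime_sys i k x | k x. below prime_sys k i \<and> x \<in> carrier (component prime_sys k)}"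
    using sys_generated by blast
qed

section \<open>The given monoid has the presentation of its I-system\<close>

sublocale S: isys prime_sys
  by unfold_locales (rule is_i_system_sys)

lemma sys_tokens: "(i, g) \<in> tokens prime_sys \<longleftrightarrow> i \<in> rep ` primes \<and> g \<in> carrier G \<and> g divides i \<and> i divides g"
  by (auto simp: tokens_def assoc_group_def associated_def)

text \<open>A token below \<open>j\<close> is absorbed in the monoid, and \<phi> adds it to
  \<open>j\<close>. A token at \<open>j\<close> itself is absorbed only for regular
  \<open>j\<close>, where j + g = g because \<open>j\<close> is idempotent.\<close>

lemma theta_sys:
  assumes j: "j \<in> rep ` primes" and t: "t \<in> absorbed prime_sys j"
  shows "snd t \<in> absorbs G j" "theta prime_sys j t = j \<otimes> snd t"
proof -
  obtain i g where [simp]: "t = (i, g)" by (cases t)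
  have jc: "j \<in> carrier G" using j by (rule index_carrier)
  have tok: "(i, g) \<in> tokens prime_sys" using t by (simp add: absorbed_def)
  have "g \<in> absorbs G j \<and> theta prime_sys j (i, g) = j \<otimes> g"
  proof (cases "i = j")
    case True
    then have "\<not> j \<in> free prime_sys" using t by (auto simp: absorbed_def)
    then have jj: "j \<otimes> j divides j" "j \<otimes> j = j" using j idempotent_index by auto
    then have "j \<in> absorbs G j" using jc by (simp add: absorbs_def)
    moreover have "g \<in> carrier G" "g divides j" "j divides g" using tok True by (auto simp: sys_tokens)
    moreover from this obtain s where "s \<in> carrier G" "g = j \<otimes> s" by (auto simp: factor_def)
    then have "j \<otimes> g = g" using jj jc by (metis m_assoc)
    ultimately show ?thesis using True absorbs_divides jc by (auto simp: theta_def)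
  next
    case False
    then have ij: "below prime_sys i j" using t by (auto simp: absorbed_def)
    have "g \<in> carrier (assoc_group G i)" using tok by (auto simp: tokens_def)
    then have "g \<in> absorbs G j" by (rule assoc_group_absorbs[OF ij])
    then show ?thesis using False jc by (auto simp: theta_def deg_def absorbs_carrier)
  qed
  then show "snd t \<in> absorbs G j" "theta prime_sys j t = j \<otimes> snd t" by auto
qed

lemma mprod_theta_sys:
  assumes j: "j \<in> rep ` primes" and \<Gamma>: "set_mset \<Gamma> \<subseteq> absorbed prime_sys j"
  shows "mprod (assoc_group G j) (theta prime_sys j) \<Gamma> = j \<otimes> mprod G snd \<Gamma>" "mprod G snd \<Gamma> \<in> absorbs G j"
proof -
  have jc: "j \<in> carrier G" using j by (rule index_carrier)
  interpret A: comm_group "assoc_group G j" by (rule comm_group_assoc_group) (rule jc)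
  have "mprod (assoc_group G j) (theta prime_sys j) \<Gamma> = j \<otimes> mprod G snd \<Gamma> \<and> mprod G snd \<Gamma> \<in> absorbs G j"
    using \<Gamma>
  proof (induction \<Gamma>)
    case (add t \<Gamma>)
    have t: "snd t \<in> absorbs G j" "theta prime_sys j t = j \<otimes> snd t" using theta_sys[OF j, of t] add.prems by auto
    with add jc show ?case by (simp add: grp_closed grp_mult absorbs_carrier absorbs_mult)
  qed (simp add: jc absorbs_one)
  then show "mprod (assoc_group G j) (theta prime_sys j) \<Gamma> = j \<otimes> mprod G snd \<Gamma>" "mprod G snd \<Gamma> \<in> absorbs G j" by auto
qed

lemma sys_rule_value:
  assumes "j \<in> rep ` primes" "y \<in> carrier (assoc_group G j)" "set_mset \<Gamma> \<subseteq> absorbed prime_sys j"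
  shows "y \<otimes>\<^bsub>assoc_group G j\<^esub> mprod (assoc_group G j) (theta prime_sys j) \<Gamma> = y \<otimes> mprod G snd \<Gamma>"
  using assms by (simp add: mprod_theta_sys assoc_group_mult index_carrier)

lemma tokens_snd: "snd \<in> tokens prime_sys \<rightarrow> carrier G"
  by (auto simp: sys_tokens)

lemma rewrite_value:
  assumes "rewrite (sys_rule prime_sys) \<alpha> \<beta>" "set_mset \<alpha> \<subseteq> tokens prime_sys"
  shows "mprod G snd \<alpha> = mprod G snd \<beta>"
proof -
  from assms(1) obtain t A \<Gamma> where R: "sys_rule prime_sys t A" and [simp]: "\<alpha> = add_mset t \<Gamma>" "\<beta> = A + \<Gamma>"
    by (auto elim: rewrite.cases)
  from R obtain j x y \<Delta> where t: "t = (j, x)" and A: "A = add_mset (j, y) \<Delta>" and j: "j \<in> index prime_sys" and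
    xy: "x \<in> carrier (grp prime_sys j)" "y \<in> carrier (grp prime_sys j)" and \<Delta>: "set_mset \<Delta> \<subseteq> absorbed prime_sys j"
    and x: "x = y \<otimes>\<^bsub>grp prime_sys j\<^esub> mprod (grp prime_sys j) (theta prime_sys j) \<Delta>"
    by (rule S.sys_ruleE)
  have "x = y \<otimes> mprod G snd \<Delta>" using x j xy \<Delta> by (simp add: sys_rule_value)
  moreover have "y \<in> carrier G" using xy assoc_groupD by auto
  moreover have "snd ` set_mset \<Delta> \<subseteq> carrier G" using \<Delta> S.absorbed_tokens[of j] tokens_snd by auto
  moreover have "snd ` set_mset \<Gamma> \<subseteq> carrier G" using assms(2) tokens_snd by auto
  ultimately show ?thesis using A t by (simp add: mprod_add m_assoc)
qed

lemma eqv_token: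
  assumes t: "t \<in> tokens prime_sys" and \<zeta>: "set_mset \<zeta> \<subseteq> tokens prime_sys" and eq: "snd t = mprod G snd \<zeta>"
  shows "conv (sys_rule prime_sys) {#t#} \<zeta>"
proof -
  obtain j x where [simp]: "t = (j, x)" by (cases t)
  have jI: "j \<in> rep ` primes" and x: "x \<in> carrier G" "x divides j" "j divides x" using t by (auto simp: sys_tokens)
  note jc = index_carrier[OF jI]
  have px: "Divisibility.prime G x"
    using prime_associated[OF _ jc x(1)] index_prime[OF jI] x by (auto simp: primes_def associated_def)
  have vc: "snd ` set_mset \<zeta> \<subseteq> carrier G" using \<zeta> tokens_snd by auto
  have "x divides mprod G snd \<zeta>" using eq x by simp
  then obtain s where s: "s \<in># \<zeta>" "x divides snd s" using prime_divides_mprod[OF px x(1) vc _ con] by blast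
  obtain k y where [simp]: "s = (k, y)" by (cases s)
  obtain \<Gamma> where \<Gamma>: "\<zeta> = add_mset s \<Gamma>" using s(1) by (metis multi_member_split)
  have kI: "k \<in> rep ` primes" and y: "y \<in> carrier G" "y divides k" "k divides y"
    using \<zeta> s by (auto simp: sys_tokens \<Gamma>)
  have dvd: "snd s' divides x" if "s' \<in># \<zeta>" for s' using mprod_divides[OF that vc] eq by simp
  have yx: "y divides x" "x divides y" using dvd[OF s(1)] s by auto
  have "k = j"
  proof -
    have "rep y = k" using rep_index[OF kI y(1)] y by (simp add: associated_def)
    moreover have "rep x = j" using rep_index[OF jI x(1)] x by (simp add: associated_def)
    moreover have "rep x = rep y" using rep_cong[OF x(1) y(1)] yx by (simp add: associated_def)
    ultimately show ?thesis by simp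
  qed
  have yj: "y \<in> carrier (assoc_group G j)"
    using y \<open>k = j\<close> by (auto simp: assoc_group_def associated_def)
  have xeq: "x = y \<otimes> mprod G snd \<Gamma>" using eq y by (simp add: \<Gamma>)
  have "set_mset \<Gamma> \<subseteq> absorbed prime_sys j"
  proof
    fix s' assume s': "s' \<in># \<Gamma>"
    obtain l z where [simp]: "s' = (l, z)" by (cases s')
    have tok: "(l, z) \<in> tokens prime_sys" using \<zeta> s' by (auto simp: \<Gamma>)
    then have lI: "l \<in> rep ` primes" and z: "z \<in> carrier G" "z divides l" "l divides z" by (auto simp: sys_tokens)
    note lc = index_carrier[OF lI]
    have "z divides x" using dvd[of s'] s' by (simp add: \<Gamma>)
    then have lj: "l divides j" using z x lc divides_trans by meson
    \<comment> \<open>Besides \<open>s\<close>, a second summand associated to \<open>j\<close> puts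
      j + j below x, hence below \<open>j\<close>, so that \<open>j\<close> is regular.\<close>
    have "j \<notin> free prime_sys" if "l = j"
    proof -
      obtain \<Delta> where \<Delta>: "\<Gamma> = add_mset s' \<Delta>" using s' by (metis multi_member_split)
      have "j \<otimes> j divides y \<otimes> z"
        using that z y \<open>k = j\<close> jc by (intro divides_trans[OF divides_mult_lI divides_mult_rI]) auto
      also have "y \<otimes> z divides x"
        using y z unfolding xeq \<Delta> by (simp add: m_assoc[symmetric] divides_mult_left)
      also have "x divides j" by (rule x)
      finally show ?thesis using jc by simp
    qed
    then show "s' \<in> absorbed prime_sys j" using tok lj jI lI by (auto simp: absorbed_def below_sys)
  qed
  then have "sys_rule prime_sys (j, x) (add_mset (j, y) \<Gamma>)"
    using jI yj xeq by (intro S.sys_ruleI) (auto simp: sys_rule_value)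
  then show ?thesis using \<open>k = j\<close> by (auto simp: \<Gamma> intro: S.eqv_rule)
qed

lemma token_decomposition:
  assumes "x \<in> carrier G" shows "\<exists>\<alpha>. set_mset \<alpha> \<subseteq> tokens prime_sys \<and> x = mprod G snd \<alpha>"
proof -
  obtain \<alpha> where \<alpha>: "set_mset \<alpha> \<subseteq> primes" "x = mprod G (\<lambda>x. x) \<alpha>" by (rule prime_decomposition[OF assms])
  have "mprod G snd (image_mset (\<lambda>p. (rep p, p)) \<alpha>) = mprod G (\<lambda>x. x) \<alpha>"
    using \<alpha>(1) by (induction \<alpha>) (auto simp: primes_carrier)
  moreover have "(rep p, p) \<in> tokens prime_sys" if "p \<in> primes" for p
    using that rep[OF primes_carrier[OF that]] by (auto simp: sys_tokens associated_def primes_carrier)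
  ultimately show ?thesis using \<alpha> by (intro exI[of _ "image_mset (\<lambda>p. (rep p, p)) \<alpha>"]) auto
qed

theorem presented_monoid_sys: "presented_monoid G (tokens prime_sys) (sys_rule prime_sys) (mprod G snd)"
proof unfold_locales
  show "\<And>t A. sys_rule prime_sys t A \<Longrightarrow> t \<in> tokens prime_sys \<and> set_mset A \<subseteq> tokens prime_sys" by (rule S.sys_rule_closed)
  show "confluentp (rewrite (sys_rule prime_sys))" by (rule S.sys_confluent)
  show "mprod G snd ` {\<alpha>. set_mset \<alpha> \<subseteq> tokens prime_sys} = carrier G" using token_decomposition by (auto simp: image_iff)
  show "mprod G snd {#} = \<one>" by simp
  show "mprod G snd (\<alpha> + \<beta>) = mprod G snd \<alpha> \<otimes> mprod G snd \<beta>"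
    if "set_mset \<alpha> \<subseteq> tokens prime_sys" "set_mset \<beta> \<subseteq> tokens prime_sys" for \<alpha> \<beta>
    using that tokens_snd by (intro mprod_add) auto
  show "mprod G snd \<alpha> = mprod G snd \<beta> \<longleftrightarrow> conv (sys_rule prime_sys) \<alpha> \<beta>"
    if T: "set_mset \<alpha> \<subseteq> tokens prime_sys" "set_mset \<beta> \<subseteq> tokens prime_sys" for \<alpha> \<beta>
  proof
    assume "mprod G snd \<alpha> = mprod G snd \<beta>"
    then show "conv (sys_rule prime_sys) \<alpha> \<beta>"
      using T
      by (rule_tac refinement_mprod[OF ref con tokens_snd, where E = "conv (sys_rule prime_sys)"])
        (simp_all add: token_decomposition conv_add_right eqv_token)
  next
    assume "conv (sys_rule prime_sys) \<alpha> \<beta>"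
    then have "set_mset \<beta> \<subseteq> tokens prime_sys \<and> mprod G snd \<alpha> = mprod G snd \<beta>"
    proof (induction rule: equivclp_induct)
      case (step \<beta> \<gamma>)
      have "set_mset \<gamma> \<subseteq> tokens prime_sys" using step S.rewrite_tokens by blast
      with step show ?case using rewrite_value by metis
    qed (use T in simp)
    then show "mprod G snd \<alpha> = mprod G snd \<beta>" ..
  qed
qed

theorem iso_monoid_of_sys: "G \<cong> monoid_of prime_sys"
  by (rule presented_monoid_iso[OF presented_monoid_sys S.presented_monoid_of])

end

section \<open>Tameness\<close>

text \<open>Induction on \<open>S\<close>: erase one letter x and take a finite basis of the
  projections. It serves all multisets with at least as many copies of x as occur in its members;
  each of the finitely many smaller numbers of copies gets a basis of its own.\<close>

lemma dickson:
  assumes "finite S"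
  shows "A \<subseteq> {\<alpha>. set_mset \<alpha> \<subseteq> S} \<Longrightarrow> \<exists>D\<subseteq>A. finite D \<and> (\<forall>\<alpha>\<in>A. \<exists>\<delta>\<in>D. \<delta> \<subseteq># \<alpha>)"
  using assms
proof (induction S arbitrary: A rule: finite_induct)
  case empty
  then have "A \<subseteq> {{#}}" by auto
  then show ?case by (intro exI[of _ A]) (auto intro: finite_subset)
next
  case (insert x S)
  define p where "p = (\<lambda>\<alpha>. filter_mset (\<lambda>y. y \<noteq> x) \<alpha>)"
  have basis: "\<exists>D\<subseteq>B. finite D \<and> (\<forall>\<alpha>\<in>B. \<exists>\<delta>\<in>D. p \<delta> \<subseteq># p \<alpha>)" if "B \<subseteq> A" for B
  proof -
    have "set_mset (p \<alpha>) \<subseteq> S" if "\<alpha> \<in> B" for \<alpha>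
      using subsetD[OF insert.prems, of \<alpha>] that \<open>B \<subseteq> A\<close> by (auto simp: p_def)
    then have "p ` B \<subseteq> {\<alpha>. set_mset \<alpha> \<subseteq> S}" by auto
    from insert.IH[OF this] obtain D where D: "D \<subseteq> p ` B" "finite D" "\<forall>\<alpha>\<in>p ` B. \<exists>\<delta>\<in>D. \<delta> \<subseteq># \<alpha>" by blast
    from D(1,2) obtain D' where "D' \<subseteq> B" "finite D'" "D = p ` D'" by (meson finite_subset_image)
    with D(3) show ?thesis by auto
  qed
  have sub: "\<delta> \<subseteq># \<alpha>" if "p \<delta> \<subseteq># p \<alpha>" "count \<delta> x \<le> count \<alpha> x" for \<alpha> \<delta>
  proof (rule mset_subset_eqI)
    fix y show "count \<delta> y \<le> count \<alpha> y"
      using that(2) mset_subset_eq_count[OF that(1), of y] by (cases "y = x") (auto simp: p_def)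
  qed
  obtain D where D: "D \<subseteq> A" "finite D" "\<forall>\<alpha>\<in>A. \<exists>\<delta>\<in>D. p \<delta> \<subseteq># p \<alpha>" using basis[of A] by blast
  define n where "n = Max (insert 0 ((\<lambda>\<delta>. count \<delta> x) ` D))"
  have n: "count \<delta> x \<le> n" if "\<delta> \<in> D" for \<delta> using that D(2) by (auto simp: n_def intro!: Max_ge)
  have "\<exists>D\<subseteq>{\<alpha> \<in> A. count \<alpha> x = k}. finite D \<and> (\<forall>\<alpha>\<in>{\<alpha> \<in> A. count \<alpha> x = k}. \<exists>\<delta>\<in>D. p \<delta> \<subseteq># p \<alpha>)" for k
    by (rule basis) auto
  then obtain C where C: "C k \<subseteq> {\<alpha> \<in> A. count \<alpha> x = k} \<and> finite (C k) \<and>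
    (\<forall>\<alpha>\<in>{\<alpha> \<in> A. count \<alpha> x = k}. \<exists>\<delta>\<in>C k. p \<delta> \<subseteq># p \<alpha>)" for k
    using choice[of "\<lambda>k D. D \<subseteq> {\<alpha> \<in> A. count \<alpha> x = k} \<and> finite D \<and>
      (\<forall>\<alpha>\<in>{\<alpha> \<in> A. count \<alpha> x = k}. \<exists>\<delta>\<in>D. p \<delta> \<subseteq># p \<alpha>)"] by presburger
  have "\<exists>\<delta>\<in>D \<union> (\<Union>k<n. C k). \<delta> \<subseteq># \<alpha>" if \<alpha>: "\<alpha> \<in> A" for \<alpha>
  proof (cases "count \<alpha> x < n")
    case True
    obtain \<delta> where "\<delta> \<in> C (count \<alpha> x)" "p \<delta> \<subseteq># p \<alpha>" using C[of "count \<alpha> x"] \<alpha> by blast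
    moreover from this C[of "count \<alpha> x"] have "count \<delta> x = count \<alpha> x" by blast
    ultimately show ?thesis using True sub[of \<delta> \<alpha>] by (metis UnI2 UN_I lessThan_iff order_refl)
  next
    case False
    obtain \<delta> where "\<delta> \<in> D" "p \<delta> \<subseteq># p \<alpha>" using bspec[OF D(3) \<alpha>] by blast
    moreover have "count \<delta> x \<le> count \<alpha> x" using n[OF \<open>\<delta> \<in> D\<close>] False by linarith
    ultimately show ?thesis using sub by blast
  qed
  moreover have "D \<union> (\<Union>k<n. C k) \<subseteq> A" using D(1) C by blast
  moreover have "finite (D \<union> (\<Union>k<n. C k))" using D(2) C by simp
  ultimately show ?case by blast
qed

text \<open>
  The pairs in \<open>B\<close> rewrite the minimal multisets that are not least in their class; the wellorder on
  multisets of natural numbers makes this terminate.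
\<close>

lemma redei:
  fixes S :: "nat set"
  assumes S: "finite S" and E: "equivp E"
    and E_add: "\<And>\<alpha> \<beta> \<gamma>. set_mset \<alpha> \<subseteq> S \<Longrightarrow> set_mset \<beta> \<subseteq> S \<Longrightarrow> set_mset \<gamma> \<subseteq> S \<Longrightarrow> E \<alpha> \<beta> \<Longrightarrow> E (\<alpha> + \<gamma>) (\<beta> + \<gamma>)"
  shows "\<exists>B. finite B \<and> (\<forall>(\<alpha>, \<beta>)\<in>B. E \<alpha> \<beta> \<and> set_mset \<alpha> \<subseteq> S \<and> set_mset \<beta> \<subseteq> S) \<and>
    (\<forall>F. equivp F \<longrightarrow> (\<forall>\<alpha> \<beta> \<gamma>. F \<alpha> \<beta> \<longrightarrow> F (\<alpha> + \<gamma>) (\<beta> + \<gamma>)) \<longrightarrow> (\<forall>(\<alpha>, \<beta>)\<in>B. F \<alpha> \<beta>) \<longrightarrow>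
      (\<forall>\<alpha> \<beta>. set_mset \<alpha> \<subseteq> S \<longrightarrow> set_mset \<beta> \<subseteq> S \<longrightarrow> E \<alpha> \<beta> \<longrightarrow> F \<alpha> \<beta>))"
proof -
  define W where "W = {\<alpha>. set_mset \<alpha> \<subseteq> S}"
  \<comment> \<open>These words are not least in their class. By Dickson's lemma some finite
    \<open>D\<close> lies below all of them, and \<open>d\<close> picks a smaller equivalent word
    for each member of \<open>D\<close>.\<close>
  define L where "L = {\<alpha> \<in> W. \<exists>\<beta>\<in>W. E \<alpha> \<beta> \<and> \<beta> < \<alpha>}"
  have "L \<subseteq> {\<alpha>. set_mset \<alpha> \<subseteq> S}" by (auto simp: L_def W_def)
  from dickson[OF S this] obtain D where D: "D \<subseteq> L" "finite D" "\<forall>\<alpha>\<in>L. \<exists>\<delta>\<in>D. \<delta> \<subseteq># \<alpha>" by blast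
  have "\<forall>\<alpha>\<in>D. \<exists>\<beta>. \<beta> \<in> W \<and> E \<alpha> \<beta> \<and> \<beta> < \<alpha>" using D(1) by (auto simp: L_def)
  then obtain d where d: "\<And>\<alpha>. \<alpha> \<in> D \<Longrightarrow> d \<alpha> \<in> W \<and> E \<alpha> (d \<alpha>) \<and> d \<alpha> < \<alpha>" by metis
  show ?thesis
  proof (intro exI[of _ "(\<lambda>\<alpha>. (\<alpha>, d \<alpha>)) ` D"] conjI allI impI)
    show "finite ((\<lambda>\<alpha>. (\<alpha>, d \<alpha>)) ` D)" using D(2) by simp
    show "\<forall>(\<alpha>, \<beta>)\<in>(\<lambda>\<alpha>. (\<alpha>, d \<alpha>)) ` D. E \<alpha> \<beta> \<and> set_mset \<alpha> \<subseteq> S \<and> set_mset \<beta> \<subseteq> S"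
      using d D(1) by (auto simp: L_def W_def)
    fix F :: "nat multiset \<Rightarrow> nat multiset \<Rightarrow> bool" and \<alpha> \<beta>
    assume F: "equivp F" and F_add: "\<forall>\<alpha> \<beta> \<gamma>. F \<alpha> \<beta> \<longrightarrow> F (\<alpha> + \<gamma>) (\<beta> + \<gamma>)"
      and FB: "\<forall>(\<alpha>, \<beta>)\<in>(\<lambda>\<alpha>. (\<alpha>, d \<alpha>)) ` D. F \<alpha> \<beta>"
      and W: "set_mset \<alpha> \<subseteq> S" "set_mset \<beta> \<subseteq> S" and "E \<alpha> \<beta>"
    \<comment> \<open>Replacing a part \<delta> in \<open>D\<close> by \<open>d \<delta>\<close>
      makes the word smaller in the wellorder, so the process ends in a word that is least in its
      class. Every replacement is a relation of both \<open>E\<close> and \<open>F\<close>.\<close>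
    have nf: "\<exists>\<nu>\<in>W - L. E \<alpha> \<nu> \<and> F \<alpha> \<nu>" if "\<alpha> \<in> W" for \<alpha>
      using that
    proof (induction \<alpha> rule: less_induct)
      case (less \<alpha>)
      show ?case
      proof (cases "\<alpha> \<in> L")
        case False
        then show ?thesis using less.prems E F by (meson DiffI equivp_reflp)
      next
        case True
        then obtain \<delta> where \<delta>: "\<delta> \<in> D" "\<delta> \<subseteq># \<alpha>" using D(3) by blast
        then obtain \<gamma> where \<gamma>: "\<alpha> = \<delta> + \<gamma>" by (metis subset_mset.le_iff_add)
        note d = d[OF \<delta>(1)]
        have in_W: "set_mset \<delta> \<subseteq> S" "set_mset \<gamma> \<subseteq> S" "d \<delta> + \<gamma> \<in> W" using less.prems d by (auto simp: \<gamma> W_def)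
        have "E \<alpha> (d \<delta> + \<gamma>)" unfolding \<gamma> using d in_W by (intro E_add) (auto simp: W_def)
        moreover have "F \<alpha> (d \<delta> + \<gamma>)" unfolding \<gamma> using \<delta> F_add FB by blast
        moreover have "d \<delta> + \<gamma> < \<alpha>" unfolding \<gamma> using d by (intro add_strict_right_mono) auto
        moreover obtain \<nu> where "\<nu> \<in> W - L" "E (d \<delta> + \<gamma>) \<nu>" "F (d \<delta> + \<gamma>) \<nu>"
          using less.IH[OF \<open>d \<delta> + \<gamma> < \<alpha>\<close> in_W(3)] by blast
        ultimately show ?thesis using equivp_transp[OF E] equivp_transp[OF F] by blast
      qed
    qed
    obtain \<mu> \<nu> where *: "\<mu> \<in> W - L" "E \<alpha> \<mu>" "F \<alpha> \<mu>" "\<nu> \<in> W - L" "E \<beta> \<nu>" "F \<beta> \<nu>"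
      using nf[of \<alpha>] nf[of \<beta>] W by (auto simp: W_def)
    have "E \<mu> \<nu>"
      using equivp_transp[OF E equivp_symp[OF E *(2)] equivp_transp[OF E \<open>E \<alpha> \<beta>\<close> *(5)]] .
    moreover from this have "E \<nu> \<mu>" by (rule equivp_symp[OF E])
    ultimately have "E \<mu> \<nu>" "E \<nu> \<mu>" by simp_all
    with * have "\<not> \<mu> < \<nu>" "\<not> \<nu> < \<mu>" by (auto simp: L_def)
    then have "\<mu> = \<nu>" by simp
    then show "F \<alpha> \<beta>" using equivp_transp[OF F *(3) equivp_symp[OF F]] *(6) by simp
  qed
qed

lemma finite_sums_mono: "S \<subseteq> T \<Longrightarrow> finite_sums M S \<subseteq> finite_sums M T"
  unfolding finite_sums_def by blast

lemma finite_sums_finite: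
  assumes "x \<in> finite_sums M P"
  obtains S where "finite S" "S \<subseteq> P" "x \<in> finite_sums M S"
proof -
  obtain xs where xs: "x = foldr (\<otimes>\<^bsub>M\<^esub>) xs \<one>\<^bsub>M\<^esub>" "set xs \<subseteq> P" using assms unfolding finite_sums_def by blast
  then have "x \<in> finite_sums M (set xs)" unfolding finite_sums_def by blast
  then show thesis using that[of "set xs"] xs(2) by simp
qed

text \<open>
  The indices carry a level, increased at every step, since the system must not have a last index:
  \<open>g\<close> need not be injective.
\<close>

lemma tameI:
  fixes M :: "('a, 'b) monoid_scheme"
  assumes ref: "refinement_monoid M" and P: "P \<subseteq> carrier M" "carrier M \<subseteq> finite_sums M P"
    and retract: "\<And>S. finite S \<Longrightarrow> S \<subseteq> P \<Longrightarrow> \<exists>T (N :: nat monoid) g h.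
      finite T \<and> S \<subseteq> T \<and> T \<subseteq> P \<and> finitely_generated_monoid N \<and> refinement_monoid N \<and>
      g \<in> hom N M \<and> g \<one>\<^bsub>N\<^esub> = \<one>\<^bsub>M\<^esub> \<and> g ` carrier N \<subseteq> finite_sums M T \<and>
      h ` finite_sums M S \<subseteq> carrier N \<and> h \<one>\<^bsub>M\<^esub> = \<one>\<^bsub>N\<^esub> \<and>
      (\<forall>x\<in>finite_sums M S. \<forall>y\<in>finite_sums M S. h (x \<otimes>\<^bsub>M\<^esub> y) = h x \<otimes>\<^bsub>N\<^esub> h y) \<and>
      (\<forall>x\<in>finite_sums M S. g (h x) = x)"
  shows "tame M"
proof -
  interpret M: comm_monoid M using ref by (simp add: refinement_monoid_def)
  let ?A = "finite_sums M"
  define Q where "Q S = (\<lambda>(T, N :: nat monoid, g, h). finite T \<and> S \<subseteq> T \<and> T \<subseteq> P \<and>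
      finitely_generated_monoid N \<and> refinement_monoid N \<and>
      g \<in> hom N M \<and> g \<one>\<^bsub>N\<^esub> = \<one>\<^bsub>M\<^esub> \<and> g ` carrier N \<subseteq> ?A T \<and>
      h ` ?A S \<subseteq> carrier N \<and> h \<one>\<^bsub>M\<^esub> = \<one>\<^bsub>N\<^esub> \<and>
      (\<forall>x\<in>?A S. \<forall>y\<in>?A S. h (x \<otimes>\<^bsub>M\<^esub> y) = h x \<otimes>\<^bsub>N\<^esub> h y) \<and> (\<forall>x\<in>?A S. g (h x) = x))" for S
  define z where "z S = (SOME z. Q S z)" for S
  define T N g h where "T S = fst (z S)" and "N S = fst (snd (z S))"
    and "g S = fst (snd (snd (z S)))" and "h S = snd (snd (snd (z S)))" for S
  have Q: "Q S (T S, N S, g S, h S)" if S: "finite S" "S \<subseteq> P" for S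
  proof -
    obtain T N g h where "Q S (T, N, g, h)" using retract[OF S] unfolding Q_def by auto
    then have "Q S (z S)" unfolding z_def by (rule someI)
    then show ?thesis by (simp add: T_def N_def g_def h_def)
  qed
  have T: "finite (T S) \<and> S \<subseteq> T S \<and> T S \<subseteq> P"
    and N: "finitely_generated_monoid (N S) \<and> refinement_monoid (N S)"
    and g: "g S \<in> hom (N S) M \<and> g S \<one>\<^bsub>N S\<^esub> = \<one>\<^bsub>M\<^esub> \<and> g S ` carrier (N S) \<subseteq> ?A (T S)"
    and h: "h S ` ?A S \<subseteq> carrier (N S) \<and> h S \<one>\<^bsub>M\<^esub> = \<one>\<^bsub>N S\<^esub> \<and>
      (\<forall>x\<in>?A S. \<forall>y\<in>?A S. h S (x \<otimes>\<^bsub>M\<^esub> y) = h S x \<otimes>\<^bsub>N S\<^esub> h S y) \<and> (\<forall>x\<in>?A S. g S (h S x) = x)"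
    if S: "finite S" "S \<subseteq> P" for S
    using Q[OF S] unfolding Q_def by simp_all
  define X where "X = {S. finite S \<and> S \<subseteq> P} \<times> (UNIV :: nat set)"
  \<comment> \<open>Singleton lists record \<open>S\<close>. The remaining list records the level n;
    its length n + 2 keeps it apart from the singletons.\<close>
  define enc :: "'a set \<times> nat \<Rightarrow> 'a list set" where
    "enc = (\<lambda>(S, n). (\<lambda>x. [x]) ` S \<union> {replicate (n + 2) undefined})"
  have enc_inj: "inj_on enc X"
  proof (rule inj_onI)
    fix x y assume "enc x = enc y"
    obtain S n S' n' where [simp]: "x = (S, n)" "y = (S', n')" by (cases x; cases y)
    have eq: "enc (S, n) = enc (S', n')" using \<open>enc x = enc y\<close> by simp
    have "x \<in> S \<longleftrightarrow> [x] \<in> enc (S, n)" for x and S :: "'a set" and n by (auto simp: enc_def)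
    from this[of _ S n] this[of _ S' n'] have "S = S'" by (auto simp: eq)
    have len: "n = n'" if "replicate (n + 2) undefined \<in> enc (S', n')" for n n' and S' :: "'a set"
    proof -
      have "length (replicate (n + 2) undefined :: 'a list) \<in> length ` enc (S', n')" using that by (rule imageI)
      then show ?thesis by (auto simp: enc_def)
    qed
    have "replicate (n + 2) undefined \<in> enc (S, n)" by (simp add: enc_def)
    then have "n = n'" using len[of n S' n'] eq by simp
    with \<open>S = S'\<close> show "x = y" by simp
  qed
  define dec where "dec = inv_into X enc"
  have dec: "dec (enc x) = x" if "x \<in> X" for x using that enc_inj by (simp add: dec_def inv_into_f_f)
  define L where "L = enc ` X"
  define src where "src U = fst (dec U)" for U
  have dec_L: "dec U \<in> X \<and> enc (dec U) = U" if "U \<in> L" for U using that dec by (auto simp: L_def)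
  have src: "finite (src U)" "src U \<subseteq> P" if "U \<in> L" for U
    using dec_L[OF that] by (auto simp: X_def src_def)
  \<comment> \<open>Below strictly means that the values of stage \<open>U\<close> lie where
    \<open>h\<close> of stage \<open>V\<close> is defined. The increasing level gives
    antisymmetry.\<close>
  define r where "r = {(U, V) \<in> L \<times> L. U = V \<or> T (src U) \<subseteq> src V \<and> snd (dec U) < snd (dec V)}"
  define N' where "N' U = N (src U)" for U
  define g' where "g' U = g (src U)" for U
  \<comment> \<open>Transition maps pass through \<open>M\<close>: evaluate by \<open>g\<close>,
    then lift by \<open>h\<close>. They preserve values, so composites agree. The diagonal is
    treated apart, since lifting the value need not give back the element.\<close>
  define f where "f U V = (if U = V then (\<lambda>m. m) else (\<lambda>m. h (src V) (g (src U) m)))" for U V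
  have TP: "src U \<subseteq> T (src U)" "T (src U) \<subseteq> P" "finite (T (src U))" if "U \<in> L" for U using T src[OF that] by auto
  have N'cm: "comm_monoid (N' U)" if "U \<in> L" for U
    using N src[OF that] by (simp add: N'_def refinement_monoid_def)
  have g'_hom: "g' U \<in> hom (N' U) M" "g' U \<one>\<^bsub>N' U\<^esub> = \<one>\<^bsub>M\<^esub>" if "U \<in> L" for U
    using g src[OF that] by (auto simp: g'_def N'_def)
  have g_A: "g' U m \<in> ?A (src V)" if "(U, V) \<in> r" "U \<noteq> V" "m \<in> carrier (N' U)" for U V m
  proof -
    have "U \<in> L" "T (src U) \<subseteq> src V" using that by (auto simp: r_def)
    then have "g (src U) m \<in> ?A (T (src U))" using g src[of U] that(3) by (auto simp: N'_def)
    then show ?thesis using finite_sums_mono[OF \<open>T (src U) \<subseteq> src V\<close>] by (auto simp: g'_def)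
  qed
  have f_eq: "f U V m = h (src V) (g' U m)" if "U \<noteq> V" for U V m using that by (simp add: f_def g'_def)
  have hA: "h (src V) x \<in> carrier (N' V)" "g' V (h (src V) x) = x" if "V \<in> L" "x \<in> ?A (src V)" for V x
    using h[OF src[OF that(1)]] that(2) by (auto simp: N'_def g'_def)
  have rL: "U \<in> L" "V \<in> L" if "(U, V) \<in> r" for U V using that by (auto simp: r_def)
  have f_closed: "f U V m \<in> carrier (N' V)" if "(U, V) \<in> r" "m \<in> carrier (N' U)" for U V m
    using that hA[OF rL(2)[OF that(1)] g_A] by (cases "U = V") (auto simp: f_eq, simp add: f_def)
  have g'_f: "g' V (f U V m) = g' U m" if "(U, V) \<in> r" "m \<in> carrier (N' U)" for U V m
    using that hA[OF rL(2)[OF that(1)] g_A] by (cases "U = V") (auto simp: f_eq, simp add: f_def)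
  have upper: "\<exists>V. (U, V) \<in> r \<and> (U', V) \<in> r \<and> U \<noteq> V \<and> U' \<noteq> V" if "U \<in> L" "U' \<in> L" for U U'
  proof -
    let ?x = "(T (src U) \<union> T (src U'), Suc (max (snd (dec U)) (snd (dec U'))))"
    have "?x \<in> X" using TP[OF that(1)] TP[OF that(2)] by (auto simp: X_def)
    then have "enc ?x \<in> L" "dec (enc ?x) = ?x" using dec by (auto simp: L_def)
    then obtain V where V: "V \<in> L" "dec V = ?x" by blast
    then have "snd (dec U) < snd (dec V)" "snd (dec U') < snd (dec V)" by auto
    moreover from this have "U \<noteq> V" "U' \<noteq> V" by auto
    moreover have "T (src U) \<subseteq> src V" "T (src U') \<subseteq> src V" using V by (auto simp: src_def)
    ultimately have "(U, V) \<in> r" "(U', V) \<in> r" "U \<noteq> V" "U' \<noteq> V"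
      using that V(1) by (simp_all add: r_def)
    then show ?thesis by blast
  qed
  have r_refl: "(U, U) \<in> r" if "U \<in> L" for U using that by (simp add: r_def)
  have r_trans: "(U, W) \<in> r" if "(U, V) \<in> r" "(V, W) \<in> r" for U V W
    using that TP(1)[OF rL(1)[OF that(2)]] unfolding r_def by auto
  have po: "partial_order_on L r"
    unfolding partial_order_on_def preorder_on_def
    using r_refl r_trans by (auto simp: refl_on_def intro!: transI antisymI) (auto simp: r_def)
  have fhom: "f U V \<in> hom (N' U) (N' V) \<and> f U V \<one>\<^bsub>N' U\<^esub> = \<one>\<^bsub>N' V\<^esub>" if UV: "(U, V) \<in> r" for U V
  proof (cases "U = V")
    case True
    then show ?thesis by (auto simp: f_def hom_def)
  next
    case False
    note L = rL[OF UV]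
    have "h (src V) (x \<otimes>\<^bsub>M\<^esub> y) = h (src V) x \<otimes>\<^bsub>N' V\<^esub> h (src V) y"
      if "x \<in> ?A (src V)" "y \<in> ?A (src V)" for x y
      using h src[OF L(2)] that by (auto simp: N'_def)
    then have "f U V \<in> hom (N' U) (N' V)"
      using f_closed[OF UV] g_A[OF UV False] hom_mult[OF g'_hom(1)[OF L(1)]]
      by (intro homI) (auto simp: f_eq[OF False])
    moreover have "f U V \<one>\<^bsub>N' U\<^esub> = \<one>\<^bsub>N' V\<^esub>"
      using g'_hom(2)[OF L(1)] h src[OF L(2)] by (simp add: f_eq[OF False] N'_def)
    ultimately show ?thesis ..
  qed
  have fcomp: "f U W m = f V W (f U V m)"
    if UV: "(U, V) \<in> r" and VW: "(V, W) \<in> r" and m: "m \<in> carrier (N' U)" for U V W m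
  proof (cases "U = V \<or> V = W")
    case True
    then show ?thesis by (auto simp: f_def)
  next
    case False
    then have "U \<noteq> W" using UV VW by (auto simp: r_def)
    then show ?thesis using False g'_f[OF UV m] by (simp add: f_eq)
  qed
  have ds: "direct_system L r N' f"
    unfolding direct_system_def
  proof (intro conjI po)
    show "L \<noteq> {}" by (auto simp: L_def X_def)
    show "\<forall>i\<in>L. \<forall>j\<in>L. \<exists>k\<in>L. (i, k) \<in> r \<and> (j, k) \<in> r" using upper rL(2) by blast
    show "\<forall>i\<in>L. comm_monoid (N' i)" using N'cm by blast
    show "\<forall>(i, j)\<in>r. f i j \<in> hom (N' i) (N' j) \<and> f i j \<one>\<^bsub>N' i\<^esub> = \<one>\<^bsub>N' j\<^esub>" using fhom by blast
    show "\<forall>i\<in>L. \<forall>x\<in>carrier (N' i). f i i x = x" by (simp add: f_def)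
    show "\<forall>i j k. (i, j) \<in> r \<longrightarrow> (j, k) \<in> r \<longrightarrow> (\<forall>x\<in>carrier (N' i). f i k x = f j k (f i j x))"
      using fcomp by blast
  qed
  define R where "R = direct_limit_rel L r N' f"
  \<comment> \<open>Elements with the same value become equal at every strictly later stage, since
    there the transition maps depend on the value only.\<close>
  have R_iff: "((U, m), (V, n)) \<in> R \<longleftrightarrow> U \<in> L \<and> V \<in> L \<and> m \<in> carrier (N' U) \<and> n \<in> carrier (N' V) \<and> g' U m = g' V n"
    for U m V n
  proof
    assume "((U, m), (V, n)) \<in> R"
    then obtain W where *: "U \<in> L" "V \<in> L" "m \<in> carrier (N' U)" "n \<in> carrier (N' V)"
      "(U, W) \<in> r" "(V, W) \<in> r" "f U W m = f V W n"
      unfolding R_def direct_limit_rel_def by auto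
    then show "U \<in> L \<and> V \<in> L \<and> m \<in> carrier (N' U) \<and> n \<in> carrier (N' V) \<and> g' U m = g' V n"
      using g'_f[of U W m] g'_f[of V W n] by simp
  next
    assume *: "U \<in> L \<and> V \<in> L \<and> m \<in> carrier (N' U) \<and> n \<in> carrier (N' V) \<and> g' U m = g' V n"
    then obtain W where W: "(U, W) \<in> r" "(V, W) \<in> r" "U \<noteq> W" "V \<noteq> W" using upper[of U V] by blast
    then have "f U W m = f V W n" using * by (simp add: f_eq)
    then show "((U, m), (V, n)) \<in> R" using * W rL(2)[OF W(1)] unfolding R_def direct_limit_rel_def by auto
  qed
  \<comment> \<open>The classes of the limit are the fibres of evaluation in
    \<open>M\<close>.\<close>
  define \<psi> where "\<psi> x = {(U, m). U \<in> L \<and> m \<in> carrier (N' U) \<and> g' U m = x}" for x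
  have R_class: "R `` {(U, m)} = \<psi> (g' U m)" if "U \<in> L" "m \<in> carrier (N' U)" for U m
    using that by (auto simp: \<psi>_def R_iff)
  have \<psi>_ne: "\<exists>U m. (U, m) \<in> \<psi> x" if "x \<in> carrier M" for x
  proof -
    from that P obtain S where S: "finite S" "S \<subseteq> P" "x \<in> ?A S" using finite_sums_finite by (metis subsetD)
    then have "(S, 0) \<in> X" by (simp add: X_def)
    then have *: "enc (S, 0) \<in> L" "src (enc (S, 0)) = S" using dec by (auto simp: L_def src_def)
    then have "(enc (S, 0), h S x) \<in> \<psi> x" using hA[OF *(1), of x] S by (auto simp: \<psi>_def)
    then show ?thesis by blast
  qed
  let ?D = "direct_limit L r N' f"
  have carr: "carrier ?D = \<psi> ` carrier M"
  proof -
    have "carrier ?D = (\<lambda>(U, m). \<psi> (g' U m)) ` (SIGMA U:L. carrier (N' U))"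
      unfolding direct_limit_def quotient_def R_def[symmetric] using R_class by auto
    also have "\<dots> = \<psi> ` carrier M"
    proof (intro equalityI subsetI)
      fix Y assume "Y \<in> \<psi> ` carrier M"
      then obtain x where x: "x \<in> carrier M" "Y = \<psi> x" by blast
      then obtain U m where "(U, m) \<in> \<psi> x" using \<psi>_ne by blast
      then show "Y \<in> (\<lambda>(U, m). \<psi> (g' U m)) ` (SIGMA U:L. carrier (N' U))"
        using x by (intro image_eqI[of _ _ "(U, m)"]) (auto simp: \<psi>_def)
    qed (use hom_in_carrier[OF g'_hom(1)] in auto)
    finally show ?thesis .
  qed
  have mult: "\<psi> x \<otimes>\<^bsub>?D\<^esub> \<psi> y = \<psi> (x \<otimes>\<^bsub>M\<^esub> y)" if xy: "x \<in> carrier M" "y \<in> carrier M" for x y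
  proof -
    let ?F = "{R `` {(W, f U W m \<otimes>\<^bsub>N' W\<^esub> f V W n)} | U m V n W.
        (U, m) \<in> \<psi> x \<and> (V, n) \<in> \<psi> y \<and> (U, W) \<in> r \<and> (V, W) \<in> r}"
    have *: "R `` {(W, f U W m \<otimes>\<^bsub>N' W\<^esub> f V W n)} = \<psi> (x \<otimes>\<^bsub>M\<^esub> y)"
      if "(U, m) \<in> \<psi> x" "(V, n) \<in> \<psi> y" "(U, W) \<in> r" "(V, W) \<in> r" for U m V n W
    proof -
      have W: "W \<in> L" using that rL by blast
      then interpret W: comm_monoid "N' W" by (rule N'cm)
      have m: "m \<in> carrier (N' U)" "g' U m = x" and n: "n \<in> carrier (N' V)" "g' V n = y"
        using that by (auto simp: \<psi>_def)
      have c: "f U W m \<in> carrier (N' W)" "f V W n \<in> carrier (N' W)" using that m n f_closed by auto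
      have "g' W (f U W m \<otimes>\<^bsub>N' W\<^esub> f V W n) = x \<otimes>\<^bsub>M\<^esub> y"
        using hom_mult[OF g'_hom(1)[OF W] c] g'_f that m n by simp
      then show ?thesis using R_class[OF W W.m_closed[OF c]] by simp
    qed
    obtain U m V n where UV: "(U, m) \<in> \<psi> x" "(V, n) \<in> \<psi> y" using \<psi>_ne xy by meson
    moreover obtain W where "(U, W) \<in> r" "(V, W) \<in> r" using UV upper[of U V] by (auto simp: \<psi>_def)
    ultimately have "\<psi> (x \<otimes>\<^bsub>M\<^esub> y) \<in> ?F" using * by blast
    moreover have "Y = \<psi> (x \<otimes>\<^bsub>M\<^esub> y)" if "Y \<in> ?F" for Y using that * by blast
    ultimately have "\<Union>?F = \<psi> (x \<otimes>\<^bsub>M\<^esub> y)" by blast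
    then show ?thesis by (simp add: direct_limit_def R_def)
  qed
  have "\<psi> \<in> iso M ?D"
    unfolding iso_iff
  proof (intro conjI)
    show "\<psi> \<in> hom M ?D" by (rule homI) (auto simp: carr mult)
    show "\<psi> ` carrier M = carrier ?D" by (simp add: carr)
    show "inj_on \<psi> (carrier M)"
    proof (rule inj_onI)
      fix x y assume x: "x \<in> carrier M" and "\<psi> x = \<psi> y"
      with \<psi>_ne[OF x] obtain U m where "(U, m) \<in> \<psi> x" "(U, m) \<in> \<psi> y" by auto
      then show "x = y" by (auto simp: \<psi>_def)
    qed
  qed
  then have "M \<cong> ?D" by (rule is_isoI)
  moreover have "finitely_generated_monoid (N' U) \<and> refinement_monoid (N' U)" if "U \<in> L" for U
    using N src[OF that] by (simp add: N'_def)
  ultimately show ?thesis unfolding tame_def using ref ds by blast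
qed

section \<open>Expansion rules over finite sets of primes, and tameness\<close>

context pg_monoid
begin

abbreviation val :: "'a multiset \<Rightarrow> 'a" where
  "val \<equiv> mprod G (\<lambda>x. x)"

lemma val_add: "set_mset \<alpha> \<subseteq> carrier G \<Longrightarrow> set_mset \<beta> \<subseteq> carrier G \<Longrightarrow> val (\<alpha> + \<beta>) = val \<alpha> \<otimes> val \<beta>"
  by (rule mprod_add) auto

lemma primes_subset: "primes \<subseteq> carrier G"
  using primes_carrier by blast

definition expansion :: "'a set \<Rightarrow> 'a \<Rightarrow> 'a multiset \<Rightarrow> bool" where
  "expansion T t A \<longleftrightarrow> t \<in> T \<and> (\<exists>\<Gamma>. set_mset \<Gamma> \<subseteq> T \<and> A = add_mset t \<Gamma> \<and> t \<otimes> val \<Gamma> = t)"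

lemma expansion_closed: "expansion T t A \<Longrightarrow> t \<in> T \<and> set_mset A \<subseteq> T"
  by (auto simp: expansion_def)

lemma expansion_mono: "expansion T t A \<Longrightarrow> T \<subseteq> T' \<Longrightarrow> expansion T' t A"
proof -
  assume "expansion T t A" "T \<subseteq> T'"
  then obtain \<Gamma> where "t \<in> T'" "set_mset \<Gamma> \<subseteq> T'" "A = add_mset t \<Gamma>" "t \<otimes> val \<Gamma> = t"
    by (auto simp: expansion_def)
  then show ?thesis unfolding expansion_def by blast
qed

lemma expansion_confluent: "confluentp (rewrite (expansion T))"
proof (rule confluent_rewrite)
  fix t A B assume "expansion T t A" "expansion T t B"
  then obtain \<Gamma> \<Delta> where *: "A = {#t#} + \<Gamma>" "B = {#t#} + \<Delta>" "expansion T t ({#t#} + \<Gamma>)" "expansion T t ({#t#} + \<Delta>)"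
    by (auto simp: expansion_def)
  have "rewrite (expansion T) A ({#t#} + \<Delta> + \<Gamma>)" unfolding *(1) by (intro rewrite_add rewrite_single *)
  moreover have "rewrite (expansion T) B ({#t#} + \<Gamma> + \<Delta>)" unfolding *(2) by (intro rewrite_add rewrite_single *)
  ultimately show "\<exists>D. (rewrite (expansion T))\<^sup>=\<^sup>= A D \<and> (rewrite (expansion T))\<^sup>=\<^sup>= B D"
    by (auto simp: ac_simps)
qed

lemma expansion_value:
  assumes "T \<subseteq> carrier G" "conv (expansion T) \<alpha> \<beta>" "set_mset \<alpha> \<subseteq> carrier G"
  shows "val \<alpha> = val \<beta>"
proof -
  have one_step: "(set_mset \<beta> \<subseteq> carrier G \<longleftrightarrow> set_mset \<gamma> \<subseteq> carrier G) \<and> (set_mset \<beta> \<subseteq> carrier G \<longrightarrow> val \<beta> = val \<gamma>)"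
    if "rewrite (expansion T) \<beta> \<gamma>" for \<beta> \<gamma>
  proof -
    from that obtain t \<Gamma> \<Delta> where *: "t \<in> T" "set_mset \<Gamma> \<subseteq> T" "t \<otimes> val \<Gamma> = t" "\<beta> = add_mset t \<Delta>" "\<gamma> = add_mset t \<Gamma> + \<Delta>"
      by (auto elim!: rewrite.cases simp: expansion_def)
    have c: "t \<in> carrier G" "set_mset \<Gamma> \<subseteq> carrier G" using * assms(1) by auto
    have "val \<gamma> = val \<beta>" if "set_mset \<Delta> \<subseteq> carrier G"
      using c that by (simp add: *(4,5) val_add m_assoc[symmetric] *(3))
    then show ?thesis using c by (auto simp: *(4,5))
  qed
  have "set_mset \<beta> \<subseteq> carrier G \<and> val \<alpha> = val \<beta>"
    using assms(2)
  proof (induction rule: equivclp_induct)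
    case (step \<beta> \<gamma>)
    then show ?case using one_step by metis
  qed (use assms in simp)
  then show ?thesis ..
qed

text \<open>The word \<epsilon> represents the inverse of j + a in the group of elements associated
  to \<open>j\<close>.\<close>

lemma ex_inverse:
  assumes "j \<in> carrier G" "a \<in> absorbs G j"
  obtains \<epsilon> where "set_mset \<epsilon> \<subseteq> primes" "j \<otimes> (a \<otimes> val \<epsilon>) = j"
proof -
  obtain c where c: "c \<in> carrier G" "j = j \<otimes> a \<otimes> c" using assms by (auto simp: absorbs_def factor_def)
  obtain \<epsilon> where "set_mset \<epsilon> \<subseteq> primes" "c = val \<epsilon>" by (rule prime_decomposition[OF c(1)])
  with c assms show thesis by (intro that[of \<epsilon>]) (simp_all add: m_assoc absorbs_carrier)
qed

text \<open>A word \<epsilon> with j + \<alpha> + \<epsilon> = j also satisfies j + \<beta> +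
  \<epsilon> = j. So on the left \<open>j\<close> can emit \<beta> + \<epsilon>, on the right
  \<alpha> + \<epsilon>, and the results agree.\<close>

lemma conv_expansion_add:
  assumes j: "j \<in> primes" and \<alpha>: "set_mset \<alpha> \<subseteq> primes" and \<beta>: "set_mset \<beta> \<subseteq> primes"
    and a: "val \<alpha> \<in> absorbs G j" and eq: "j \<otimes> val \<alpha> = j \<otimes> val \<beta>"
  shows "\<exists>T. finite T \<and> T \<subseteq> primes \<and> conv (expansion T) ({#j#} + \<alpha>) ({#j#} + \<beta>)"
proof -
  have jc: "j \<in> carrier G" and \<alpha>c: "set_mset \<alpha> \<subseteq> carrier G" and \<beta>c: "set_mset \<beta> \<subseteq> carrier G"
    using j \<alpha> \<beta> primes_subset by auto
  obtain \<epsilon> where \<epsilon>: "set_mset \<epsilon> \<subseteq> primes" "j \<otimes> (val \<alpha> \<otimes> val \<epsilon>) = j" by (rule ex_inverse[OF jc a])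
  have \<epsilon>c: "set_mset \<epsilon> \<subseteq> carrier G" using \<epsilon> primes_subset by auto
  define T where "T = insert j (set_mset \<alpha> \<union> set_mset \<beta> \<union> set_mset \<epsilon>)"
  have "j \<otimes> val (\<alpha> + \<epsilon>) = j" using \<epsilon> \<alpha>c \<epsilon>c by (simp add: val_add)
  moreover have "j \<otimes> val (\<beta> + \<epsilon>) = j"
  proof -
    have "j \<otimes> val (\<beta> + \<epsilon>) = j \<otimes> val \<beta> \<otimes> val \<epsilon>" using jc \<beta>c \<epsilon>c by (simp add: val_add m_assoc)
    also have "\<dots> = j" using \<epsilon>(2) jc by (simp add: eq[symmetric] m_assoc)
    finally show ?thesis .
  qed
  ultimately have "expansion T j ({#j#} + (\<alpha> + \<epsilon>))" "expansion T j ({#j#} + (\<beta> + \<epsilon>))"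
    by (auto simp: expansion_def T_def)
  then have "conv (expansion T) {#j#} ({#j#} + (\<alpha> + \<epsilon>))" "conv (expansion T) {#j#} ({#j#} + (\<beta> + \<epsilon>))"
    by (blast intro: rewrite_single)+
  then have "conv (expansion T) ({#j#} + \<beta>) ({#j#} + (\<alpha> + \<epsilon>) + \<beta>)" "conv (expansion T) ({#j#} + \<alpha>) ({#j#} + (\<beta> + \<epsilon>) + \<alpha>)"
    by (blast intro: conv_add_right)+
  moreover have "{#j#} + (\<alpha> + \<epsilon>) + \<beta> = {#j#} + (\<beta> + \<epsilon>) + \<alpha>" by (simp add: ac_simps)
  ultimately have "conv (expansion T) ({#j#} + \<alpha>) ({#j#} + \<beta>)" by (metis conv_trans equivclp_sym)
  moreover have "finite T" "T \<subseteq> primes" using j \<alpha> \<beta> \<epsilon> by (auto simp: T_def)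
  ultimately show ?thesis by blast
qed

text \<open>Choose \<epsilon> with p + p + \<epsilon> = p. Then p can emit k + \<delta> +
  \<epsilon>, as k + \<delta> has value p, and k, being p plus something, can emit p + \<epsilon>.
  Both words become p + k + \<delta> + \<epsilon>.\<close>

lemma conv_expansion_regular:
  assumes p: "p \<in> primes" "p \<otimes> p divides p" and k: "k \<in> primes" "p divides k" and \<delta>: "set_mset \<delta> \<subseteq> primes"
    and eq: "p = k \<otimes> val \<delta>"
  shows "\<exists>T. finite T \<and> T \<subseteq> primes \<and> conv (expansion T) {#p#} ({#k#} + \<delta>)"
proof -
  have pc: "p \<in> carrier G" and kc: "k \<in> carrier G" and \<delta>c: "set_mset \<delta> \<subseteq> carrier G"
    using p k \<delta> primes_subset by auto
  have "p \<in> absorbs G p" using p pc by (simp add: absorbs_def)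
  then obtain \<epsilon> where \<epsilon>: "set_mset \<epsilon> \<subseteq> primes" "p \<otimes> (p \<otimes> val \<epsilon>) = p" by (rule ex_inverse[OF pc])
  have \<epsilon>c: "set_mset \<epsilon> \<subseteq> carrier G" using \<epsilon> primes_subset by auto
  obtain s where s: "s \<in> carrier G" "k = p \<otimes> s" using k by (auto simp: factor_def)
  define T where "T = insert p (insert k (set_mset \<delta> \<union> set_mset \<epsilon>))"
  have "p \<otimes> val ({#k#} + \<delta> + \<epsilon>) = p \<otimes> (k \<otimes> val \<delta> \<otimes> val \<epsilon>)"
    using kc \<delta>c \<epsilon>c by (simp add: val_add m_assoc)
  also have "\<dots> = p" unfolding eq[symmetric] by (rule \<epsilon>(2))
  finally have "expansion T p ({#p#} + ({#k#} + \<delta> + \<epsilon>))" by (auto simp: expansion_def T_def)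
  then have 1: "conv (expansion T) {#p#} ({#p#} + ({#k#} + \<delta> + \<epsilon>))" by (blast intro: rewrite_single)
  have "k \<otimes> val ({#p#} + \<epsilon>) = (p \<otimes> (p \<otimes> val \<epsilon>)) \<otimes> s" using s pc by (simp add: m_ac)
  also have "\<dots> = k" by (simp add: \<epsilon>(2) s)
  finally have "expansion T k ({#k#} + ({#p#} + \<epsilon>))" using \<epsilon> by (auto simp: expansion_def T_def)
  then have "conv (expansion T) {#k#} ({#k#} + ({#p#} + \<epsilon>))" by (blast intro: rewrite_single)
  then have 2: "conv (expansion T) ({#k#} + \<delta>) ({#k#} + ({#p#} + \<epsilon>) + \<delta>)" by (rule conv_add_right)
  have "{#p#} + ({#k#} + \<delta> + \<epsilon>) = {#k#} + ({#p#} + \<epsilon>) + \<delta>" by (simp add: ac_simps)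
  with 1 2 have "conv (expansion T) {#p#} ({#k#} + \<delta>)" by (metis conv_trans equivclp_sym)
  moreover have "finite T" "T \<subseteq> primes" using p k \<delta> \<epsilon> by (auto simp: T_def)
  ultimately show ?thesis by blast
qed

text \<open>
  Distinct associated free primes are never related in the monoid presented by \<open>expansion T\<close>, so a
  free prime is first replaced by its representative and a sum of smaller primes.
\<close>

definition hat1 :: "'a \<Rightarrow> 'a multiset" where
  "hat1 p = (if p \<otimes> p divides p then {#p#} else
     {#rep p#} + (SOME \<alpha>. set_mset \<alpha> \<subseteq> primes \<and> p = rep p \<otimes> val \<alpha>))"

definition hat :: "'a multiset \<Rightarrow> 'a multiset" where
  "hat \<alpha> = (\<Sum>p\<in>#\<alpha>. hat1 p)"

lemma hat_simps [simp]: "hat {#} = {#}" "hat (add_mset p \<alpha>) = hat1 p + hat \<alpha>" "hat (\<alpha> + \<beta>) = hat \<alpha> + hat \<beta>"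
  by (simp_all add: hat_def)

lemma hat1_free:
  assumes p: "p \<in> primes" "\<not> p \<otimes> p divides p"
  obtains \<alpha> where "hat1 p = {#rep p#} + \<alpha>" "set_mset \<alpha> \<subseteq> primes" "p = rep p \<otimes> val \<alpha>"
proof -
  have pc: "p \<in> carrier G" using p primes_carrier by blast
  have "rep p divides p" using rep(2)[OF pc] by (simp add: associated_def)
  then obtain a where a: "a \<in> carrier G" "p = rep p \<otimes> a" by (auto simp: factor_def)
  obtain \<alpha> where "set_mset \<alpha> \<subseteq> primes" "a = val \<alpha>" by (rule prime_decomposition[OF a(1)])
  with a have "\<exists>\<alpha>. set_mset \<alpha> \<subseteq> primes \<and> p = rep p \<otimes> val \<alpha>" by blast
  from someI_ex[OF this] that p show thesis by (auto simp: hat1_def)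
qed

lemma hat1_closed: "p \<in> primes \<Longrightarrow> set_mset (hat1 p) \<subseteq> primes"
proof (cases "p \<otimes> p divides p")
  case False
  assume p: "p \<in> primes"
  obtain \<alpha> where "hat1 p = {#rep p#} + \<alpha>" "set_mset \<alpha> \<subseteq> primes" by (rule hat1_free[OF p False])
  then show ?thesis using rep_prime[OF p] by simp
qed (simp add: hat1_def)

lemma val_hat1: "p \<in> primes \<Longrightarrow> val (hat1 p) = p"
proof (cases "p \<otimes> p divides p")
  case False
  assume p: "p \<in> primes"
  then obtain \<alpha> where \<alpha>: "hat1 p = {#rep p#} + \<alpha>" "set_mset \<alpha> \<subseteq> primes" "p = rep p \<otimes> val \<alpha>"
    using hat1_free False by blast
  then show ?thesis using rep(1)[OF primes_carrier[OF p]] by simp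
qed (simp add: hat1_def primes_carrier)

lemma hat_closed: "set_mset \<alpha> \<subseteq> primes \<Longrightarrow> set_mset (hat \<alpha>) \<subseteq> primes"
  using hat1_closed by (induction \<alpha>) auto

lemma val_hat: "set_mset \<alpha> \<subseteq> primes \<Longrightarrow> val (hat \<alpha>) = val \<alpha>"
proof (induction \<alpha>)
  case (add p \<alpha>)
  then show ?case
    using val_add[OF order_trans[OF hat1_closed primes_subset] order_trans[OF hat_closed primes_subset], of p \<alpha>]
    by (simp add: val_hat1 primes_carrier)
qed simp

text \<open>The set \<open>T\<close> may depend on the pair. Enlarging it preserves conversions, so
  unions of such sets give transitivity.\<close>

definition hat_eqv :: "'a multiset \<Rightarrow> 'a multiset \<Rightarrow> bool" where
  "hat_eqv \<alpha> \<beta> \<longleftrightarrow> (\<exists>T. finite T \<and> T \<subseteq> primes \<and> conv (expansion T) (hat \<alpha>) (hat \<beta>))"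

lemma equivp_hat_eqv: "equivp hat_eqv"
proof (rule equivpI)
  show "reflp hat_eqv" by (rule reflpI) (auto simp: hat_eqv_def intro!: exI[of _ "{}"])
  show "symp hat_eqv" by (rule sympI) (auto simp: hat_eqv_def intro: equivclp_sym)
  show "transp hat_eqv"
  proof (rule transpI)
    fix \<alpha> \<beta> \<gamma> assume "hat_eqv \<alpha> \<beta>" "hat_eqv \<beta> \<gamma>"
    then obtain T T' where *: "finite T" "T \<subseteq> primes" "conv (expansion T) (hat \<alpha>) (hat \<beta>)"
      "finite T'" "T' \<subseteq> primes" "conv (expansion T') (hat \<beta>) (hat \<gamma>)" by (auto simp: hat_eqv_def)
    have "conv (expansion (T \<union> T')) (hat \<alpha>) (hat \<beta>)" using *(3) by (rule conv_mono) (auto intro: expansion_mono)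
    moreover have "conv (expansion (T \<union> T')) (hat \<beta>) (hat \<gamma>)" using *(6) by (rule conv_mono) (auto intro: expansion_mono)
    ultimately have "conv (expansion (T \<union> T')) (hat \<alpha>) (hat \<gamma>)" by (rule conv_trans)
    with * show "hat_eqv \<alpha> \<gamma>" unfolding hat_eqv_def by (intro exI[of _ "T \<union> T'"]) auto
  qed
qed

lemma hat_eqv_add: "hat_eqv \<alpha> \<beta> \<Longrightarrow> hat_eqv (\<alpha> + \<gamma>) (\<beta> + \<gamma>)"
  unfolding hat_eqv_def by (auto intro: conv_add_right)

text \<open>Some k in \<zeta> is associated to p. In the regular case the two words are compared
  with p and k as they stand; in the free case \<open>hat\<close> has brought both to the token
  \<open>rep p\<close>, as \<open>conv_expansion_add\<close> requires.\<close>

lemma hat_eqv_token: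
  assumes p: "p \<in> primes" and \<zeta>: "set_mset \<zeta> \<subseteq> primes" and eq: "p = val \<zeta>"
  shows "hat_eqv {#p#} \<zeta>"
proof -
  have pc: "p \<in> carrier G" and \<zeta>c: "set_mset \<zeta> \<subseteq> carrier G" using p \<zeta> primes_subset by auto
  have "p divides val \<zeta>" using eq pc by simp
  then obtain k where k: "k \<in># \<zeta>" "p divides k"
    using prime_divides_mprod[OF primes_prime[OF p] pc, of "\<lambda>x. x" \<zeta>] \<zeta>c con by auto
  have "k divides p" using mprod_divides[OF k(1), of "\<lambda>x. x"] \<zeta>c eq by auto
  obtain \<gamma> where \<gamma>: "\<zeta> = add_mset k \<gamma>" using k(1) by (metis multi_member_split)
  have kp: "k \<in> primes" and \<gamma>p: "set_mset \<gamma> \<subseteq> primes" using \<zeta> by (auto simp: \<gamma>)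
  have kc: "k \<in> carrier G" and \<gamma>c: "set_mset \<gamma> \<subseteq> carrier G" using kp \<gamma>p primes_subset by auto
  have eq': "p = k \<otimes> val (hat \<gamma>)" using eq kc by (simp add: \<gamma> val_hat \<gamma>p)
  have kpa: "k \<sim> p" using \<open>k divides p\<close> k(2) by (simp add: associated_def)
  have reg: "k \<otimes> k divides k \<longleftrightarrow> p \<otimes> p divides p" using regular_cong[OF kc pc kpa] .
  show ?thesis
  proof (cases "p \<otimes> p divides p")
    case True
    then obtain T where "finite T" "T \<subseteq> primes" "conv (expansion T) {#p#} ({#k#} + hat \<gamma>)"
      using conv_expansion_regular[OF p _ kp k(2) hat_closed[OF \<gamma>p] eq'] by blast
    then show ?thesis using True reg by (auto simp: hat_eqv_def hat1_def \<gamma>)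
  next
    case False
    obtain \<alpha> where \<alpha>: "hat1 p = {#rep p#} + \<alpha>" "set_mset \<alpha> \<subseteq> primes" "p = rep p \<otimes> val \<alpha>"
      by (rule hat1_free[OF p False])
    obtain \<beta> where \<beta>: "hat1 k = {#rep p#} + \<beta>" "set_mset \<beta> \<subseteq> primes" "k = rep p \<otimes> val \<beta>"
      using hat1_free[OF kp] False reg rep_cong[OF kc pc kpa] by metis
    have rc: "rep p \<in> carrier G" "p divides rep p" using rep[OF pc] by (auto simp: associated_def)
    have c: "set_mset \<alpha> \<subseteq> carrier G" "set_mset \<beta> \<subseteq> carrier G" "set_mset (hat \<gamma>) \<subseteq> carrier G"
      using \<alpha>(2) \<beta>(2) hat_closed[OF \<gamma>p] primes_subset by auto
    have "val \<alpha> \<in> absorbs G (rep p)" using rc \<alpha>(3) by (simp add: absorbs_def)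
    moreover have "rep p \<otimes> val \<alpha> = rep p \<otimes> val (\<beta> + hat \<gamma>)"
    proof -
      have "rep p \<otimes> val (\<beta> + hat \<gamma>) = (rep p \<otimes> val \<beta>) \<otimes> val (hat \<gamma>)"
        using rc c by (simp add: val_add m_assoc)
      also have "\<dots> = p" unfolding \<beta>(3)[symmetric] by (rule eq'[symmetric])
      finally show ?thesis unfolding \<alpha>(3)[symmetric] by simp
    qed
    ultimately obtain T where "finite T" "T \<subseteq> primes" "conv (expansion T) ({#rep p#} + \<alpha>) ({#rep p#} + (\<beta> + hat \<gamma>))"
      using conv_expansion_add[OF rep_prime[OF p] \<alpha>(2), of "\<beta> + hat \<gamma>"] \<beta>(2) hat_closed[OF \<gamma>p] by auto
    then show ?thesis by (auto simp: hat_eqv_def \<gamma> \<alpha>(1) \<beta>(1) add.assoc)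
  qed
qed

lemma hat_eqv_of_val_eq:
  assumes "set_mset \<alpha> \<subseteq> primes" "set_mset \<beta> \<subseteq> primes" "val \<alpha> = val \<beta>"
  shows "hat_eqv \<alpha> \<beta>"
proof (rule refinement_mprod[OF ref con])
  show "(\<lambda>x. x) \<in> primes \<rightarrow> carrier G" by (simp add: primes_carrier)
  show "\<exists>\<alpha>. set_mset \<alpha> \<subseteq> primes \<and> x = val \<alpha>" if "x \<in> carrier G" for x
    using prime_decomposition[OF that] by blast
qed (use assms equivp_hat_eqv hat_eqv_add hat_eqv_token in simp_all)

text \<open>There may be infinitely many relations between words over \<open>S\<close>, each with
  its own finite set of primes. Redei's theorem reduces them to a finite set \<open>B\<close>, and
  the union of the sets chosen for \<open>B\<close> serves for all.\<close>

lemma finite_witness: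
  assumes S: "finite S" "S \<subseteq> primes"
  shows "\<exists>T. finite T \<and> S \<subseteq> T \<and> T \<subseteq> primes \<and>
    (\<forall>\<alpha>. set_mset \<alpha> \<subseteq> S \<longrightarrow> set_mset (hat \<alpha>) \<subseteq> T) \<and>
    (\<forall>\<alpha> \<beta>. set_mset \<alpha> \<subseteq> S \<longrightarrow> set_mset \<beta> \<subseteq> S \<longrightarrow> val \<alpha> = val \<beta> \<longrightarrow> conv (expansion T) (hat \<alpha>) (hat \<beta>))"
proof -
  \<comment> \<open>\<open>S\<close> is transported to the natural numbers, whose multisets carry
    the wellorder that \<open>redei\<close> relies on.\<close>
  obtain s where s: "bij_betw s {0..<card S} S" using ex_bij_betw_nat_finite[OF S(1)] by blast
  let ?I = "{0..<card S}"
  define E where "E a b \<longleftrightarrow> val (image_mset s a) = val (image_mset s b)" for a b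
  have im: "set_mset (image_mset s a) \<subseteq> S" if "set_mset a \<subseteq> ?I" for a
    using that s by (auto simp: bij_betw_def)
  have imc: "set_mset (image_mset s a) \<subseteq> carrier G" if "set_mset a \<subseteq> ?I" for a
    using im[OF that] S primes_subset by blast
  have "\<exists>B. finite B \<and> (\<forall>(a, b)\<in>B. E a b \<and> set_mset a \<subseteq> ?I \<and> set_mset b \<subseteq> ?I) \<and>
    (\<forall>F. equivp F \<longrightarrow> (\<forall>a b c. F a b \<longrightarrow> F (a + c) (b + c)) \<longrightarrow> (\<forall>(a, b)\<in>B. F a b) \<longrightarrow>
      (\<forall>a b. set_mset a \<subseteq> ?I \<longrightarrow> set_mset b \<subseteq> ?I \<longrightarrow> E a b \<longrightarrow> F a b))"
  proof (rule redei)
    show "finite ?I" by simp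
    show "equivp E" by (intro equivpI reflpI sympI transpI) (auto simp: E_def)
    show "E (a + c) (b + c)" if "set_mset a \<subseteq> ?I" "set_mset b \<subseteq> ?I" "set_mset c \<subseteq> ?I" "E a b" for a b c
      using that imc[of a] imc[of b] imc[of c] by (simp add: E_def val_add)
  qed
  then obtain B where B: "finite B" "\<forall>(a, b)\<in>B. E a b \<and> set_mset a \<subseteq> ?I \<and> set_mset b \<subseteq> ?I"
    and gen: "\<forall>F. equivp F \<longrightarrow> (\<forall>a b c. F a b \<longrightarrow> F (a + c) (b + c)) \<longrightarrow> (\<forall>(a, b)\<in>B. F a b) \<longrightarrow>
      (\<forall>a b. set_mset a \<subseteq> ?I \<longrightarrow> set_mset b \<subseteq> ?I \<longrightarrow> E a b \<longrightarrow> F a b)"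
    by (elim exE conjE)
  define W where "W z = (SOME T. finite T \<and> T \<subseteq> primes \<and>
    conv (expansion T) (hat (image_mset s (fst z))) (hat (image_mset s (snd z))))" for z
  have W: "finite (W z) \<and> W z \<subseteq> primes \<and> conv (expansion (W z)) (hat (image_mset s (fst z))) (hat (image_mset s (snd z)))"
    if "z \<in> B" for z
  proof -
    have "hat_eqv (image_mset s (fst z)) (image_mset s (snd z))"
    proof (rule hat_eqv_of_val_eq)
      have *: "E (fst z) (snd z) \<and> set_mset (fst z) \<subseteq> ?I \<and> set_mset (snd z) \<subseteq> ?I"
        using bspec[OF B(2) that] by (simp add: case_prod_beta)
      then show "set_mset (image_mset s (fst z)) \<subseteq> primes" "set_mset (image_mset s (snd z)) \<subseteq> primes"
        using im[of "fst z"] im[of "snd z"] S(2) by blast+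
      show "val (image_mset s (fst z)) = val (image_mset s (snd z))" using * by (simp add: E_def)
    qed
    then show ?thesis unfolding W_def hat_eqv_def by (rule someI_ex)
  qed
  \<comment> \<open>The letters of each \<open>hat1 p\<close> are included so that
    \<open>hat\<close> maps words over \<open>S\<close> to words over \<open>T\<close>.\<close>
  define T where "T = (\<Union>z\<in>B. W z) \<union> S \<union> (\<Union>p\<in>S. set_mset (hat1 p))"
  have "conv (expansion T) (hat \<alpha>) (hat \<beta>)"
    if "set_mset \<alpha> \<subseteq> S" "set_mset \<beta> \<subseteq> S" "val \<alpha> = val \<beta>" for \<alpha> \<beta>
  proof -
    let ?t = "inv_into ?I s"
    have inv: "image_mset s (image_mset ?t \<gamma>) = \<gamma> \<and> set_mset (image_mset ?t \<gamma>) \<subseteq> ?I" if "set_mset \<gamma> \<subseteq> S" for \<gamma>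
    proof -
      have "s (?t x) = x \<and> ?t x \<in> ?I" if "x \<in> S" for x
        using that s by (metis bij_betw_def f_inv_into_f inv_into_into)
      with that show ?thesis by (induction \<gamma>) auto
    qed
    let ?F = "\<lambda>a b. conv (expansion T) (hat (image_mset s a)) (hat (image_mset s b))"
    have F1: "equivp ?F"
      by (intro equivpI reflpI sympI transpI) (auto intro: equivclp_sym conv_trans)
    have F2: "\<forall>a b c. ?F a b \<longrightarrow> ?F (a + c) (b + c)" by (simp add: conv_add_right)
    have F3: "?F a b" if "(a, b) \<in> B" for a b
    proof -
      have "conv (expansion (W (a, b))) (hat (image_mset s a)) (hat (image_mset s b))" using W[OF that] by simp
      then show ?thesis
      proof (rule conv_mono)
        have "W (a, b) \<subseteq> T" using that by (auto simp: T_def)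
        then show "expansion T t A" if "expansion (W (a, b)) t A" for t A
          using that by (rule_tac expansion_mono)
      qed
    qed
    have F4: "\<forall>(a, b)\<in>B. ?F a b" by (intro ballI) (auto intro: F3)
    note I\<alpha> = inv[OF that(1)] and I\<beta> = inv[OF that(2)]
    have E: "E (image_mset ?t \<alpha>) (image_mset ?t \<beta>)" 
      using I\<alpha> I\<beta> that(3) by (simp only: E_def)
    note gen' = gen[THEN spec, THEN mp, OF F1, THEN mp, OF F2, THEN mp, OF F4]
    have "?F (image_mset ?t \<alpha>) (image_mset ?t \<beta>)"
      using gen'[THEN spec, THEN spec, THEN mp, OF conjunct2[OF I\<alpha>], THEN mp, OF conjunct2[OF I\<beta>], THEN mp, OF E] .
    then show ?thesis unfolding conjunct1[OF I\<alpha>] conjunct1[OF I\<beta>] .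
  qed
  moreover have "set_mset (hat \<alpha>) \<subseteq> T" if "set_mset \<alpha> \<subseteq> S" for \<alpha>
    using that by (induction \<alpha>) (auto simp: T_def)
  moreover have "finite T" using B(1) S(1) W by (auto simp: T_def)
  moreover have "T \<subseteq> primes"
    unfolding T_def
  proof (intro Un_least UN_least S(2))
    show "W z \<subseteq> primes" if "z \<in> B" for z using W[OF that] by simp
    show "set_mset (hat1 p) \<subseteq> primes" if "p \<in> S" for p using that S(2) by (intro hat1_closed) auto
  qed
  ultimately show ?thesis by (intro exI[of _ T] conjI allI impI) (auto simp: T_def)
qed

lemma finite_sums_eq_val:
  assumes "S \<subseteq> carrier G" shows "finite_sums G S = val ` {\<alpha>. set_mset \<alpha> \<subseteq> S}"
proof (intro equalityI subsetI)
  fix x assume "x \<in> finite_sums G S"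
  then obtain xs where "x = foldr (\<otimes>) xs \<one>" "set xs \<subseteq> S" unfolding finite_sums_def by blast
  then show "x \<in> val ` {\<alpha>. set_mset \<alpha> \<subseteq> S}"
    using foldr_eq_mprod[of xs] assms by (intro image_eqI[of _ _ "mset xs"]) auto
next
  fix x assume "x \<in> val ` {\<alpha>. set_mset \<alpha> \<subseteq> S}"
  then obtain \<alpha> where \<alpha>: "x = val \<alpha>" "set_mset \<alpha> \<subseteq> S" by blast
  obtain xs where xs: "mset xs = \<alpha>" by (metis ex_mset)
  then have "x = foldr (\<otimes>) xs \<one>" "set xs \<subseteq> S" using foldr_eq_mprod[of xs] \<alpha> assms by auto
  then show "x \<in> finite_sums G S" unfolding finite_sums_def by blast
qed

theorem tame: "tame G"
proof (rule tameI[OF ref primes_subset])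
  show "carrier G \<subseteq> finite_sums G primes"
    using prime_decomposition by (auto simp: finite_sums_eq_val[OF primes_subset])
next
  fix S :: "'a set" assume S: "finite S" "S \<subseteq> primes"
  from finite_witness[OF S] obtain T where T: "finite T" "S \<subseteq> T" "T \<subseteq> primes"
    and hatT: "\<And>\<alpha>. set_mset \<alpha> \<subseteq> S \<Longrightarrow> set_mset (hat \<alpha>) \<subseteq> T"
    and wit: "\<And>\<alpha> \<beta>. set_mset \<alpha> \<subseteq> S \<Longrightarrow> set_mset \<beta> \<subseteq> S \<Longrightarrow> val \<alpha> = val \<beta> \<Longrightarrow> conv (expansion T) (hat \<alpha>) (hat \<beta>)"
    by auto
  obtain N :: "nat monoid" and q where "presented_monoid N T (expansion T) q"
    using ex_presented_monoid_nat[OF T(1) expansion_closed expansion_confluent] by blast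
  then interpret N: presented_monoid N T "expansion T" q .
  have Tc: "T \<subseteq> carrier G" and Sc: "S \<subseteq> carrier G" using T S primes_subset by auto
  note A = finite_sums_eq_val[OF Sc] finite_sums_eq_val[OF Tc]
  \<comment> \<open>\<open>g\<close> evaluates a word, and expansions do not change the value;
    \<open>h\<close> does not depend on the chosen word because of \<open>wit\<close>. Since
    \<open>hat\<close> preserves values, \<open>g\<close> after \<open>h\<close> is the
    identity.\<close>
  define g where "g n = val (SOME \<alpha>. set_mset \<alpha> \<subseteq> T \<and> q \<alpha> = n)" for n
  define h where "h x = q (hat (SOME \<alpha>. set_mset \<alpha> \<subseteq> S \<and> val \<alpha> = x))" for x
  have g: "g (q \<alpha>) = val \<alpha>" if \<alpha>: "set_mset \<alpha> \<subseteq> T" for \<alpha>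
  proof -
    let ?\<beta> = "SOME \<beta>. set_mset \<beta> \<subseteq> T \<and> q \<beta> = q \<alpha>"
    have \<beta>: "set_mset ?\<beta> \<subseteq> T \<and> q ?\<beta> = q \<alpha>" by (rule someI) (use \<alpha> in simp)
    then have "conv (expansion T) ?\<beta> \<alpha>" using N.q_eq_iff[of ?\<beta> \<alpha>] \<alpha> by simp
    then show ?thesis unfolding g_def using \<beta> Tc by (intro expansion_value[OF Tc]) auto
  qed
  have h: "h (val \<alpha>) = q (hat \<alpha>)" if \<alpha>: "set_mset \<alpha> \<subseteq> S" for \<alpha>
  proof -
    let ?\<beta> = "SOME \<beta>. set_mset \<beta> \<subseteq> S \<and> val \<beta> = val \<alpha>"
    have \<beta>: "set_mset ?\<beta> \<subseteq> S \<and> val ?\<beta> = val \<alpha>" by (rule someI) (use \<alpha> in simp)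
    then show ?thesis unfolding h_def using N.q_eq_iff[OF hatT hatT, of ?\<beta> \<alpha>] wit[of ?\<beta> \<alpha>] \<alpha> by simp
  qed
  have valT: "val (\<alpha> + \<beta>) = val \<alpha> \<otimes> val \<beta>" if "set_mset \<alpha> \<subseteq> T" "set_mset \<beta> \<subseteq> T" for \<alpha> \<beta>
    using that Tc by (intro val_add) auto
  have "g \<in> hom N G"
  proof (rule homI)
    show "g x \<in> carrier G" for x by (simp add: g_def)
    fix x y assume "x \<in> carrier N" "y \<in> carrier N"
    then obtain \<alpha> \<beta> where "set_mset \<alpha> \<subseteq> T" "x = q \<alpha>" "set_mset \<beta> \<subseteq> T" "y = q \<beta>"
      by (metis N.q_surj)
    then show "g (x \<otimes>\<^bsub>N\<^esub> y) = g x \<otimes> g y" by (simp add: N.q_add[symmetric] g valT)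
  qed
  moreover have "g \<one>\<^bsub>N\<^esub> = \<one>" using g[of "{#}"] by (simp add: N.q_empty)
  moreover have "g ` carrier N \<subseteq> finite_sums G T" unfolding A N.q_carrier[symmetric] using g by auto
  moreover have "h ` finite_sums G S \<subseteq> carrier N" unfolding A using h hatT N.q_closed by auto
  moreover have "h \<one> = \<one>\<^bsub>N\<^esub>" using h[of "{#}"] by (simp add: N.q_empty)
  moreover have "\<forall>x\<in>finite_sums G S. \<forall>y\<in>finite_sums G S. h (x \<otimes> y) = h x \<otimes>\<^bsub>N\<^esub> h y"
    unfolding A
  proof safe
    fix \<alpha> \<beta> assume \<alpha>: "set_mset \<alpha> \<subseteq> S" "set_mset \<beta> \<subseteq> S"
    then have "val \<alpha> \<otimes> val \<beta> = val (\<alpha> + \<beta>)" using T(2) by (intro valT[symmetric]) auto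
    then show "h (val \<alpha> \<otimes> val \<beta>) = h (val \<alpha>) \<otimes>\<^bsub>N\<^esub> h (val \<beta>)"
      using \<alpha> by (simp add: h hatT N.q_add)
  qed
  moreover have "\<forall>x\<in>finite_sums G S. g (h x) = x"
    unfolding A
  proof safe
    fix \<alpha> assume \<alpha>: "set_mset \<alpha> \<subseteq> S"
    then have "set_mset \<alpha> \<subseteq> primes" using S by blast
    then show "g (h (val \<alpha>)) = val \<alpha>" using \<alpha> by (simp add: h g hatT val_hat)
  qed
  moreover have "finitely_generated_monoid N" "refinement_monoid N"
    using N.finitely_generated[OF T(1)] N.refinement by auto
  ultimately show "\<exists>T (N :: nat monoid) g h.
      finite T \<and> S \<subseteq> T \<and> T \<subseteq> primes \<and> finitely_generated_monoid N \<and> refinement_monoid N \<and>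
      g \<in> hom N G \<and> g \<one>\<^bsub>N\<^esub> = \<one> \<and> g ` carrier N \<subseteq> finite_sums G T \<and>
      h ` finite_sums G S \<subseteq> carrier N \<and> h \<one> = \<one>\<^bsub>N\<^esub> \<and>
      (\<forall>x\<in>finite_sums G S. \<forall>y\<in>finite_sums G S. h (x \<otimes> y) = h x \<otimes>\<^bsub>N\<^esub> h y) \<and>
      (\<forall>x\<in>finite_sums G S. g (h x) = x)"
    using T by (intro exI[of _ T] exI[of _ N] exI[of _ g] exI[of _ h]) simp
qed

end

theorem theorem0p1:
  shows "(\<forall>M :: 'a monoid.
            comm_monoid M \<and> primely_generated M \<and> conical M \<and> refinement_monoid M \<longrightarrow>
            (\<exists>J :: ('a, 'a) i_system. is_i_system J \<and> M \<cong> monoid_of J)) \<and>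
         (\<forall>J :: ('i, 'g) i_system. is_i_system J \<longrightarrow>
            comm_monoid (monoid_of J) \<and> primely_generated (monoid_of J) \<and>
            conical (monoid_of J) \<and> refinement_monoid (monoid_of J) \<and> tame (monoid_of J))"
proof (intro conjI allI impI)
  fix M :: "'a monoid"
  assume "comm_monoid M \<and> primely_generated M \<and> conical M \<and> refinement_monoid M"
  then interpret pg_monoid M by (simp add: pg_monoid_def pg_monoid_axioms_def)
  show "\<exists>J :: ('a, 'a) i_system. is_i_system J \<and> M \<cong> monoid_of J"
    using is_i_system_sys iso_monoid_of_sys by blast
next
  fix J :: "('i, 'g) i_system" assume "is_i_system J"
  then interpret isys J by unfold_locales
  from monoid_of_properties show "comm_monoid (monoid_of J)" "primely_generated (monoid_of J)" "conical (monoid_of J)"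
    "refinement_monoid (monoid_of J)" .
  \<comment> \<open>The properties just shown place \<open>M(J)\<close> among the primely generated
    conical refinement monoids, for which tameness has been proved.\<close>
  then interpret pg_monoid "monoid_of J" by (simp add: pg_monoid_def pg_monoid_axioms_def)
  show "tame (monoid_of J)" by (rule tame)
qed

end
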